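(* As $x\to\infty$, \[\sum_{n\le x}r_{\mathcal{R}}(n)= c\,\frac{x}{\sqrt{\log x}}\left(1+O\Bigl(\frac{1}{\log x}\Bigr)\right),\] where $c$ is the constant \[c=\frac{\pi}{4}\prod_{p\equiv 3\pmod 4}\Bigl(1-\frac{1}{p^2}\Bigr)^{-1/2},\] the product running over all primes $p\equiv 3\pmod 4$.
   Context: The sum is over positive integers $n\le x$. $\mathcal{R}$ is the set of positive integers $k$ which can be written as a sum of two squares, i.e. $k=a^2+b^2$ with integers $a\ge 0$, $b\ge 1$. $r_{\mathcal{R}}(n):=\#\{(a,b)\in\mathbb{Z}_{\ge 0}\times \mathcal{R}:\ a^2+b^2=n\}$. The notation $f(x)=O(g(x))$ means there are constants $C>0$ and $x_0$ with $|f(x)|\le C|g(x)|$ for all $x>x_0$. *)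

theory Defs
  imports "HOL-Analysis.Analysis" "HOL-Library.Landau_Symbols" "HOL-Number_Theory.Cong"
begin

definition sums_of_two_squares :: "nat set" where
  "sums_of_two_squares = {k. \<exists>a b :: nat. b \<ge> 1 \<and> k = a\<^sup>2 + b\<^sup>2}"

definition r_R :: "nat \<Rightarrow> nat" where
  "r_R n = card {(a, b). b \<in> sums_of_two_squares \<and> a\<^sup>2 + b\<^sup>2 = n}"

definition euler_factor :: "nat \<Rightarrow> real" where
  "euler_factor p =
     (if prime p \<and> [p = 3] (mod 4) then (1 - 1 / (real p)\<^sup>2) powr (- 1 / 2) else 1)"

definition c_R :: real where
  "c_R = pi / 4 * (\<Prod>p. euler_factor p)"

text \<open>
  The two lemmas below show that neither \<open>card\<close> nor \<open>prodinf\<close> takes its default value here.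
\<close>

lemma finite_r_R_set: "finite {(a, b). b \<in> sums_of_two_squares \<and> a\<^sup>2 + b\<^sup>2 = n}"
proof (rule finite_subset)
  show "{(a, b). b \<in> sums_of_two_squares \<and> a\<^sup>2 + b\<^sup>2 = n} \<subseteq> {..n} \<times> {..n}"
    by (auto simp: power2_eq_square intro: trans_le_add1 trans_le_add2 le_square)
qed simp

lemma abs_convergent_prod_euler_factor: "abs_convergent_prod euler_factor"
proof -
  have bound: "norm (euler_factor p - 1) \<le> 2 / (real p)\<^sup>2" for p
  proof (cases "prime p \<and> [p = 3] (mod 4)")
    case True
    then have p2: "p \<ge> 2" by (simp add: prime_ge_2_nat)
    define t where "t = 1 / (real p)\<^sup>2"
    have "(real p)\<^sup>2 \<ge> 2\<^sup>2" using p2 by (intro power_mono) auto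
    then have t: "0 \<le> t" "t \<le> 1 / 4" using p2 by (auto simp: t_def divide_simps)
    have u: "(1 - t) powr (- 1 / 2) = 1 / sqrt (1 - t)"
      using t by (simp add: powr_minus_divide powr_half_sqrt flip: minus_divide_left)
    have s: "1 - t \<le> sqrt (1 - t)" "sqrt (1 - t) \<le> 1" "sqrt (1 - t) > 0"
      using t by (auto intro!: real_le_rsqrt power_le_one simp: power2_eq_square mult_left_le)
    have "1 / sqrt (1 - t) \<le> 1 / (1 - t)" using s t by (intro divide_left_mono) auto
    also have "\<dots> \<le> 1 + 2 * t"
    proof -
      have "t * (1 - 2 * t) \<ge> 0" using t by simp
      then have "1 \<le> (1 + 2 * t) * (1 - t)" by (simp add: algebra_simps)
      then show ?thesis using t by (simp add: divide_simps)
    qed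
    finally have "\<bar>1 / sqrt (1 - t) - 1\<bar> \<le> 2 * t" using s by simp
    then show ?thesis using True u by (simp add: euler_factor_def t_def)
  qed (auto simp: euler_factor_def)
  have "summable (\<lambda>p. 2 / (real p)\<^sup>2)"
    using summable_mult[OF inverse_power_summable[of 2, where ?'a = real], of 2]
    by (simp add: divide_inverse)
  then have "summable (\<lambda>p. norm (euler_factor p - 1))"
    by (rule summable_comparison_test'[where N = 0]) (use bound in auto)
  then show ?thesis by (simp add: abs_convergent_prod_conv_summable)
qed

end

theory Submission
  imports Defs "HOL-Number_Theory.Number_Theory" "HOL-Complex_Analysis.Complex_Analysis"
    "HOL-Probability.Probability" "HOL-Real_Asymp.Real_Asymp"
begin

text \<open>
  The indicator function \<open>indR\<close> of sums of two squares satisfies \<open>indR ln = lamR * indR\<close> (Dirichlet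
  convolution), where \<open>lamR\<close> is supported on prime powers and differs from \<open>lamQ / 2\<close>, half the
  coefficients of the logarithmic derivative of the Dedekind zeta function of the Gaussian integers, by a
  series \<open>lamE\<close> that converges to the left of the line 1.  The inequality \<open>3 + 4 cos t + cos (2 t) \<ge> 0\<close>
  gives a region of width \<open>c / \<bar>t\<bar> powr (1/4)\<close> free of zeros of that zeta function; shifting the
  contour for a Gaussian mean of width \<open>u powr (- 3/2)\<close> into this region yields
  \<open>\<Sum>n\<le>x. lamR n = x / 2 + O(x / ln x powr (5/4))\<close>.  Any exponent larger than 1 suffices for what follows.

  By the convolution identity, \<open>M x = \<Sum>n\<le>x. indR n / n\<close> satisfies
  \<open>M(x) ln x = 3/2 \<integral> M(t) dt / t + O(M x)\<close> over \<open>[1, x]\<close>.  Hence \<open>M x\<close> is \<open>K sqrt (ln x) + O(1 / sqrt (ln x))\<close>,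
  and \<open>K\<close> is found from the Laplace transform of \<open>M \<circ> exp\<close> at 0, with \<open>Gamma (3/2)\<close> and \<open>L(1, chi) = pi / 4\<close>.
  A second use of the identity gives \<open>B x ln x = x / 2 * M x + O(x / sqrt (ln x))\<close> for the number \<open>B x\<close> of
  sums of two squares up to \<open>x\<close>.  Finally the sum of \<open>r_R\<close> is \<open>\<Sum>a\<le>sqrt x. B (sqrt (x - a\<^sup>2))\<close>, in
  which \<open>ln (sqrt (x - a\<^sup>2))\<close> may be replaced by \<open>ln x / 2\<close>, leaving a Riemann sum for a quarter disc.
\<close>

section \<open>Sums of two squares and their von Mangoldt function\<close>

definition sum2sq :: "int \<Rightarrow> bool" where
  "sum2sq n \<longleftrightarrow> (\<exists>a b. n = a\<^sup>2 + b\<^sup>2)"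

lemma sum2sq_mult: "sum2sq m \<Longrightarrow> sum2sq n \<Longrightarrow> sum2sq (m * n)"
proof -
  assume "sum2sq m" "sum2sq n"
  then obtain a b c d where "m = a\<^sup>2 + b\<^sup>2" "n = c\<^sup>2 + d\<^sup>2"
    by (auto simp: sum2sq_def)
  then have "m * n = (a * c - b * d)\<^sup>2 + (a * d + b * c)\<^sup>2"
    by (simp add: power2_eq_square algebra_simps)
  then show ?thesis by (auto simp: sum2sq_def)
qed

lemma sums_of_two_squares_iff: "n \<in> sums_of_two_squares \<longleftrightarrow> n > 0 \<and> sum2sq (int n)"
proof
  assume "n \<in> sums_of_two_squares"
  then obtain a b where "b \<ge> 1" "n = a\<^sup>2 + b\<^sup>2" by (auto simp: sums_of_two_squares_def)
  then have "n > 0" "int n = (int a)\<^sup>2 + (int b)\<^sup>2" by auto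
  then show "n > 0 \<and> sum2sq (int n)" unfolding sum2sq_def by blast
next
  assume *: "n > 0 \<and> sum2sq (int n)"
  then obtain a b where ab: "int n = a\<^sup>2 + b\<^sup>2" by (auto simp: sum2sq_def)
  have "int n = int ((nat \<bar>a\<bar>)\<^sup>2 + (nat \<bar>b\<bar>)\<^sup>2)" using ab by simp
  then have n: "n = (nat \<bar>a\<bar>)\<^sup>2 + (nat \<bar>b\<bar>)\<^sup>2" by linarith
  show "n \<in> sums_of_two_squares"
  proof (cases "b = 0")
    case True
    then have "a \<noteq> 0" using * ab by auto
    then have "nat \<bar>a\<bar> \<ge> 1" by simp
    moreover have "n = (nat \<bar>b\<bar>)\<^sup>2 + (nat \<bar>a\<bar>)\<^sup>2" using n by simp
    ultimately show ?thesis unfolding sums_of_two_squares_def by blast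
  next
    case False
    then have "nat \<bar>b\<bar> \<ge> 1" by simp
    then show ?thesis using n unfolding sums_of_two_squares_def by blast
  qed
qed

lemma prime_3_mod_4_dvd_sum2sq:
  fixes p :: nat and a b :: int
  assumes p: "prime p" "p mod 4 = 3" and dvd: "int p dvd a\<^sup>2 + b\<^sup>2"
  shows "int p dvd a"
proof (rule ccontr)
  assume na: "\<not> int p dvd a"
  have pi: "prime (int p)" using p by simp
  have nb: "\<not> int p dvd b"
  proof
    assume "int p dvd b"
    then have "int p dvd a\<^sup>2" using dvd by (simp add: power2_eq_square dvd_add_left_iff)
    then show False using na pi prime_dvd_power by blast
  qed
  obtain k where k: "p = 4 * k + 3" using p(2) by (metis div_mult_mod_eq mult.commute)
  have fermat: "[c ^ (p - 1) = 1] (mod int p)" if "\<not> int p dvd c" for c :: int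
  proof -
    have cop: "coprime c (int p)" using that pi prime_imp_coprime coprime_commute by blast
    have "[c ^ totient (nat (int p)) = 1] (mod int p)"
      using residues.euler_theorem[of "int p" c] cop p prime_gt_1_nat[of p]
      by (simp add: residues_def)
    then show ?thesis using p by (simp add: totient_prime)
  qed
  have e: "p - 1 = 2 * (2 * k + 1)" using k by simp
  have "[a\<^sup>2 = - (b\<^sup>2)] (mod int p)" using dvd by (simp add: cong_iff_dvd_diff)
  then have "[(a\<^sup>2) ^ (2 * k + 1) = (- (b\<^sup>2)) ^ (2 * k + 1)] (mod int p)" by (rule cong_pow)
  moreover have "(a\<^sup>2) ^ (2 * k + 1) = a ^ (p - 1)" unfolding e by (simp only: power_mult)
  moreover have "(- (b\<^sup>2)) ^ (2 * k + 1) = - (b ^ (p - 1))"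
    unfolding e by (simp only: power_mult) (simp add: power_minus_odd)
  ultimately have "[a ^ (p - 1) = - (b ^ (p - 1))] (mod int p)" by simp
  moreover have "[- (b ^ (p - 1)) = - 1] (mod int p)"
    using fermat[OF nb] by (simp add: cong_minus_minus_iff)
  ultimately have "[1 = - 1] (mod int p)"
    using fermat[OF na] by (metis cong_sym cong_trans)
  then have "int p dvd 2" by (simp add: cong_iff_dvd_diff)
  then have "int p \<le> 2" by (rule zdvd_imp_le) simp
  with k show False by simp
qed

lemma prime_1_mod_4_sum2sq:
  fixes p :: nat
  assumes p: "prime p" "p mod 4 = 1"
  shows "sum2sq (int p)"
proof -
  have p2: "p > 2" using p prime_ge_2_nat[of p] by (cases "p = 2") auto
  have "even ((p - 1) div 2)" using p(2) by presburger
  then obtain j where j: "(p - 1) div 2 = 2 * j" by blast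
  have "[Legendre (-1) (int p) = (-1) ^ ((p - 1) div 2)] (mod int p)"
    using euler_criterion[of p "-1"] p p2 by simp
  then have "[Legendre (-1) (int p) = 1] (mod int p)" unfolding j by simp
  moreover have "\<not> [(-1::int) = 0] (mod int p)" "\<not> [-1 = (1::int)] (mod int p)"
    using p2 zdvd_imp_le[of "int p" 2] zdvd_imp_le[of "int p" 1] by (auto simp: cong_iff_dvd_diff)
  ultimately have "QuadRes (int p) (-1)" by (auto simp: Legendre_def split: if_splits)
  then obtain x where x: "[x\<^sup>2 = -1] (mod int p)" by (auto simp: QuadRes_def)
  define k where "k = nat \<lfloor>sqrt p\<rfloor>"
  have k1: "real k \<le> sqrt p" "sqrt p < real k + 1"
    unfolding k_def by (auto simp: of_nat_nat)
  have kp: "p < (k + 1)\<^sup>2"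
  proof -
    have "(sqrt p)\<^sup>2 < (real k + 1)\<^sup>2" using k1 by (intro power_strict_mono) auto
    then have "real p < real ((k + 1)\<^sup>2)" by (simp add: add.commute)
    then show ?thesis using of_nat_less_iff by blast
  qed
  have k2: "int k ^ 2 < int p"
  proof -
    have "(real k)\<^sup>2 \<le> (sqrt p)\<^sup>2" using k1 by (intro power_mono) auto
    then have "real (k\<^sup>2) \<le> real p" by simp
    then have "k\<^sup>2 \<le> p" using of_nat_le_iff by blast
    moreover have "k\<^sup>2 \<noteq> p" using p by (metis One_nat_def numeral_eq_one_iff prime_power_iff semiring_norm(85))
    ultimately have "k\<^sup>2 < p" by simp
    then show ?thesis by (metis of_nat_less_iff of_nat_power)
  qed
  define h where "h = (\<lambda>(a, b). (int a - x * int b) mod int p)"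
  have "card (h ` ({..k} \<times> {..k})) \<le> card {0..<int p}"
    using p2 by (intro card_mono) (auto simp: h_def)
  also have "\<dots> = p" by simp
  also have "\<dots> < card ({..k} \<times> {..k})" using kp by (simp add: card_cartesian_product power2_eq_square)
  finally have "\<not> inj_on h ({..k} \<times> {..k})" by (intro pigeonhole)
  then obtain a b c d where abcd: "a \<le> k" "b \<le> k" "c \<le> k" "d \<le> k" "(a, b) \<noteq> (c, d)"
      "h (a, b) = h (c, d)"
    unfolding inj_on_def by fastforce
  define u v where "u = int a - int c" and "v = int b - int d"
  have "[u = x * v] (mod int p)"
    using abcd(6) by (simp add: h_def u_def v_def mod_eq_dvd_iff cong_iff_dvd_diff algebra_simps)
  then have "[u\<^sup>2 = (x * v)\<^sup>2] (mod int p)" by (rule cong_pow)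
  also have "(x * v)\<^sup>2 = x\<^sup>2 * v\<^sup>2" by (rule power_mult_distrib)
  also have "[x\<^sup>2 * v\<^sup>2 = -1 * v\<^sup>2] (mod int p)" using x by (intro cong_mult cong_refl)
  finally have dvd: "int p dvd u\<^sup>2 + v\<^sup>2" by (simp add: cong_iff_dvd_diff)
  have "\<bar>u\<bar> \<le> int k" "\<bar>v\<bar> \<le> int k" using abcd by (auto simp: u_def v_def)
  then have "u\<^sup>2 \<le> int k ^ 2" "v\<^sup>2 \<le> int k ^ 2" using abs_le_square_iff by fastforce+
  then have lt: "u\<^sup>2 + v\<^sup>2 < 2 * int p" using k2 by linarith
  have "u \<noteq> 0 \<or> v \<noteq> 0" using abcd by (auto simp: u_def v_def)
  then have pos: "u\<^sup>2 + v\<^sup>2 > 0" by (simp add: sum_power2_gt_zero_iff)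
  obtain m where m: "u\<^sup>2 + v\<^sup>2 = int p * m" using dvd by auto
  have "m > 0" using pos m by (metis of_nat_0_le_iff zero_less_mult_pos linorder_not_less mult_nonneg_nonpos order_less_le_trans)
  moreover have "m < 2" using lt m p2 by (metis mult.commute mult_less_cancel_left_pos of_nat_0_less_iff prime_gt_0_nat p(1))
  ultimately have "m = 1" by simp
  then show ?thesis using m unfolding sum2sq_def by (metis mult.right_neutral)
qed

lemma sum2sq_prime: "prime (p :: nat) \<Longrightarrow> p mod 4 \<noteq> 3 \<Longrightarrow> sum2sq (int p)"
proof -
  assume p: "prime p" "p mod 4 \<noteq> 3"
  show ?thesis
  proof (cases "p = 2")
    case True
    then show ?thesis by (auto simp: sum2sq_def intro!: exI[of _ 1])
  next
    case False
    then have "odd p" using p prime_odd_nat[of p] prime_ge_2_nat[of p] by auto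
    then have "p mod 4 = 1" using p by presburger
    then show ?thesis using p prime_1_mod_4_sum2sq by blast
  qed
qed

lemma sum2sq_mult_prime_iff:
  assumes p: "prime (p :: nat)" "p mod 4 \<noteq> 3"
  shows "sum2sq (int p * m) \<longleftrightarrow> sum2sq m"
proof
  assume "sum2sq m"
  then show "sum2sq (int p * m)" using sum2sq_prime[OF p] sum2sq_mult by blast
next
  assume "sum2sq (int p * m)"
  then obtain a b where ab: "int p * m = a\<^sup>2 + b\<^sup>2" by (auto simp: sum2sq_def)
  obtain c d where cd: "int p = c\<^sup>2 + d\<^sup>2" using sum2sq_prime[OF p] by (auto simp: sum2sq_def)
  have pi: "prime (int p)" using p by simp
  have key: "sum2sq m" if ab: "int p * m = a\<^sup>2 + b\<^sup>2" and dvd: "int p dvd a * c - b * d" for a b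
  proof -
    have id: "(a * c - b * d)\<^sup>2 + (a * d + b * c)\<^sup>2 = int p * (int p * m)"
      unfolding ab by (subst cd) (simp add: power2_eq_square algebra_simps)
    have "int p dvd (a * c - b * d)\<^sup>2" using dvd by (simp add: power2_eq_square)
    then have "int p dvd (a * d + b * c)\<^sup>2" using id by (metis dvd_add_right_iff dvd_triv_left)
    then have "int p dvd a * d + b * c" using pi prime_dvd_power by blast
    then obtain v where v: "a * d + b * c = int p * v" by auto
    obtain u where u: "a * c - b * d = int p * u" using dvd by auto
    have "(int p * int p) * m = (int p * int p) * (u\<^sup>2 + v\<^sup>2)"
      using id unfolding u v by (simp add: power2_eq_square algebra_simps)
    then have "m = u\<^sup>2 + v\<^sup>2" using p by simp
    then show ?thesis by (auto simp: sum2sq_def)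
  qed
  have "(a * c - b * d) * (a * c + b * d) = c\<^sup>2 * (a\<^sup>2 + b\<^sup>2) - b\<^sup>2 * (c\<^sup>2 + d\<^sup>2)"
    by (simp add: power2_eq_square algebra_simps)
  also have "\<dots> = int p * (c\<^sup>2 * m - b\<^sup>2)" unfolding ab[symmetric] cd[symmetric]
    by (simp add: algebra_simps)
  finally have "int p dvd (a * c - b * d) * (a * c + b * d)" by simp
  then consider "int p dvd a * c - b * d" | "int p dvd a * c + b * d"
    using pi prime_dvd_mult_iff by blast
  then show "sum2sq m"
  proof cases
    case 1
    then show ?thesis using key ab by blast
  next
    case 2
    then show ?thesis using key[of a "- b"] ab by simp
  qed
qed

lemma sum2sq_mult_prime_square_iff:
  assumes p: "prime (p :: nat)" "p mod 4 = 3"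
  shows "sum2sq (int p ^ 2 * m) \<longleftrightarrow> sum2sq m"
proof
  assume "sum2sq m"
  moreover have "sum2sq (int p ^ 2)" unfolding sum2sq_def by (rule exI[of _ "int p"], rule exI[of _ 0]) simp
  ultimately show "sum2sq (int p ^ 2 * m)" using sum2sq_mult by blast
next
  assume "sum2sq (int p ^ 2 * m)"
  then obtain a b where ab: "int p ^ 2 * m = a\<^sup>2 + b\<^sup>2" by (auto simp: sum2sq_def)
  then have "int p dvd a\<^sup>2 + b\<^sup>2" by (metis dvd_mult2 dvd_power zero_less_numeral)
  then have "int p dvd a" "int p dvd b"
    using prime_3_mod_4_dvd_sum2sq[OF p, of a b] prime_3_mod_4_dvd_sum2sq[OF p, of b a]
    by (simp_all only: add.commute)
  then obtain u v where "a = int p * u" "b = int p * v" unfolding dvd_def by blast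
  then have "int p ^ 2 * m = int p ^ 2 * (u\<^sup>2 + v\<^sup>2)" using ab by (simp add: power_mult_distrib algebra_simps)
  then show "sum2sq m" using p by (auto simp: sum2sq_def)
qed

definition chi :: "nat \<Rightarrow> real" where
  "chi n = (if n mod 4 = 1 then 1 else if n mod 4 = 3 then - 1 else 0)"

lemma chi_mult: "chi (m * n) = chi m * chi n"
proof -
  have "m mod 4 \<in> {0, 1, 2, 3}" "n mod 4 \<in> {0, 1, 2, 3}" by auto
  moreover have "(m * n) mod 4 = (m mod 4) * (n mod 4) mod 4" by (simp add: mod_mult_eq)
  ultimately show ?thesis unfolding chi_def by (elim insertE emptyE) simp_all
qed

lemma chi_1 [simp]: "chi (Suc 0) = 1" "chi 1 = 1"
  by (simp_all add: chi_def)

lemma chi_0 [simp]: "chi 0 = 0"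
  by (simp add: chi_def)

lemma chi_power: "chi (m ^ k) = chi m ^ k"
  by (induction k) (simp_all add: chi_mult)

lemma abs_chi_le_1: "\<bar>chi n\<bar> \<le> 1"
  by (simp add: chi_def)

definition indR :: "nat \<Rightarrow> real" where
  "indR n = (if n \<in> sums_of_two_squares then 1 else 0)"

text \<open>The von Mangoldt function attached to \<^const>\<open>indR\<close>: even powers of a prime
  \<open>p \<equiv> 3 (mod 4)\<close> have weight \<open>2 ln p\<close>, odd powers have weight 0.\<close>

definition lamR :: "nat \<Rightarrow> real" where
  "lamR n = mangoldt n * (if aprimedivisor n mod 4 = 3 then 1 + chi n else 1)"

lemma lamR_nonneg: "lamR n \<ge> 0"
  using abs_chi_le_1[of n] by (auto simp: lamR_def mangoldt_nonneg intro!: mult_nonneg_nonneg)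

lemma indR_1 [simp]: "indR (Suc 0) = 1"
proof -
  have "sum2sq 1" unfolding sum2sq_def by (rule exI[of _ 1], rule exI[of _ 0]) simp
  then show ?thesis by (simp add: indR_def sums_of_two_squares_iff)
qed

lemma indR_nonneg: "indR n \<ge> 0" and indR_le_1: "indR n \<le> 1" and indR_0 [simp]: "indR 0 = 0"
  by (auto simp: indR_def sums_of_two_squares_iff)

lemma indR_mult_prime: "prime p \<Longrightarrow> p mod 4 \<noteq> 3 \<Longrightarrow> indR (p * m) = indR m"
  by (auto simp: indR_def sums_of_two_squares_iff sum2sq_mult_prime_iff prime_gt_0_nat)

lemma indR_mult_prime_square: "prime p \<Longrightarrow> p mod 4 = 3 \<Longrightarrow> indR (p\<^sup>2 * m) = indR m"
  by (auto simp: indR_def sums_of_two_squares_iff sum2sq_mult_prime_square_iff prime_gt_0_nat)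

lemma lamR_prime_power:
  assumes "prime p" "k > 0"
  shows "lamR (p ^ k) = (if p mod 4 = 3 then (if even k then 2 * ln p else 0) else ln p)"
  using assms by (auto simp: lamR_def aprimedivisor_prime_power chi_power)
     (simp_all add: chi_def)

lemma lamR_nonzeroE:
  assumes "lamR d \<noteq> 0"
  obtains p k where "prime p" "k > 0" "d = p ^ k" "p mod 4 = 3 \<Longrightarrow> even k"
proof -
  have "primepow d" using assms by (auto simp: lamR_def mangoldt_def split: if_splits)
  then obtain p k where "prime p" "k > 0" "d = p ^ k" by (auto simp: primepow_def)
  then show thesis using that[of p k] assms lamR_prime_power[of p k] by (auto split: if_splits)
qed

lemma indR_mult_lamR:
  assumes "lamR d \<noteq> 0"
  shows "indR (d * m) = indR m"
proof -
  obtain p k where pk: "prime p" "k > 0" "d = p ^ k" "p mod 4 = 3 \<Longrightarrow> even k"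
    using assms by (rule lamR_nonzeroE) blast
  show ?thesis
  proof (cases "p mod 4 = 3")
    case True
    then obtain j where j: "k = 2 * j" using pk by auto
    have "indR ((p\<^sup>2) ^ j * m) = indR m"
      by (induction j) (use True pk indR_mult_prime_square in \<open>auto simp: mult.assoc\<close>)
    then show ?thesis using pk j by (simp add: power_mult)
  next
    case False
    have "indR (p ^ k * m) = indR m"
      by (induction k) (use False pk indR_mult_prime in \<open>auto simp: mult.assoc\<close>)
    then show ?thesis using pk by simp
  qed
qed

lemma sum_lamR_mult_prime:
  assumes p: "prime p" and m: "m > 0"
  shows "(\<Sum>d | d dvd p * m. lamR d) = (\<Sum>d | d dvd m. lamR d) + lamR (p ^ Suc (multiplicity p m))"
proof -
  let ?q = "p ^ Suc (multiplicity p m)"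
  have nu: "\<not> is_unit p" using p by auto
  have n1: "\<not> ?q dvd m" using m nu by (simp add: power_dvd_iff_le_multiplicity del: power_Suc)
  have q: "?q dvd p * m" by (auto intro: mult_dvd_mono multiplicity_dvd)
  have "(\<Sum>d | d dvd p * m. lamR d) = (\<Sum>d \<in> insert ?q {d. d dvd m}. lamR d)"
  proof (rule sum.mono_neutral_right)
    show "finite {d. d dvd p * m}" using p m prime_gt_0_nat by simp
    show "insert ?q {d. d dvd m} \<subseteq> {d. d dvd p * m}" using q by auto
    show "\<forall>d\<in>{d. d dvd p * m} - insert ?q {d. d dvd m}. lamR d = 0"
    proof (rule ballI, rule ccontr)
      fix d assume d: "d \<in> {d. d dvd p * m} - insert ?q {d. d dvd m}" and "lamR d \<noteq> 0"
      then obtain r k where rk: "prime r" "k > 0" "d = r ^ k" by (auto elim: lamR_nonzeroE)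
      have k: "k \<le> multiplicity r (p * m)"
        using d rk m p by (intro multiplicity_geI) (auto simp: prime_gt_0_nat)
      have "multiplicity r (p * m) = multiplicity r p + multiplicity r m"
        using rk p m by (intro prime_elem_multiplicity_mult_distrib) (auto simp: prime_gt_0_nat)
      also have "multiplicity r p = (if r = p then 1 else 0)"
        using rk p by (auto simp: prime_multiplicity_other)
      finally have "multiplicity r (p * m) = (if r = p then 1 else 0) + multiplicity r m" .
      moreover have "\<not> k \<le> multiplicity r m" using d rk by (auto simp: multiplicity_dvd')
      ultimately have "r = p" "k = Suc (multiplicity p m)" using k by (auto split: if_splits)
      then show False using d rk by simp
    qed
  qed
  also have "\<dots> = lamR ?q + (\<Sum>d | d dvd m. lamR d)"
    using n1 m by (subst sum.insert) auto
  finally show ?thesis by simp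
qed

lemma sum_lamR_divisors:
  assumes "n \<in> sums_of_two_squares"
  shows "(\<Sum>d | d dvd n. lamR d) = ln n"
  using assms
proof (induction n rule: less_induct)
  case (less n)
  have n0: "n > 0" using less.prems by (simp add: sums_of_two_squares_iff)
  show ?case
  proof (cases "n = 1")
    case True
    then show ?thesis by (simp add: lamR_def)
  next
    case False
    then obtain p where p: "prime p" "p dvd n" using prime_factor_nat by blast
    have p1: "p > 1" using p prime_gt_1_nat by blast
    show ?thesis
    proof (cases "p mod 4 = 3")
      case False
      obtain m where m: "n = p * m" using p by auto
      have m0: "m > 0" using m n0 by auto
      have "m \<in> sums_of_two_squares" using less.prems indR_mult_prime[OF p(1) False, of m] m
        by (auto simp: indR_def split: if_splits)
      moreover have "m < n" using m p1 m0 by simp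
      ultimately have "(\<Sum>d | d dvd m. lamR d) = ln m" using less.IH by blast
      moreover have "lamR (p ^ Suc (multiplicity p m)) = ln p"
        using lamR_prime_power[OF p(1), of "Suc (multiplicity p m)"] False by simp
      ultimately show ?thesis unfolding m using sum_lamR_mult_prime[OF p(1) m0] p1 m0
        by (simp add: ln_mult)
    next
      case True
      obtain a b where ab: "int n = a\<^sup>2 + b\<^sup>2" using less.prems by (auto simp: sums_of_two_squares_iff sum2sq_def)
      have d: "int p dvd a\<^sup>2 + b\<^sup>2" using p(2) ab by (metis int_dvd_int_iff)
      have "int p dvd a" using prime_3_mod_4_dvd_sum2sq[OF p(1) True d] .
      moreover have "int p dvd b"
        using prime_3_mod_4_dvd_sum2sq[OF p(1) True, of b a] d by (simp only: add.commute)
      ultimately have "int p ^ 2 dvd int n" unfolding ab by (intro dvd_add dvd_power_same)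
      then have "p\<^sup>2 dvd n" by (metis int_dvd_int_iff of_nat_power)
      then obtain m where m: "n = p\<^sup>2 * m" by auto
      have m0: "m > 0" using m n0 by auto
      have mR: "m \<in> sums_of_two_squares" using less.prems indR_mult_prime_square[OF p(1) True, of m] m
        by (auto simp: indR_def split: if_splits)
      have "1 < p\<^sup>2" using p1 by (intro one_less_power) auto
      then have "m < n" using m m0 by simp
      then have IH: "(\<Sum>d | d dvd m. lamR d) = ln m" using less.IH mR by blast
      let ?v = "multiplicity p m"
      have v: "multiplicity p (p * m) = Suc ?v"
        using p p1 m0 by (simp add: multiplicity_times_same)
      have "lamR (p ^ Suc ?v) + lamR (p ^ Suc (Suc ?v)) = 2 * ln p"
        using lamR_prime_power[OF p(1), of "Suc ?v"] lamR_prime_power[OF p(1), of "Suc (Suc ?v)"] True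
        by (cases "even ?v") simp_all
      then have "(\<Sum>d | d dvd p * (p * m). lamR d) = ln m + 2 * ln p"
        using sum_lamR_mult_prime[OF p(1), of "p * m"] sum_lamR_mult_prime[OF p(1) m0] IH m0 p1 v by simp
      moreover have "ln (real n) = ln m + 2 * ln p" unfolding m using p1 m0
        by (simp add: ln_mult ln_realpow)
      ultimately show ?thesis unfolding m by (simp add: power2_eq_square mult.assoc)
    qed
  qed
qed

definition dconv :: "(nat \<Rightarrow> real) \<Rightarrow> (nat \<Rightarrow> real) \<Rightarrow> nat \<Rightarrow> real" where
  "dconv a b n = (\<Sum>d | d dvd n. a d * b (n div d))"

lemma dconv_0 [simp]: "dconv a b 0 = 0"
  by (simp add: dconv_def)

lemma indR_ln: "indR n * ln n = dconv lamR indR n"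
proof (cases "n = 0")
  case False
  have "dconv lamR indR n = (\<Sum>d | d dvd n. lamR d * indR n)"
    unfolding dconv_def
  proof (rule sum.cong)
    fix d assume "d \<in> {d. d dvd n}"
    then obtain m where m: "n = d * m" by auto
    have d: "d > 0" using m False by (cases d) auto
    have "lamR d \<noteq> 0 \<Longrightarrow> indR m = indR n" using indR_mult_lamR[of d m] m by simp
    then show "lamR d * indR (n div d) = lamR d * indR n"
      using m d by (cases "lamR d = 0") auto
  qed simp
  also have "\<dots> = indR n * (\<Sum>d | d dvd n. lamR d)" by (simp add: sum_distrib_left mult.commute)
  also have "\<dots> = indR n * ln n" using sum_lamR_divisors[of n] by (simp add: indR_def)
  finally show ?thesis ..
qed simp

lemma chi_ln: "chi n * ln n = dconv (\<lambda>n. chi n * mangoldt n) chi n"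
proof (cases "n = 0")
  case False
  have "dconv (\<lambda>n. chi n * mangoldt n) chi n = (\<Sum>d | d dvd n. chi n * mangoldt d)"
    unfolding dconv_def
  proof (rule sum.cong)
    fix d assume "d \<in> {d. d dvd n}"
    then obtain m where m: "n = d * m" by auto
    have d: "d > 0" using m False by (cases d) auto
    then show "chi d * mangoldt d * chi (n div d) = chi n * mangoldt d"
      using m by (simp add: chi_mult)
  qed simp
  also have "\<dots> = chi n * ln n" using mangoldt_sum[of n, where ?'a = real] False
    by (simp flip: sum_distrib_left)
  finally show ?thesis ..
qed simp

definition one0 :: "nat \<Rightarrow> real" where "one0 n = (if n = 0 then 0 else 1)"

lemma one0_ln: "one0 n * ln n = dconv mangoldt one0 n"
proof (cases "n = 0")
  case False
  have "dconv mangoldt one0 n = (\<Sum>d | d dvd n. mangoldt d)"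
    unfolding dconv_def using False by (intro sum.cong) (auto simp: one0_def dvd_div_eq_0_iff)
  then show ?thesis using mangoldt_sum[of n, where ?'a = real] False by (simp add: one0_def)
qed simp

section \<open>Dirichlet series\<close>

definition dser :: "(nat \<Rightarrow> real) \<Rightarrow> complex \<Rightarrow> complex" where
  "dser a s = (\<Sum>n. of_real (a n) * of_nat n powr (- s))"

definition abs_conv :: "(nat \<Rightarrow> real) \<Rightarrow> real \<Rightarrow> bool" where
  "abs_conv a x \<longleftrightarrow> summable (\<lambda>n. \<bar>a n\<bar> * real n powr (- x))"

lemma norm_nat_powr: "norm (of_nat n powr s :: complex) = real n powr Re s"
  by (cases "n = 0") (auto simp: norm_powr_real_powr)

lemma abs_conv_mono:
  assumes "abs_conv a x" "x \<le> y"
  shows "abs_conv a y"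
  unfolding abs_conv_def
proof (rule summable_comparison_test'[where N = 0])
  show "summable (\<lambda>n. \<bar>a n\<bar> * real n powr (- x))" using assms by (simp add: abs_conv_def)
  fix n :: nat
  have "real n powr (- y) \<le> real n powr (- x)"
    by (cases "n = 0") (use assms in \<open>auto intro: powr_mono\<close>)
  then show "norm (\<bar>a n\<bar> * real n powr (- y)) \<le> \<bar>a n\<bar> * real n powr (- x)"
    by (simp add: mult_left_mono)
qed

lemma abs_conv_bounded:
  assumes "\<And>n. \<bar>a n\<bar> \<le> C" "x > 1"
  shows "abs_conv a x"
  unfolding abs_conv_def
proof (rule summable_comparison_test'[where N = 0])
  have "summable (\<lambda>n. real n powr (- x))" using assms by (simp add: summable_real_powr_iff)
  then show "summable (\<lambda>n. C * real n powr (- x))" by (rule summable_mult)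
  fix n :: nat
  show "norm (\<bar>a n\<bar> * real n powr (- x)) \<le> C * real n powr (- x)"
    using assms by (simp add: mult_right_mono)
qed

lemma ln_le_powr: "x \<ge> 0 \<Longrightarrow> e > 0 \<Longrightarrow> ln x \<le> x powr e / e" for x e :: real
proof (cases "x = 0")
  case False
  assume "x \<ge> 0" "e > 0"
  then have x: "x > 0" using False by simp
  have "e * ln x \<le> x powr e" using x \<open>e > 0\<close> ln_le_minus_one[of "x powr e"] by (simp add: ln_powr)
  then show ?thesis using \<open>e > 0\<close> by (simp add: field_simps)
qed auto

lemma ln_nat_nonneg: "ln (real n) \<ge> 0"
  by (cases "n = 0") auto

lemma abs_conv_ln:
  assumes "abs_conv a x" "x < y" "\<And>n. \<bar>b n\<bar> \<le> \<bar>a n\<bar> * ln n"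
  shows "abs_conv b y"
  unfolding abs_conv_def
proof (rule summable_comparison_test'[where N = 0])
  show "summable (\<lambda>n. \<bar>a n\<bar> * real n powr (- x) * (1 / (y - x)))"
    using assms unfolding abs_conv_def by (intro summable_mult2) auto
  fix n :: nat
  have "ln (real n) \<le> real n powr (y - x) / (y - x)" using assms by (intro ln_le_powr) auto
  then have "\<bar>b n\<bar> \<le> \<bar>a n\<bar> * (real n powr (y - x) / (y - x))"
    using assms(3)[of n] mult_left_mono[of "ln (real n)" _ "\<bar>a n\<bar>"] by fastforce
  then have "\<bar>b n\<bar> * real n powr (- y) \<le> \<bar>a n\<bar> * (real n powr (y - x) / (y - x)) * real n powr (- y)"
    by (rule mult_right_mono) simp
  also have "\<dots> = \<bar>a n\<bar> * (real n powr (y - x) * real n powr (- y)) * (1 / (y - x))" by simp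
  also have "real n powr (y - x) * real n powr (- y) = real n powr (- x)"
    by (simp flip: powr_add)
  finally show "norm (\<bar>b n\<bar> * real n powr (- y)) \<le> \<bar>a n\<bar> * real n powr (- x) * (1 / (y - x))"
    by (simp add: abs_mult)
qed

lemma dser_summable_norm:
  "abs_conv a (Re s) \<Longrightarrow> summable (\<lambda>n. norm (of_real (a n) * of_nat n powr (- s) :: complex))"
  by (simp add: abs_conv_def norm_mult norm_nat_powr)

lemma dser_sums:
  "abs_conv a (Re s) \<Longrightarrow> (\<lambda>n. of_real (a n) * of_nat n powr (- s)) sums dser a s"
  unfolding dser_def by (rule summable_sums[OF summable_norm_cancel[OF dser_summable_norm]])

lemma nat_powr_deriv:
  assumes "n > 0"
  shows "((\<lambda>z :: complex. of_nat n powr (- z)) has_field_derivative - (of_real (ln (real n)) * of_nat n powr (- z))) (at z within S)"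
proof -
  have "((\<lambda>z :: complex. of_nat n powr (- z)) has_field_derivative Ln (of_nat n) * of_nat n powr (- z) * (- 1)) (at z)"
    by (rule DERIV_chain2[OF has_field_derivative_powr_right])
       (use assms in \<open>auto intro!: derivative_eq_intros\<close>)
  moreover have "Ln (of_nat n) = of_real (ln (real n))" using Ln_of_nat assms by simp
  ultimately show ?thesis by (simp add: has_field_derivative_at_within)
qed

lemma dser_deriv:
  assumes "abs_conv a x" "x < Re s"
  shows "(dser a has_field_derivative - dser (\<lambda>n. a n * ln n) s) (at s)"
proof -
  obtain y where y: "x < y" "y < Re s" using assms dense by blast
  define b where "b = (\<lambda>n. a n * ln (real n))"
  define S where "S = {z. Re z > y}"
  have S: "open S" "convex S" "s \<in> S" using y by (auto simp: S_def open_halfspace_Re_gt convex_halfspace_Re_gt)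
  have b: "abs_conv b y" by (rule abs_conv_ln[OF assms(1) y(1)]) (auto simp: b_def abs_mult ln_nat_nonneg)
  have unif: "uniform_limit S (\<lambda>n z. \<Sum>i<n. - (of_real (b i) * of_nat i powr (- z))) (\<lambda>z. \<Sum>i. - (of_real (b i) * of_nat i powr (- z))) sequentially"
  proof (rule Weierstrass_m_test)
    show "summable (\<lambda>n. \<bar>b n\<bar> * real n powr (- y))" using b by (simp add: abs_conv_def)
    fix n z assume "z \<in> S"
    then have "real n powr (- Re z) \<le> real n powr (- y)"
      by (cases "n = 0") (auto simp: S_def intro: powr_mono)
    then show "norm (- (of_real (b n) * of_nat n powr (- z)) :: complex) \<le> \<bar>b n\<bar> * real n powr (- y)"
      by (simp add: norm_mult norm_nat_powr mult_left_mono)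
  qed
  have "\<exists>g. \<forall>z\<in>S. ((\<lambda>n. of_real (a n) * of_nat n powr (- z)) sums g z) \<and>
      ((g has_field_derivative (\<Sum>i. - (of_real (b i) * of_nat i powr (- z)))) (at z within S))"
  proof (rule has_complex_derivative_series[OF S(2)])
    fix n z assume "z \<in> S"
    show "((\<lambda>z. of_real (a n) * of_nat n powr (- z)) has_field_derivative - (of_real (b n) * of_nat n powr (- z))) (at z within S)"
      using DERIV_cmult[OF nat_powr_deriv[of n z S], of "of_real (a n)"]
      by (cases "n = 0") (simp_all add: b_def mult.assoc)
  next
    fix e :: real assume "e > 0"
    then have "\<forall>\<^sub>F n in sequentially. \<forall>z\<in>S. dist (\<Sum>i<n. - (of_real (b i) * of_nat i powr (- z)) :: complex) (\<Sum>i. - (of_real (b i) * of_nat i powr (- z))) < e"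
      using unif by (auto simp: uniform_limit_iff)
    then show "\<exists>N. \<forall>n z. n \<ge> N \<longrightarrow> z \<in> S \<longrightarrow> cmod ((\<Sum>i<n. - (of_real (b i) * of_nat i powr (- z))) - (\<Sum>i. - (of_real (b i) * of_nat i powr (- z)))) \<le> e"
      by (fastforce simp: eventually_sequentially dist_norm)
  next
    show "\<exists>z l. z \<in> S \<and> (\<lambda>n. of_real (a n) * of_nat n powr (- z)) sums l"
      using S(3) dser_sums[of a s] abs_conv_mono[OF assms(1), of "Re s"] assms(2) by auto
  qed
  then obtain g where g: "\<And>z. z \<in> S \<Longrightarrow> (\<lambda>n. of_real (a n) * of_nat n powr (- z)) sums g z"
      "\<And>z. z \<in> S \<Longrightarrow> (g has_field_derivative (\<Sum>i. - (of_real (b i) * of_nat i powr (- z)))) (at z within S)"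
    by blast
  have "abs_conv b (Re s)" using b y by (auto intro: abs_conv_mono)
  then have "(\<lambda>i. - (of_real (b i) * of_nat i powr (- s))) sums - dser b s"
    by (rule sums_minus[OF dser_sums])
  then have "(\<Sum>i. - (of_real (b i) * of_nat i powr (- s))) = - dser b s"
    by (simp add: sums_iff)
  then have "(g has_field_derivative - dser b s) (at s)"
    using g(2)[OF S(3)] at_within_open[OF S(3) S(1)] by simp
  moreover have "g z = dser a z" if "z \<in> S" for z
    using g(1)[OF that] by (simp add: dser_def sums_iff)
  ultimately show ?thesis unfolding b_def
    using has_field_derivative_transform_within_open[OF _ S(1) S(3)] by blast
qed

lemma dser_mult:
  assumes a: "abs_conv a (Re s)" and b: "abs_conv b (Re s)"
  shows "(\<lambda>n. of_real (dconv a b n) * of_nat n powr (- s)) sums (dser a s * dser b s)"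
proof -
  define f g where "f = (\<lambda>n. of_real (a n) * of_nat n powr (- s) :: complex)"
    and "g = (\<lambda>n. of_real (b n) * of_nat n powr (- s) :: complex)"
  have f0: "f 0 = 0" and g0: "g 0 = 0" by (simp_all add: f_def g_def)
  have fs: "(\<lambda>n. norm (f n)) summable_on UNIV" and gs: "(\<lambda>n. norm (g n)) summable_on UNIV"
    using dser_summable_norm[OF a] dser_summable_norm[OF b]
    by (auto simp: f_def g_def summable_on_UNIV_nonneg_real_iff)
  have fh: "(f has_sum dser a s) UNIV" and gh: "(g has_sum dser b s) UNIV"
    using norm_summable_imp_has_sum[OF dser_summable_norm[OF a] dser_sums[OF a]]
      norm_summable_imp_has_sum[OF dser_summable_norm[OF b] dser_sums[OF b]]
    by (simp_all add: f_def g_def)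
  define h where "h = (\<lambda>(m, k). f m * g k)"
  have "(\<lambda>x. norm (h x)) summable_on (UNIV \<times> UNIV)"
    unfolding Infinite_Sum.abs_summable_on_Sigma_iff
    using fs gs infsum_nonneg[of UNIV "\<lambda>k. norm (g k)"]
    by (auto simp: h_def norm_mult infsum_cmult_right' abs_mult
        intro!: summable_on_cmult_right summable_on_cmult_left)
  then have hs: "h summable_on (UNIV \<times> UNIV)" using abs_summable_summable by blast
  have "(h has_sum (dser a s * dser b s)) (UNIV \<times> UNIV)"
  proof (rule has_sum_SigmaI[OF _ _ hs])
    show "((\<lambda>k. h (m, k)) has_sum (f m * dser b s)) UNIV" for m
      unfolding h_def by (simp add: has_sum_cmult_right gh)
    show "((\<lambda>m. f m * dser b s) has_sum dser a s * dser b s) UNIV"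
      by (rule has_sum_cmult_left[OF fh])
  qed
  also have "?this \<longleftrightarrow> (h has_sum (dser a s * dser b s)) ({0<..} \<times> {0<..})"
    by (intro has_sum_cong_neutral) (auto simp: h_def f0 g0 intro!: Nat.gr0I)
  also have "\<dots> \<longleftrightarrow> ((\<lambda>(n, d). f d * g (n div d)) has_sum (dser a s * dser b s)) (SIGMA n:{0<..}. {d. d dvd n})"
    by (intro has_sum_reindex_bij_witness[of _ "\<lambda>(n, d). (d, n div d)" "\<lambda>(m, k). (m * k, m)"])
       (auto simp: h_def dvd_pos_nat dvd_div_eq_0_iff intro!: Nat.gr0I)
  finally have "((\<lambda>n. \<Sum>d | d dvd n. f d * g (n div d)) has_sum (dser a s * dser b s)) {0<..}"
    by (rule has_sum_Sigma') (auto intro!: has_sum_finite)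
  also have "?this \<longleftrightarrow> ((\<lambda>n. of_real (dconv a b n) * of_nat n powr (- s)) has_sum (dser a s * dser b s)) UNIV"
  proof (rule has_sum_cong_neutral)
    fix n :: nat assume "n \<in> {0<..} \<inter> UNIV"
    then have n: "n > 0" by simp
    have "(\<Sum>d | d dvd n. f d * g (n div d)) = (\<Sum>d | d dvd n. of_real (a d * b (n div d)) * of_nat n powr (- s))"
    proof (rule sum.cong)
      fix d assume "d \<in> {d. d dvd n}"
      then obtain k where k: "n = d * k" by auto
      then have "d > 0" "k > 0" using n by (auto intro: Nat.gr0I)
      moreover have "(of_nat (d * k) :: complex) powr (- s) = of_nat d powr (- s) * of_nat k powr (- s)"
        using powr_times_real_left[of "of_nat d" "of_nat k" "- s"] by simp
      ultimately show "f d * g (n div d) = of_real (a d * b (n div d)) * of_nat n powr (- s)"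
        unfolding k f_def g_def by simp
    qed simp
    then show "(\<Sum>d | d dvd n. f d * g (n div d)) = of_real (dconv a b n) * of_nat n powr (- s)"
      by (simp add: dconv_def sum_distrib_right)
  qed auto
  finally show ?thesis by (rule has_sum_imp_sums)
qed

lemma dser_tendsto:
  assumes "abs_conv a x"
  shows "((\<lambda>y. dser a (of_real y)) \<longlongrightarrow> of_real (a 1)) at_top"
proof -
  define B where "B = (\<Sum>n. \<bar>a n\<bar> * real n powr (- x))"
  have bound: "norm (dser a (of_real y) - of_real (a 1)) \<le> 2 powr (x - y) * B" if y: "y \<ge> x" for y
  proof -
    have ac: "abs_conv a y" using assms y by (rule abs_conv_mono)
    define t where "t = (\<lambda>n. of_real (a n) * of_nat n powr (- of_real y) :: complex)"
    have "(t sums dser a (of_real y))" unfolding t_def using ac by (intro dser_sums) simp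
    moreover have "(\<lambda>n. if n = 1 then of_real (a 1) else 0) sums (of_real (a 1) :: complex)"
      using sums_single[of 1 "\<lambda>n. of_real (a 1) :: complex"] by simp
    ultimately have d: "(\<lambda>n. t n - (if n = 1 then of_real (a 1) else 0)) sums (dser a (of_real y) - of_real (a 1))"
      by (rule sums_diff)
    have le: "norm (t n - (if n = 1 then of_real (a 1) else 0)) \<le> 2 powr (x - y) * (\<bar>a n\<bar> * real n powr (- x))" for n
    proof (cases "n \<ge> 2")
      case True
      have "real n powr (- y) = real n powr (x - y) * real n powr (- x)" by (simp flip: powr_add)
      also have "\<dots> \<le> 2 powr (x - y) * real n powr (- x)"
        using True y by (intro mult_right_mono powr_mono2') auto
      finally have "\<bar>a n\<bar> * real n powr (- y) \<le> \<bar>a n\<bar> * (2 powr (x - y) * real n powr (- x))"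
        by (rule mult_left_mono) simp
      then show ?thesis using True by (simp add: t_def norm_mult norm_nat_powr mult_ac)
    next
      case False
      then have "n = 0 \<or> n = 1" by auto
      then show ?thesis by (auto simp: t_def)
    qed
    have s: "summable (\<lambda>n. 2 powr (x - y) * (\<bar>a n\<bar> * real n powr (- x)))"
      using assms unfolding abs_conv_def by (rule summable_mult)
    have "norm (\<Sum>n. t n - (if n = 1 then of_real (a 1) else 0)) \<le> (\<Sum>n. 2 powr (x - y) * (\<bar>a n\<bar> * real n powr (- x)))"
      by (rule norm_suminf_le[OF le s])
    then show ?thesis using d assms unfolding B_def abs_conv_def
      by (simp add: sums_iff suminf_mult)
  qed
  have "((\<lambda>y. 2 powr (x - y) * B) \<longlongrightarrow> 0) at_top" by real_asymp
  then have "((\<lambda>y. dser a (of_real y) - of_real (a 1)) \<longlongrightarrow> 0) at_top"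
    by (rule Lim_null_comparison[rotated]) (rule eventually_mono[OF eventually_ge_at_top bound])
  then show ?thesis by (simp add: LIM_zero_iff)
qed

lemma abs_conv_div_ln:
  assumes "abs_conv a x"
  shows "abs_conv (\<lambda>n. a n / ln n) x"
  unfolding abs_conv_def
proof (rule summable_comparison_test'[where N = 0])
  show "summable (\<lambda>n. \<bar>a n\<bar> * real n powr (- x) * (1 / ln 2))"
    using assms unfolding abs_conv_def by (rule summable_mult2)
  fix n :: nat
  have "\<bar>a n / ln n\<bar> \<le> \<bar>a n\<bar> * (1 / ln 2)"
  proof (cases "n \<ge> 2")
    case True
    then have "\<bar>a n\<bar> / ln n \<le> \<bar>a n\<bar> / ln 2" by (intro divide_left_mono) auto
    then show ?thesis using True by simp
  next
    case False
    then have "n = 0 \<or> n = 1" by auto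
    then show ?thesis by auto
  qed
  then show "norm (\<bar>a n / ln n\<bar> * real n powr (- x)) \<le> \<bar>a n\<bar> * real n powr (- x) * (1 / ln 2)"
    using mult_right_mono[of "\<bar>a n / ln n\<bar>" "\<bar>a n\<bar> * (1 / ln 2)" "real n powr (- x)"] by (simp add: mult_ac)
qed

text \<open>Both sides have the same logarithmic derivative, and both tend to 1 at infinity.\<close>

lemma dser_eq_exp:
  assumes f: "f 1 = 1" "\<And>n. f n * ln n = dconv a f n" "\<And>x. x > 1 \<Longrightarrow> abs_conv f x"
    and a: "\<And>x. x > 1 \<Longrightarrow> abs_conv a x" and s: "Re s > 1"
  shows "dser f s = exp (dser (\<lambda>n. a n / ln n) s)"
proof -
  define b where "b = (\<lambda>n. a n / ln (real n))"
  have a1: "a 1 = 0" using f(1) f(2)[of 1] by (simp add: dconv_def)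
  have bl: "b n * ln n = a n" if "n > 0" for n
    using that a1 by (cases "n = 1") (auto simp: b_def)
  have ab: "abs_conv b x" if "x > 1" for x
    unfolding b_def by (rule abs_conv_div_ln[OF a[OF that]])
  define h where "h = (\<lambda>z. dser f z * exp (- dser b z))"
  define S where "S = {z. Re z > 1}"
  have S: "open S" "convex S" by (auto simp: S_def open_halfspace_Re_gt convex_halfspace_Re_gt)
  have "(h has_field_derivative 0) (at z within S)" if "z \<in> S" for z
  proof -
    have z: "Re z > 1" using that by (simp add: S_def)
    then obtain x where x: "1 < x" "x < Re z" using dense by blast
    have b': "dser (\<lambda>n. b n * ln n) z = dser a z"
      unfolding dser_def
    proof (rule suminf_cong)
      fix n :: nat
      show "of_real (b n * ln (real n)) * of_nat n powr (- z) = of_real (a n) * of_nat n powr (- z)"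
        using bl[of n] by (cases "n = 0") simp_all
    qed
    have f': "dser (\<lambda>n. f n * ln n) z = dser a z * dser f z"
      using dser_mult[OF a[OF z] f(3)[OF z]] unfolding dser_def f(2) by (simp add: sums_iff)
    have "(h has_field_derivative (- (dser a z * dser f z) * exp (- dser b z) + exp (- dser b z) * (- (- dser a z)) * dser f z)) (at z)"
      unfolding h_def
      using dser_deriv[OF f(3)[OF x(1)] x(2)] dser_deriv[OF ab[OF x(1)] x(2)] b' f'
      by (intro DERIV_mult DERIV_fun_exp DERIV_minus) simp_all
    then show ?thesis by (auto simp: algebra_simps intro: has_field_derivative_at_within)
  qed
  then obtain c where c: "\<And>z. z \<in> S \<Longrightarrow> h z = c"
    using has_field_derivative_zero_constant[OF S(2), of h] by blast
  have "((\<lambda>y. h (of_real y)) \<longlongrightarrow> of_real (f 1) * exp (- of_real (b 1))) at_top"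
    unfolding h_def by (intro tendsto_intros dser_tendsto[of _ 2] f(3) ab) auto
  then have "((\<lambda>y. h (of_real y)) \<longlongrightarrow> 1) at_top" using f(1) by (simp add: b_def)
  moreover have "\<forall>\<^sub>F y in at_top. h (of_real y) = c"
    using eventually_gt_at_top[of 1] by eventually_elim (auto intro!: c simp: S_def)
  then have "((\<lambda>y. h (of_real y)) \<longlongrightarrow> c) at_top" by (rule tendsto_eventually)
  ultimately have "c = 1" using tendsto_unique trivial_limit_at_top_linorder by blast
  then have "h s = 1" using c s by (simp add: S_def)
  then show ?thesis unfolding h_def b_def[symmetric] by (simp add: exp_minus field_simps)
qed

lemma nat_powr_Complex:
  "n > 0 \<Longrightarrow> of_nat n powr (- Complex x y) = of_real (real n powr (- x)) * cis (- y * ln n)"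
  by (rule complex_eqI) (simp_all add: powr_def Re_exp Im_exp mult.commute)

lemma Re_dser_341:
  assumes a: "\<And>n. a n \<ge> 0" "abs_conv a x"
  shows "3 * Re (dser a (Complex x 0)) + 4 * Re (dser a (Complex x t)) + Re (dser a (Complex x (2 * t))) \<ge> 0"
proof -
  have S: "(\<lambda>n. Re (of_real (a n) * of_nat n powr (- Complex x y))) sums Re (dser a (Complex x y))" for y
    using a(2) by (intro sums_Re dser_sums) simp
  have S2: "(\<lambda>n. 3 * Re (of_real (a n) * of_nat n powr (- Complex x 0)) + 4 * Re (of_real (a n) * of_nat n powr (- Complex x t)) + Re (of_real (a n) * of_nat n powr (- Complex x (2 * t))))
     sums (3 * Re (dser a (Complex x 0)) + 4 * Re (dser a (Complex x t)) + Re (dser a (Complex x (2 * t))))"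
    by (intro sums_add sums_mult S)
  have nn: "3 * Re (of_real (a n) * of_nat n powr (- Complex x 0)) + 4 * Re (of_real (a n) * of_nat n powr (- Complex x t)) + Re (of_real (a n) * of_nat n powr (- Complex x (2 * t))) \<ge> 0" for n
  proof (cases "n = 0")
    case False
    define u where "u = t * ln n"
    have "3 + 4 * cos u + cos (2 * u) = 2 * (1 + cos u)\<^sup>2"
      using cos_double_cos[of u] by (simp only: power2_eq_square) (simp add: distrib_left distrib_right)
    then have "a n * real n powr (- x) * (3 + 4 * cos u + cos (2 * u)) \<ge> 0" using a(1) by simp
    then show ?thesis using False by (simp add: nat_powr_Complex u_def algebra_simps)
  qed simp
  show ?thesis by (rule sums_le[OF nn sums_zero S2])
qed

section \<open>Continuation of the zeta and L functions\<close>

lemma series_holomorphic: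
  fixes h :: "nat \<Rightarrow> complex \<Rightarrow> complex"
  assumes hol: "\<And>n. h n holomorphic_on {s. Re s > 0}"
    and bound: "\<And>n s. Re s > 0 \<Longrightarrow> norm (h n s) \<le> K * (1 + norm s)\<^sup>2 * real (Suc n) powr (- Re s - 1)"
    and K: "K \<ge> 0"
  shows "(\<lambda>s. \<Sum>n. h n s) holomorphic_on {s. Re s > 0}"
    and "Re s > 0 \<Longrightarrow> summable (\<lambda>n. norm (h n s))"
proof -
  have summ: "summable (\<lambda>n. C * real (Suc n) powr (- x - 1))" if "x > 0" for x C
  proof -
    have "summable (\<lambda>n. real n powr (- x - 1))" using that by (simp add: summable_real_powr_iff)
    then have "summable (\<lambda>n. real (Suc n) powr (- x - 1))" by (subst summable_Suc_iff)
    then show ?thesis by (rule summable_mult)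
  qed
  show "Re s > 0 \<Longrightarrow> summable (\<lambda>n. norm (h n s))"
    by (rule summable_comparison_test'[OF summ[of "Re s"], where N = 0]) (use bound in auto)
  show "(\<lambda>s. \<Sum>n. h n s) holomorphic_on {s. Re s > 0}"
  proof (rule holomorphic_uniform_sequence)
    show "open {s. Re s > 0}" by (rule open_halfspace_Re_gt)
    show "(\<lambda>s. \<Sum>i<n. h i s) holomorphic_on {s. Re s > 0}" for n
      by (intro holomorphic_intros hol)
    fix z :: complex assume "z \<in> {s. Re s > 0}"
    then have z: "Re z > 0" by simp
    define d where "d = Re z / 2"
    have d: "d > 0" using z by (simp add: d_def)
    have near: "Re s \<ge> d \<and> norm s \<le> norm z + d" if "s \<in> cball z d" for s
    proof -
      have "norm (z - s) \<le> d" using that by (simp add: dist_norm)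
      moreover have "Re (z - s) \<le> norm (z - s)" by (rule complex_Re_le_cmod)
      moreover have "norm s \<le> norm z + norm (z - s)" using norm_triangle_ineq4[of z "z - s"] by simp
      ultimately show ?thesis by (simp add: d_def)
    qed
    have "uniform_limit (cball z d) (\<lambda>n s. \<Sum>i<n. h i s) (\<lambda>s. \<Sum>n. h n s) sequentially"
    proof (rule Weierstrass_m_test)
      show "summable (\<lambda>n. (K * (1 + (norm z + d))\<^sup>2) * real (Suc n) powr (- d - 1))"
        using summ[OF d] .
      fix n s assume s: "s \<in> cball z d"
      have "norm (h n s) \<le> K * (1 + norm s)\<^sup>2 * real (Suc n) powr (- Re s - 1)"
        using near[OF s] d by (intro bound) linarith
      also have "\<dots> \<le> K * (1 + (norm z + d))\<^sup>2 * real (Suc n) powr (- d - 1)"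
        using near[OF s] K by (intro mult_mono mult_left_mono power_mono powr_mono) auto
      finally show "norm (h n s) \<le> (K * (1 + (norm z + d))\<^sup>2) * real (Suc n) powr (- d - 1)" .
    qed
    moreover have "cball z d \<subseteq> {s. Re s > 0}" using near d by fastforce
    ultimately show "\<exists>d>0. cball z d \<subseteq> {s. Re s > 0} \<and> uniform_limit (cball z d) (\<lambda>n s. \<Sum>i<n. h i s) (\<lambda>s. \<Sum>n. h n s) sequentially"
      using d by blast
  qed
qed

lemma powr_diff_norm_le:
  fixes A c :: real and s :: complex
  assumes n: "n > 0" and s: "Re s > 0" and A: "\<And>u. n \<le> u \<Longrightarrow> u \<le> n + 1 \<Longrightarrow> \<bar>A - c * u\<bar> \<le> B"
  shows "norm ((s - 1) * of_real A * (of_real n powr (- s) - of_real (n + 1) powr (- s))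
           + of_real c * s * (of_real (n + 1) powr (1 - s) - of_real n powr (1 - s)))
         \<le> B * norm s * norm (s - 1) * n powr (- Re s - 1)"
proof -
  define f where "f = (\<lambda>w. of_real c * s * w powr (1 - s) - (s - 1) * of_real A * w powr (- s))"
  define I where "I = complex_of_real ` {n..n + 1}"
  have I: "convex I" unfolding I_def by (intro convex_linear_image linear_of_real) auto
  have B: "B \<ge> 0" using A[of n] by auto
  have "norm (f (of_real (n + 1)) - f (of_real n)) \<le> (B * norm s * norm (s - 1) * n powr (- Re s - 1)) * norm (of_real (n + 1) - of_real n :: complex)"
  proof (rule field_differentiable_bound[OF I])
    fix w assume "w \<in> I"
    then obtain u where u: "w = of_real u" "n \<le> u" "u \<le> n + 1" by (auto simp: I_def)
    have w: "w \<notin> \<real>\<^sub>\<le>\<^sub>0" using u n by (auto simp: complex_nonpos_Reals_iff)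
    have w0: "w \<noteq> 0" using w by auto
    show "(f has_field_derivative (s * (s - 1) * w powr (- s - 1) * (of_real A - of_real c * w))) (at w within I)"
    proof -
      have gen: "c' * s * ((1 - s) * (P * w)) - (s - 1) * a * (- s * P) = s * (s - 1) * P * (a - c' * w)"
        for P a c' :: complex by (simp add: algebra_simps)
      have 1: "w powr (1 - s - 1) = w powr (- s - 1) * w" using w0 by (simp add: powr_diff)
      have "(f has_field_derivative (of_real c * s * ((1 - s) * w powr (1 - s - 1)) - (s - 1) * of_real A * (- s * w powr (- s - 1)))) (at w within I)"
        unfolding f_def
        by (intro DERIV_diff DERIV_cmult has_field_derivative_at_within[OF has_field_derivative_powr] w)
      also have "of_real c * s * ((1 - s) * w powr (1 - s - 1)) - (s - 1) * of_real A * (- s * w powr (- s - 1))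
          = s * (s - 1) * w powr (- s - 1) * (of_real A - of_real c * w)"
        unfolding 1 by (rule gen)
      finally show ?thesis .
    qed
    have "norm (w powr (- s - 1)) = u powr (- Re s - 1)"
      using u n by (simp add: norm_powr_real_powr)
    also have "\<dots> \<le> n powr (- Re s - 1)" using u n s by (intro powr_mono2') auto
    finally have 1: "norm (w powr (- s - 1)) \<le> n powr (- Re s - 1)" .
    have "norm (of_real A - of_real c * w) = \<bar>A - c * u\<bar>"
      unfolding u by (metis norm_of_real of_real_diff of_real_mult)
    then have 2: "norm (of_real A - of_real c * w) \<le> B" using A u by simp
    have "norm (s * (s - 1) * w powr (- s - 1) * (of_real A - of_real c * w)) \<le> norm s * norm (s - 1) * n powr (- Re s - 1) * B"
      unfolding norm_mult by (intro mult_mono 1 2 mult_left_mono) auto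
    then show "norm (s * (s - 1) * w powr (- s - 1) * (of_real A - of_real c * w)) \<le> B * norm s * norm (s - 1) * n powr (- Re s - 1)"
      by (simp add: mult_ac)
  qed (auto simp: I_def simp del: of_real_add)
  then show ?thesis unfolding f_def by (simp add: algebra_simps)
qed

lemma powr_diff_norm_le':
  fixes s :: complex
  assumes n: "n > 0" and s: "Re s > 0"
  shows "norm (of_real n powr (- s) - of_real (n + 1) powr (- s)) \<le> norm s * n powr (- Re s - 1)"
proof -
  define I where "I = complex_of_real ` {n..n + 1}"
  have I: "convex I" unfolding I_def by (intro convex_linear_image linear_of_real) auto
  have "norm (of_real n powr (- s) - of_real (n + 1) powr (- s)) \<le> (norm s * n powr (- Re s - 1)) * norm (of_real n - of_real (n + 1) :: complex)"
  proof (rule field_differentiable_bound[OF I])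
    fix w assume "w \<in> I"
    then obtain u where u: "w = of_real u" "n \<le> u" "u \<le> n + 1" by (auto simp: I_def)
    have w: "w \<notin> \<real>\<^sub>\<le>\<^sub>0" using u n by (auto simp: complex_nonpos_Reals_iff)
    show "((\<lambda>w. w powr (- s)) has_field_derivative - s * w powr (- s - 1)) (at w within I)"
      by (rule has_field_derivative_at_within[OF has_field_derivative_powr[OF w]])
    have "norm (w powr (- s - 1)) = u powr (- Re s - 1)"
      using u n by (simp add: norm_powr_real_powr)
    also have "\<dots> \<le> n powr (- Re s - 1)" using u n s by (intro powr_mono2') auto
    finally show "norm (- s * w powr (- s - 1)) \<le> norm s * n powr (- Re s - 1)"
      by (simp add: norm_mult mult_left_mono)
  qed (auto simp: I_def simp del: of_real_add)
  then show ?thesis by simp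
qed

lemma sum_powr_le:
  assumes e: "0 < e" "e \<le> 1"
  shows "(\<Sum>n\<le>N. real n powr (e - 1)) \<le> real N powr e / e"
proof (induction N)
  case (Suc N)
  have "real (Suc N) powr (e - 1) \<le> real (Suc N) powr e / e - real N powr e / e"
  proof (cases "N = 0")
    case False
    have "\<exists>z>real N. z < real (Suc N) \<and> real (Suc N) powr e / e - real N powr e / e = (real (Suc N) - real N) * z powr (e - 1)"
      by (rule MVT2) (use False e in \<open>auto intro!: derivative_eq_intros\<close>)
    then obtain z where z: "real N < z" "z < real (Suc N)" "real (Suc N) powr e / e - real N powr e / e = z powr (e - 1)" by auto
    moreover have "real (Suc N) powr (e - 1) \<le> z powr (e - 1)" using z e by (intro powr_mono2') auto
    ultimately show ?thesis by simp
  qed (use e in simp)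
  then show ?case using Suc by simp
qed simp

lemma tail_powr_le:
  assumes N: "N > 0" and b: "1/2 \<le> b" "b \<le> 1"
  shows "summable (\<lambda>n. real (n + N) powr (- b - 1))" "(\<Sum>n. real (n + N) powr (- b - 1)) \<le> 8 * real N powr (- b)"
proof -
  define g where "g = (\<lambda>n. - (real (n + N) powr (- b)))"
  have "filterlim (\<lambda>n. real (n + N)) at_top sequentially" by real_asymp
  then have "(\<lambda>n. real (n + N) powr (- b)) \<longlonglongrightarrow> 0" using b by (intro tendsto_neg_powr) auto
  then have g0: "g \<longlonglongrightarrow> - 0" unfolding g_def by (rule tendsto_minus)
  have tel: "(\<lambda>n. g (Suc n) - g n) sums (- 0 - g 0)" using g0 by (rule telescope_sums)
  have tel8: "(\<lambda>n. 8 * (g (Suc n) - g n)) sums (8 * real N powr (- b))"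
    using sums_mult[OF tel, of 8] by (simp add: g_def)
  have le: "real (n + N) powr (- b - 1) \<le> 8 * (g (Suc n) - g n)" for n
  proof -
    let ?x = "real (n + N)"
    have x: "?x \<ge> 1" using N by linarith
    have "\<exists>z>?x. z < ?x + 1 \<and> (?x + 1) powr (- b) - ?x powr (- b) = (?x + 1 - ?x) * (- b * z powr (- b - 1))"
      by (rule MVT2) (use x in \<open>auto intro!: derivative_eq_intros\<close>)
    then obtain z where z: "?x < z" "z < ?x + 1" "(?x + 1) powr (- b) - ?x powr (- b) = - b * z powr (- b - 1)" by auto
    have "(2 * ?x) powr (- b - 1) \<le> z powr (- b - 1)" using z x b by (intro powr_mono2') auto
    moreover have "(2 * ?x) powr (- b - 1) = 2 powr (- b - 1) * ?x powr (- b - 1)" by (rule powr_mult)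
    moreover have "2 powr (- b - 1) \<ge> (2 :: real) powr (- 2)" using b by (intro powr_mono) auto
    then have "2 powr (- b - 1) * ?x powr (- b - 1) \<ge> 1 / 4 * ?x powr (- b - 1)"
      by (intro mult_right_mono) (auto simp: powr_minus)
    ultimately have q: "z powr (- b - 1) \<ge> 1 / 4 * ?x powr (- b - 1)" by linarith
    have "b * z powr (- b - 1) \<ge> 1 / 2 * (1 / 4 * ?x powr (- b - 1))"
      using q b by (intro mult_mono) auto
    then have "?x powr (- b - 1) \<le> 8 * (?x powr (- b) - (?x + 1) powr (- b))" using z(3) by simp
    then show ?thesis by (simp add: g_def add.commute algebra_simps)
  qed
  show 1: "summable (\<lambda>n. real (n + N) powr (- b - 1))"
    by (rule summable_comparison_test'[OF sums_summable[OF tel8], where N = 0]) (use le in auto)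
  show "(\<Sum>n. real (n + N) powr (- b - 1)) \<le> 8 * real N powr (- b)"
    using suminf_le[OF le 1 sums_summable[OF tel8]] tel8 by (simp add: sums_iff)
qed

locale bounded_psums =
  fixes a :: "nat \<Rightarrow> real" and c :: real
  assumes a0: "a 0 = 0" and a1: "\<bar>a n\<bar> \<le> 1"
    and c: "0 \<le> c" "c \<le> 1"
    and psum: "\<bar>(\<Sum>k\<le>n. a k) - c * real n\<bar> \<le> 1"
begin

definition A :: "nat \<Rightarrow> real" where "A n = (\<Sum>k\<le>n. a k)"

definition lterm :: "nat \<Rightarrow> complex \<Rightarrow> complex" where
  "lterm n s = of_real (A (Suc n)) * (of_real (real (Suc n)) powr (- s) - of_real (real (Suc n) + 1) powr (- s))"

definition zterm :: "nat \<Rightarrow> complex \<Rightarrow> complex" where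
  "zterm n s = (s - 1) * lterm n s + of_real c * s * (of_real (real (Suc n) + 1) powr (1 - s) - of_real (real (Suc n)) powr (1 - s))"

text \<open>The continuation of \<open>(s - 1) \<Sum> a n n powr (-s)\<close> to the right half-plane.\<close>

definition zser :: "complex \<Rightarrow> complex" where
  "zser s = of_real c * s + (\<Sum>n. zterm n s)"

lemma A_bound: "n \<le> u \<Longrightarrow> u \<le> real n + 1 \<Longrightarrow> \<bar>A n - c * u\<bar> \<le> 2"
proof -
  assume u: "n \<le> u" "u \<le> real n + 1"
  have "c * (u - n) \<le> 1 * 1" "c * (u - n) \<ge> 0" using u c by (intro mult_mono mult_nonneg_nonneg; simp)+
  then show ?thesis using psum[of n] by (simp add: A_def algebra_simps)
qed

lemma abs_A_le: "\<bar>A n\<bar> \<le> real n + 1"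
proof -
  have "c * real n \<le> 1 * real n" "c * real n \<ge> 0" using c by (intro mult_right_mono mult_nonneg_nonneg; simp)+
  then show ?thesis using psum[of n] by (simp add: A_def)
qed

lemma norm_zterm_le:
  assumes "Re s > 0"
  shows "norm (zterm n s) \<le> 2 * norm s * norm (s - 1) * real (Suc n) powr (- Re s - 1)"
  unfolding zterm_def lterm_def
  using powr_diff_norm_le[of "real (Suc n)" s "A (Suc n)" c 2] A_bound[of "Suc n"] assms
  by (simp add: mult.assoc)

lemma zterm_holomorphic: "zterm n holomorphic_on S"
  unfolding zterm_def lterm_def by (intro holomorphic_intros)

lemma norm_zterm_le':
  assumes "Re s > 0"
  shows "norm (zterm n s) \<le> 2 * (1 + norm s)\<^sup>2 * real (Suc n) powr (- Re s - 1)"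
proof -
  have "norm (s - 1) \<le> 1 + norm s" using norm_triangle_ineq4[of s 1] by simp
  then have "norm s * norm (s - 1) \<le> (1 + norm s) * (1 + norm s)" by (intro mult_mono) auto
  then have "2 * (norm s * norm (s - 1)) * real (Suc n) powr (- Re s - 1) \<le> 2 * (1 + norm s)\<^sup>2 * real (Suc n) powr (- Re s - 1)"
    by (intro mult_right_mono) (auto simp: power2_eq_square)
  moreover have "norm (zterm n s) \<le> 2 * (norm s * norm (s - 1)) * real (Suc n) powr (- Re s - 1)"
    using norm_zterm_le[OF assms, of n] by (simp only: mult.assoc)
  ultimately show ?thesis by linarith
qed

lemma zser_holomorphic: "zser holomorphic_on {s. Re s > 0}"
  unfolding zser_def
  by (intro holomorphic_intros series_holomorphic(1)[where K = 2] zterm_holomorphic norm_zterm_le') auto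

lemma zterm_summable: "Re s > 0 \<Longrightarrow> summable (\<lambda>n. norm (zterm n s))"
  by (rule series_holomorphic(2)[where K = 2, OF zterm_holomorphic norm_zterm_le']) auto

lemma sum_lterm:
  "(\<Sum>n<M. lterm n s) = (\<Sum>n\<le>Suc M. of_real (a n) * of_nat n powr (- s)) - of_real (A (Suc M)) * of_nat (Suc M) powr (- s)"
proof (induction M)
  case 0
  show ?case by (simp add: A_def a0)
next
  case (Suc M)
  have "of_real (A (Suc (Suc M))) = (of_real (A (Suc M)) + of_real (a (Suc (Suc M))) :: complex)"
    by (simp add: A_def)
  moreover have "of_real (real (Suc M)) = (of_nat (Suc M) :: complex)" "of_real (real (Suc M) + 1) = (of_nat (Suc (Suc M)) :: complex)"
    by simp_all
  ultimately show ?case using Suc unfolding lterm_def by (simp only: sum.lessThan_Suc sum.atMost_Suc[of _ "Suc M"]) (simp add: algebra_simps)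
qed

lemma sum_zterm:
  "(\<Sum>n<M. zterm n s) = (s - 1) * ((\<Sum>n\<le>Suc M. of_real (a n) * of_nat n powr (- s)) - of_real (A (Suc M)) * of_nat (Suc M) powr (- s))
     + of_real c * s * (of_nat (Suc M) powr (1 - s) - 1)"
proof -
  have "(\<Sum>n<M. of_real (real (Suc n) + 1) powr (1 - s) - of_real (real (Suc n)) powr (1 - s)) = of_nat (Suc M) powr (1 - s) - 1"
  proof (induction M)
    case (Suc M)
    have "of_real (real (Suc M)) = (of_nat (Suc M) :: complex)" "of_real (real (Suc M) + 1) = (of_nat (Suc (Suc M)) :: complex)"
      by simp_all
    then show ?case using Suc by (simp only: sum.lessThan_Suc) (simp add: algebra_simps)
  qed simp
  then show ?thesis unfolding zterm_def sum.distrib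
    by (simp only: sum_distrib_left[symmetric] sum_lterm)
qed

lemma zser_eq:
  assumes "Re s > 0"
  shows "zser s = (s - 1) * (\<Sum>n\<le>Suc M. of_real (a n) * of_nat n powr (- s)) - (s - 1) * of_real (A (Suc M)) * of_nat (Suc M) powr (- s)
    + of_real c * s * of_nat (Suc M) powr (1 - s) + (\<Sum>n. zterm (n + M) s)"
proof -
  have "(\<Sum>n. zterm n s) = (\<Sum>n<M. zterm n s) + (\<Sum>n. zterm (n + M) s)"
    using suminf_split_initial_segment[OF summable_norm_cancel[OF zterm_summable[OF assms]], of M] by simp
  then show ?thesis unfolding zser_def sum_zterm by (simp add: algebra_simps)
qed

lemma zser_eq_dser:
  assumes s: "Re s > 1"
  shows "zser s = (s - 1) * dser a s"
proof -
  have ac: "abs_conv a (Re s)" using abs_conv_bounded[of a 1] a1 s by simp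
  have s1: "(\<lambda>n. \<Sum>k\<le>n. of_real (a k) * of_nat k powr (- s)) \<longlonglongrightarrow> dser a s"
    using dser_sums[OF ac] by (simp add: sums_def_le)
  have 1: "(\<lambda>M. \<Sum>k\<le>Suc M. of_real (a k) * of_nat k powr (- s)) \<longlonglongrightarrow> dser a s"
    using LIMSEQ_Suc[OF s1] .
  have z: "(\<lambda>M. (2 * real (Suc M)) powr 1 * real (Suc M) powr (- Re s)) \<longlonglongrightarrow> 0" using s by real_asymp
  have 2: "(\<lambda>M. of_real (A (Suc M)) * of_nat (Suc M) powr (- s)) \<longlonglongrightarrow> (0 :: complex)"
  proof (rule Lim_null_comparison[OF _ z], rule always_eventually, rule allI)
    fix M show "norm (of_real (A (Suc M)) * of_nat (Suc M) powr (- s) :: complex) \<le> (2 * real (Suc M)) powr 1 * real (Suc M) powr (- Re s)"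
      unfolding norm_mult norm_nat_powr using abs_A_le[of "Suc M"] by (intro mult_mono) auto
  qed
  have z3: "(\<lambda>M. real (Suc M) powr (1 - Re s)) \<longlonglongrightarrow> 0" using s by real_asymp
  have 3: "(\<lambda>M. of_nat (Suc M) powr (1 - s)) \<longlonglongrightarrow> (0 :: complex)"
    by (rule Lim_null_comparison[OF always_eventually z3]) (simp add: norm_nat_powr del: of_nat_Suc)
  have "(\<lambda>M. \<Sum>n<M. zterm n s) \<longlonglongrightarrow> (s - 1) * (dser a s - 0) + of_real c * s * (0 - 1)"
    unfolding sum_zterm by (intro tendsto_intros 1 2 3)
  then have "(\<lambda>n. zterm n s) sums ((s - 1) * dser a s - of_real c * s)" by (simp add: sums_def)
  then show ?thesis by (simp add: zser_def sums_iff)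
qed

lemma zser_bound:
  assumes tau: "tau > 0"
  shows "\<exists>C>0. \<forall>s. 39/40 \<le> Re s \<longrightarrow> Re s \<le> 3 \<longrightarrow> norm (s - 1) \<ge> tau \<longrightarrow>
           norm (zser s) \<le> C * norm (s - 1) * (1 + \<bar>Im s\<bar>) powr (1/40)"
proof -
  define C where "C = 2 * (40 + 2 + (1 + 1 / tau) + 48)"
  have "norm (zser s) \<le> C * norm (s - 1) * (1 + \<bar>Im s\<bar>) powr (1/40)"
    if s: "39/40 \<le> Re s" "Re s \<le> 3" "norm (s - 1) \<ge> tau" for s
  proof -
    define T where "T = 1 + \<bar>Im s\<bar>"
    define M where "M = nat \<lceil>\<bar>Im s\<bar>\<rceil>"
    define N where "N = real (Suc M)"
    have "real M = of_int \<lceil>\<bar>Im s\<bar>\<rceil>" by (simp add: M_def)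
    then have "\<bar>Im s\<bar> \<le> real M" "real M \<le> \<bar>Im s\<bar> + 1" by linarith+
    then have TN: "T \<le> N" "N \<le> 2 * T" by (simp_all add: N_def T_def)
    have N1: "N \<ge> 1" by (simp add: N_def)
    have T1: "T \<ge> 1" by (simp add: T_def)
    have s0: "Re s > 0" using s by simp
    have ns: "norm s \<le> 3 * T" using cmod_le[of s] s by (simp add: T_def)
    have np: "n powr (- Re s) \<le> n powr (- 39/40)" if "n = 0 \<or> n \<ge> 1" for n :: real
      using that s by (auto intro: powr_mono)
    have N40: "N * N powr (- 39/40) = N powr (1/40)" using N1 powr_add[of N 1 "- 39/40"] by simp
    have 1: "norm (\<Sum>n\<le>Suc M. of_real (a n) * of_nat n powr (- s) :: complex) \<le> 40 * N powr (1/40)"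
    proof -
      have "norm (\<Sum>n\<le>Suc M. of_real (a n) * of_nat n powr (- s) :: complex) \<le> (\<Sum>n\<le>Suc M. real n powr (1/40 - 1))"
      proof (rule sum_norm_le)
        fix n
        have "norm (of_real (a n) * of_nat n powr (- s) :: complex) \<le> 1 * real n powr (- 39/40)"
        proof -
          have "real n powr (- Re s) \<le> real n powr (- 39/40)" by (rule np) (cases n; simp)
          then show ?thesis unfolding norm_mult norm_nat_powr norm_of_real uminus_complex.sel
            using a1[of n] by (intro mult_mono) simp_all
        qed
        then show "norm (of_real (a n) * of_nat n powr (- s) :: complex) \<le> real n powr (1/40 - 1)" by simp
      qed
      also have "\<dots> \<le> N powr (1/40) / (1/40)" unfolding N_def by (rule sum_powr_le) auto
      finally show ?thesis by simp
    qed
    have 2: "norm (of_real (A (Suc M)) * of_nat (Suc M) powr (- s) :: complex) \<le> 2 * N powr (1/40)"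
    proof -
      have "norm (of_real (A (Suc M)) * of_nat (Suc M) powr (- s) :: complex) \<le> (2 * N) * N powr (- 39/40)"
        unfolding norm_mult norm_nat_powr using abs_A_le[of "Suc M"] np[of N] N1
        by (intro mult_mono) (auto simp: N_def)
      then show ?thesis using N40 by simp
    qed
    have 3: "norm (of_real c * s * of_nat (Suc M) powr (1 - s)) \<le> (1 + 1 / tau) * norm (s - 1) * N powr (1/40)"
    proof -
      have "norm s \<le> norm (s - 1) + 1" using norm_triangle_ineq[of "s - 1" 1] by simp
      also have "1 \<le> 1 / tau * norm (s - 1)" using s tau by (simp add: field_simps)
      finally have "norm s \<le> (1 + 1 / tau) * norm (s - 1)" by (simp add: algebra_simps)
      moreover have "N powr (1 - Re s) \<le> N powr (1/40)" using N1 s by (intro powr_mono) auto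
      ultimately have "(c * norm s) * N powr (1 - Re s) \<le> (1 * ((1 + 1 / tau) * norm (s - 1))) * N powr (1/40)"
        using c tau by (intro mult_mono) auto
      then show ?thesis using c unfolding norm_mult norm_nat_powr N_def[symmetric] by simp
    qed
    have 4: "norm (\<Sum>n. zterm (n + M) s) \<le> 48 * norm (s - 1) * N powr (1/40)"
    proof -
      have t: "norm (zterm (n + M) s) \<le> 2 * norm s * norm (s - 1) * real (n + Suc M) powr (- 39/40 - 1)" for n
      proof -
        have "norm (zterm (n + M) s) \<le> 2 * norm s * norm (s - 1) * real (Suc (n + M)) powr (- Re s - 1)"
          by (rule norm_zterm_le[OF s0])
        also have "\<dots> \<le> 2 * norm s * norm (s - 1) * real (Suc (n + M)) powr (- 39/40 - 1)"
          using s by (intro mult_left_mono powr_mono) auto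
        finally show ?thesis by simp
      qed
      have S: "summable (\<lambda>n. 2 * norm s * norm (s - 1) * real (n + Suc M) powr (- 39/40 - 1))"
        using tail_powr_le(1)[of "Suc M" "39/40"] by (intro summable_mult) auto
      have "norm (\<Sum>n. zterm (n + M) s) \<le> (\<Sum>n. 2 * norm s * norm (s - 1) * real (n + Suc M) powr (- 39/40 - 1))"
        by (rule norm_suminf_le[OF t S])
      also have "\<dots> = 2 * norm s * norm (s - 1) * (\<Sum>n. real (n + Suc M) powr (- 39/40 - 1))"
        using tail_powr_le(1)[of "Suc M" "39/40"] by (intro suminf_mult) auto
      also have "\<dots> \<le> 2 * norm s * norm (s - 1) * (8 * N powr (- 39/40))"
        using tail_powr_le(2)[of "Suc M" "39/40"] by (intro mult_left_mono) (auto simp: N_def)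
      also have "\<dots> = (16 * norm (s - 1)) * (norm s * N powr (- 39/40))" by simp
      also have "\<dots> \<le> (16 * norm (s - 1)) * ((3 * N) * N powr (- 39/40))"
        using ns TN by (intro mult_left_mono mult_right_mono) auto
      also have "\<dots> = 48 * norm (s - 1) * N powr (1/40)" using N40 by simp
      finally show ?thesis .
    qed
    have "zser s = (s - 1) * (\<Sum>n\<le>Suc M. of_real (a n) * of_nat n powr (- s)) - (s - 1) * (of_real (A (Suc M)) * of_nat (Suc M) powr (- s))
        + of_real c * s * of_nat (Suc M) powr (1 - s) + (\<Sum>n. zterm (n + M) s)"
      using zser_eq[OF s0, of M] by (simp only: mult.assoc)
    then have "norm (zser s) \<le> norm (s - 1) * norm (\<Sum>n\<le>Suc M. of_real (a n) * of_nat n powr (- s) :: complex)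
        + norm (s - 1) * norm (of_real (A (Suc M)) * of_nat (Suc M) powr (- s) :: complex)
        + norm (of_real c * s * of_nat (Suc M) powr (1 - s)) + norm (\<Sum>n. zterm (n + M) s)"
      by (simp only: norm_mult[symmetric]) (intro order_trans[OF norm_triangle_ineq] add_mono order_trans[OF norm_triangle_ineq4] order_refl)
    also have "\<dots> \<le> norm (s - 1) * (40 * N powr (1/40)) + norm (s - 1) * (2 * N powr (1/40))
        + (1 + 1 / tau) * norm (s - 1) * N powr (1/40) + 48 * norm (s - 1) * N powr (1/40)"
      by (intro add_mono mult_left_mono 1 2 3 4) auto
    also have "\<dots> = (40 + 2 + (1 + 1 / tau) + 48) * norm (s - 1) * N powr (1/40)" by (simp add: algebra_simps)
    finally have E: "norm (zser s) \<le> (40 + 2 + (1 + 1 / tau) + 48) * norm (s - 1) * N powr (1/40)" .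
    have "N powr (1/40) \<le> 2 * T powr (1/40)"
    proof -
      have "N powr (1/40) \<le> (2 * T) powr (1/40)" using TN N1 by (intro powr_mono2) auto
      also have "\<dots> = 2 powr (1/40) * T powr (1/40)" using T1 by (simp add: powr_mult)
      also have "\<dots> \<le> 2 powr 1 * T powr (1/40)" by (intro mult_right_mono powr_mono) auto
      finally show ?thesis by simp
    qed
    then have "(40 + 2 + (1 + 1 / tau) + 48) * norm (s - 1) * N powr (1/40) \<le> (40 + 2 + (1 + 1 / tau) + 48) * norm (s - 1) * (2 * T powr (1/40))"
      using tau by (intro mult_left_mono mult_nonneg_nonneg) auto
    also have "\<dots> = C * norm (s - 1) * T powr (1/40)" by (simp only: C_def mult_ac)
    finally show ?thesis using E unfolding T_def by linarith
  qed
  moreover have "C > 0" using tau by (simp add: C_def add_pos_pos)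
  ultimately show ?thesis by blast
qed

lemma zser_1: "zser 1 = of_real c"
proof -
  have "complex_of_real (real (Suc n) + 1) \<noteq> 0" "complex_of_real (real (Suc n)) \<noteq> 0" for n
    by (simp_all only: of_real_eq_0_iff)
  then have "zterm n 1 = 0" for n by (simp add: zterm_def del: of_nat_Suc of_real_add)
  then show ?thesis by (simp add: zser_def)
qed

end

interpretation Z: bounded_psums one0 1
proof
  have "(\<Sum>k\<le>n. one0 k) = real n" for n by (induction n) (simp_all add: one0_def)
  then show "\<bar>(\<Sum>k\<le>n. one0 k) - 1 * real n\<bar> \<le> 1" for n by simp
qed (auto simp: one0_def)

lemma sum_chi: "(\<Sum>k\<le>n. chi k) = (if n mod 4 = 1 \<or> n mod 4 = 2 then 1 else 0)"
proof (induction n)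
  case (Suc n)
  have "n mod 4 \<in> {0, 1, 2, 3}" by auto
  then show ?case unfolding sum.atMost_Suc Suc
    by (elim insertE emptyE) (simp_all add: mod_Suc chi_def)
qed simp

interpretation X: bounded_psums chi 0
  by unfold_locales (use abs_chi_le_1 in \<open>simp_all add: sum_chi\<close>)

definition Lchi :: "complex \<Rightarrow> complex" where
  "Lchi s = (\<Sum>n. X.lterm n s)"

lemma norm_Xlterm_le:
  assumes "Re s > 0"
  shows "norm (X.lterm n s) \<le> 1 * (1 + norm s)\<^sup>2 * real (Suc n) powr (- Re s - 1)"
proof -
  have "\<bar>X.A (Suc n)\<bar> \<le> 1" by (simp add: X.A_def sum_chi del: sum.atMost_Suc)
  then have "norm (X.lterm n s) \<le> 1 * (norm s * real (Suc n) powr (- Re s - 1))"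
    unfolding X.lterm_def norm_mult
    using powr_diff_norm_le'[of "real (Suc n)" s] assms by (intro mult_mono) auto
  also have "norm s \<le> (1 + norm s)\<^sup>2" by (simp add: power2_eq_square algebra_simps add_nonneg_nonneg)
  finally show ?thesis by (simp add: mult_right_mono)
qed

lemma Lchi_holomorphic: "Lchi holomorphic_on {s. Re s > 0}"
  unfolding Lchi_def
  by (intro series_holomorphic(1)[where K = 1] norm_Xlterm_le)
     (auto simp: X.lterm_def intro!: holomorphic_intros)

lemma Lchi_sums: "Re s > 0 \<Longrightarrow> (\<lambda>n. X.lterm n s) sums Lchi s"
  unfolding Lchi_def
  by (intro summable_sums summable_norm_cancel[OF series_holomorphic(2)[where K = 1]] norm_Xlterm_le)
     (auto simp: X.lterm_def intro!: holomorphic_intros)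

lemma Xzser_eq: "Re s > 0 \<Longrightarrow> X.zser s = (s - 1) * Lchi s"
  using sums_mult[OF Lchi_sums[of s], of "s - 1"] by (simp add: X.zser_def X.zterm_def sums_iff)

lemma Lchi_eq_dser:
  assumes "Re s > 1"
  shows "Lchi s = dser chi s"
  using X.zser_eq_dser[OF assms] Xzser_eq[of s] assms by (cases "s = 1") auto

lemma Lchi_1: "Lchi 1 = of_real (pi / 4)"
proof -
  have part: "(\<Sum>n\<le>4 * k. chi n / real n) = (\<Sum>j<2 * k. (-1) ^ j * 1 / real (j * 2 + 1))" for k
  proof (induction k)
    case (Suc k)
    have "4 * Suc k = Suc (Suc (Suc (Suc (4 * k))))" "2 * Suc k = Suc (Suc (2 * k))" by simp_all
    moreover have "chi (Suc (4 * k)) = 1" "chi (Suc (Suc (4 * k))) = 0" "chi (Suc (Suc (Suc (4 * k)))) = - 1" "chi (Suc (Suc (Suc (Suc (4 * k))))) = 0"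
      by (simp_all add: chi_def mod_Suc)
    ultimately show ?case using Suc by (simp only: sum.atMost_Suc sum.lessThan_Suc) (simp add: algebra_simps)
  qed simp
  have "(\<lambda>j. (-1) ^ j * 1 / real (j * 2 + 1)) sums (pi / 4)"
    using pi_series summable_arctan_series[of 1] by (simp add: sums_iff)
  then have "(\<lambda>n. \<Sum>j<n. (-1) ^ j * 1 / real (j * 2 + 1)) \<longlonglongrightarrow> pi / 4" by (simp add: sums_def)
  then have "(\<lambda>k. \<Sum>j<2 * k. (-1) ^ j * 1 / real (j * 2 + 1)) \<longlonglongrightarrow> pi / 4"
    by (rule filterlim_compose) (auto intro!: filterlim_subseq strict_monoI)
  then have p: "(\<lambda>k. \<Sum>n\<le>4 * k. chi n / real n) \<longlonglongrightarrow> pi / 4" by (simp only: part)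
  have "(\<lambda>M. \<Sum>n<M. X.lterm n 1) \<longlonglongrightarrow> Lchi 1" using Lchi_sums[of 1] by (simp add: sums_def)
  then have "(\<lambda>k. \<Sum>n<4 * k + 3. X.lterm n 1) \<longlonglongrightarrow> Lchi 1"
    by (rule filterlim_compose) (auto intro!: filterlim_subseq strict_monoI)
  moreover have "(\<Sum>n<4 * k + 3. X.lterm n 1) = of_real (\<Sum>n\<le>4 * Suc k. chi n / real n)" for k
  proof -
    have "X.A (Suc (4 * k + 3)) = 0" by (simp add: X.A_def sum_chi mod_Suc del: sum.atMost_Suc)
    moreover have "Suc (4 * k + 3) = 4 * Suc k" by simp
    ultimately have "(\<Sum>n<4 * k + 3. X.lterm n 1) = (\<Sum>n\<le>4 * Suc k. of_real (chi n) * of_nat n powr (- 1))"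
      using X.sum_lterm[of 1 "4 * k + 3"] by (simp only:) simp
    also have "\<dots> = of_real (\<Sum>n\<le>4 * Suc k. chi n / real n)"
      unfolding of_real_sum by (intro sum.cong) (auto simp: powr_minus divide_inverse)
    finally show ?thesis .
  qed
  ultimately have "(\<lambda>k. of_real (\<Sum>n\<le>4 * Suc k. chi n / real n)) \<longlonglongrightarrow> Lchi 1" by (simp only:)
  moreover have "(\<lambda>k. of_real (\<Sum>n\<le>4 * Suc k. chi n / real n)) \<longlonglongrightarrow> (of_real (pi / 4) :: complex)"
    using tendsto_of_real[OF LIMSEQ_Suc[OF p]] .
  ultimately show ?thesis using LIMSEQ_unique by blast
qed

lemma dser_add:
  assumes "abs_conv a (Re s)" "abs_conv b (Re s)"
  shows "dser (\<lambda>n. a n + b n) s = dser a s + dser b s"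
  using sums_add[OF dser_sums[OF assms(1)] dser_sums[OF assms(2)]]
  by (simp add: dser_def sums_iff distrib_right)

lemma abs_conv_one0: "x > 1 \<Longrightarrow> abs_conv one0 x"
  by (rule abs_conv_bounded[of _ 1]) (auto simp: one0_def)

lemma abs_conv_chi: "x > 1 \<Longrightarrow> abs_conv chi x"
  by (rule abs_conv_bounded[of _ 1]) (auto intro: abs_chi_le_1)

lemma abs_conv_mangoldt_bound:
  assumes "\<And>n. \<bar>a n\<bar> \<le> C * mangoldt n" "x > 1"
  shows "abs_conv a x"
proof -
  obtain y where y: "1 < y" "y < x" using assms dense by blast
  have C: "C \<ge> 0" using assms(1)[of 2] abs_ge_zero[of "a 2"]
    by (metis ln_gt_zero_iff mangoldt_prime of_nat_numeral of_real_eq_id id_apply one_less_numeral_iff order_trans semiring_norm(76) two_is_prime_nat zero_le_mult_iff linorder_not_less zero_less_numeral)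
  have "abs_conv (\<lambda>n. C * one0 n) y" by (rule abs_conv_bounded[of _ "\<bar>C\<bar>"]) (use y in \<open>auto simp: one0_def\<close>)
  then show ?thesis
  proof (rule abs_conv_ln[OF _ y(2)])
    fix n :: nat
    have "\<bar>a n\<bar> \<le> C * mangoldt n" by (rule assms)
    also have "\<dots> \<le> C * (one0 n * ln n)" using C mangoldt_le[of n] by (intro mult_left_mono) (auto simp: one0_def)
    finally show "\<bar>a n\<bar> \<le> \<bar>C * one0 n\<bar> * ln n" using C by (simp add: one0_def abs_mult)
  qed
qed

definition lamQ :: "nat \<Rightarrow> real" where "lamQ n = (1 + chi n) * mangoldt n"

lemma lamQ_nonneg: "lamQ n \<ge> 0"
  using abs_chi_le_1[of n] by (auto simp: lamQ_def mangoldt_nonneg intro!: mult_nonneg_nonneg)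

lemma lamQ_le: "lamQ n \<le> 2 * mangoldt n"
  using abs_chi_le_1[of n] by (auto simp: lamQ_def mangoldt_nonneg intro!: mult_right_mono)

lemma abs_conv_lamQ: "x > 1 \<Longrightarrow> abs_conv lamQ x"
  using lamQ_le lamQ_nonneg by (intro abs_conv_mangoldt_bound[of _ 2]) auto

lemma dser_one0_chi_eq_exp:
  assumes s: "Re s > 1"
  shows "dser one0 s * dser chi s = exp (dser (\<lambda>n. lamQ n / ln n) s)"
proof -
  have m: "abs_conv mangoldt x" if "x > 1" for x
    using that mangoldt_nonneg by (intro abs_conv_mangoldt_bound[of _ 1]) auto
  have cm: "abs_conv (\<lambda>n. chi n * mangoldt n) x" if "x > 1" for x
    using that abs_chi_le_1 mangoldt_nonneg
    by (intro abs_conv_mangoldt_bound[of _ 1]) (auto simp: abs_mult intro!: mult_left_le_one_le)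
  have "dser one0 s = exp (dser (\<lambda>n. mangoldt n / ln n) s)"
    by (rule dser_eq_exp) (use s m one0_ln abs_conv_one0 in \<open>auto simp: one0_def\<close>)
  moreover have "dser chi s = exp (dser (\<lambda>n. chi n * mangoldt n / ln n) s)"
    by (rule dser_eq_exp) (use s cm chi_ln abs_conv_chi in auto)
  moreover have "dser (\<lambda>n. lamQ n / ln n) s = dser (\<lambda>n. mangoldt n / ln n) s + dser (\<lambda>n. chi n * mangoldt n / ln n) s"
    using dser_add[OF abs_conv_div_ln[OF m[OF s]] abs_conv_div_ln[OF cm[OF s]]]
    by (simp add: lamQ_def distrib_right add_divide_distrib)
  ultimately show ?thesis by (simp add: exp_add)
qed

section \<open>The zero-free region\<close>

text \<open>\<open>(s - 1)\<close> times the Dedekind zeta function of the Gaussian integers.\<close>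

definition Kfun :: "complex \<Rightarrow> complex" where
  "Kfun s = Z.zser s * Lchi s"

lemma Kfun_holomorphic: "Kfun holomorphic_on {s. Re s > 0}"
  unfolding Kfun_def by (intro holomorphic_intros Z.zser_holomorphic Lchi_holomorphic)

lemma Kfun_1: "Kfun 1 = of_real (pi / 4)"
  by (simp add: Kfun_def Z.zser_1 Lchi_1)

lemma Kfun_eq_exp:
  assumes "Re s > 1"
  shows "Kfun s = (s - 1) * exp (dser (\<lambda>n. lamQ n / ln n) s)"
  using dser_one0_chi_eq_exp[OF assms] Z.zser_eq_dser[OF assms] Lchi_eq_dser[OF assms]
  by (simp add: Kfun_def)

lemma Kfun_log_deriv:
  assumes s: "Re s > 1"
  shows "deriv Kfun s / Kfun s = 1 / (s - 1) - dser lamQ s"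
proof -
  obtain x where x: "1 < x" "x < Re s" using s dense by blast
  have l1: "lamQ (Suc 0) = 0" by (simp add: lamQ_def)
  have e: "dser (\<lambda>n. lamQ n / ln n * ln n) s = dser lamQ s"
    unfolding dser_def
  proof (rule suminf_cong)
    fix n :: nat
    show "of_real (lamQ n / ln n * ln n) * of_nat n powr (- s) = of_real (lamQ n) * of_nat n powr (- s)"
      using l1 by (cases "n = 0 \<or> n = 1") auto
  qed
  have "((\<lambda>s. (s - 1) * exp (dser (\<lambda>n. lamQ n / ln n) s)) has_field_derivative
      1 * exp (dser (\<lambda>n. lamQ n / ln n) s) + exp (dser (\<lambda>n. lamQ n / ln n) s) * (- dser lamQ s) * (s - 1)) (at s)"
    using dser_deriv[OF abs_conv_div_ln[OF abs_conv_lamQ[OF x(1)]] x(2)] e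
    by (intro DERIV_mult DERIV_fun_exp) (auto intro!: derivative_eq_intros)
  then have "(Kfun has_field_derivative
      1 * exp (dser (\<lambda>n. lamQ n / ln n) s) + exp (dser (\<lambda>n. lamQ n / ln n) s) * (- dser lamQ s) * (s - 1)) (at s)"
    by (rule has_field_derivative_transform_within_open[of _ _ _ "{s. Re s > 1}"])
       (use s Kfun_eq_exp in \<open>auto simp: open_halfspace_Re_gt\<close>)
  then have "deriv Kfun s = exp (dser (\<lambda>n. lamQ n / ln n) s) * (1 - dser lamQ s * (s - 1))"
    by (simp add: DERIV_imp_deriv algebra_simps)
  moreover have "s - 1 \<noteq> 0" using s by auto
  moreover have "(e * (1 - d * w)) / (w * e) = 1 / w - d" if "e \<noteq> 0" "w \<noteq> 0" for e d w :: complex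
    using that by (simp add: field_simps)
  ultimately show ?thesis using Kfun_eq_exp[OF s] by (simp only: exp_not_eq_zero not_False_eq_True)
qed

lemma Kfun_nonzero: "Re s > 1 \<Longrightarrow> Kfun s \<noteq> 0"
  using Kfun_eq_exp[of s] by auto

lemma norm_Kfun_341:
  assumes "x > 1"
  defines "k \<equiv> \<lambda>t. norm (Kfun (Complex x t) / (Complex x t - 1))"
  shows "k 0 ^ 3 * k t ^ 4 * k (2 * t) \<ge> 1"
proof -
  let ?g = "dser (\<lambda>n. lamQ n / ln n)"
  have k: "k y = exp (Re (?g (Complex x y)))" for y
  proof -
    have "Complex x y \<noteq> 1" using assms(1) by (auto simp: complex_eq_iff)
    then show ?thesis unfolding k_def using Kfun_eq_exp[of "Complex x y"] assms(1) by simp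
  qed
  have nn: "lamQ n / ln n \<ge> 0" for n using lamQ_nonneg[of n] ln_nat_nonneg[of n] by simp
  have "0 \<le> 3 * Re (?g (Complex x 0)) + 4 * Re (?g (Complex x t)) + Re (?g (Complex x (2 * t)))"
    by (rule Re_dser_341[OF nn abs_conv_div_ln[OF abs_conv_lamQ[OF assms(1)]]])
  then have "1 \<le> exp (3 * Re (?g (Complex x 0)) + 4 * Re (?g (Complex x t)) + Re (?g (Complex x (2 * t))))" by simp
  also have "\<dots> = k 0 ^ 3 * k t ^ 4 * k (2 * t)"
    unfolding k exp_add by (simp flip: exp_of_nat_mult)
  finally show ?thesis .
qed

lemma Kfun_pole_bound: "\<exists>C>0. \<forall>x. 1 < x \<longrightarrow> x \<le> 2 \<longrightarrow> norm (Kfun (Complex x 0) / (Complex x 0 - 1)) \<le> C / (x - 1)"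
proof -
  have seg: "closed_segment 1 (2 :: complex) = {z. Im z = 0 \<and> 1 \<le> Re z \<and> Re z \<le> 2}"
  proof (rule Set.set_eqI, rule iffI)
    fix z :: complex assume "z \<in> {z. Im z = 0 \<and> 1 \<le> Re z \<and> Re z \<le> 2}"
    then show "z \<in> closed_segment 1 2"
      by (auto simp: closed_segment_def complex_eq_iff intro!: exI[of _ "Re z - 1"])
  qed (auto simp: closed_segment_def)
  have "compact (closed_segment 1 (2 :: complex))" by (rule compact_segment)
  moreover have "continuous_on (closed_segment 1 2) Kfun"
    by (rule holomorphic_on_imp_continuous_on[OF holomorphic_on_subset[OF Kfun_holomorphic]])
       (auto simp: seg)
  ultimately have "bounded (Kfun ` closed_segment 1 2)"
    by (intro compact_imp_bounded compact_continuous_image)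
  then obtain B where B: "\<And>z. z \<in> closed_segment 1 2 \<Longrightarrow> norm (Kfun z) \<le> B"
    unfolding bounded_iff by blast
  have "norm (Kfun (Complex x 0) / (Complex x 0 - 1)) \<le> (\<bar>B\<bar> + 1) / (x - 1)" if x: "1 < x" "x \<le> 2" for x
  proof -
    have "Complex x 0 \<in> closed_segment 1 2" using x by (simp add: seg)
    then have "norm (Kfun (Complex x 0)) \<le> \<bar>B\<bar> + 1" using B by fastforce
    moreover have "norm (Complex x 0 - 1) = x - 1"
      using x by (simp add: complex_eq_iff cmod_def)
    ultimately show ?thesis using x by (simp add: norm_divide divide_right_mono)
  qed
  then show ?thesis by (intro exI[of _ "\<bar>B\<bar> + 1"]) auto
qed

lemma Kfun_div_bound:
  assumes tau: "tau > 0"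
  shows "\<exists>C>0. \<forall>s. 39/40 \<le> Re s \<longrightarrow> Re s \<le> 3 \<longrightarrow> norm (s - 1) \<ge> tau \<longrightarrow>
           norm (Kfun s / (s - 1)) \<le> C * (1 + \<bar>Im s\<bar>) powr (1/20)"
proof -
  obtain C1 where C1: "C1 > 0" "\<And>s. 39/40 \<le> Re s \<Longrightarrow> Re s \<le> 3 \<Longrightarrow> norm (s - 1) \<ge> tau \<Longrightarrow>
           norm (Z.zser s) \<le> C1 * norm (s - 1) * (1 + \<bar>Im s\<bar>) powr (1/40)"
    using Z.zser_bound[OF tau] by blast
  obtain C2 where C2: "C2 > 0" "\<And>s. 39/40 \<le> Re s \<Longrightarrow> Re s \<le> 3 \<Longrightarrow> norm (s - 1) \<ge> tau \<Longrightarrow>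
           norm (X.zser s) \<le> C2 * norm (s - 1) * (1 + \<bar>Im s\<bar>) powr (1/40)"
    using X.zser_bound[OF tau] by blast
  have "norm (Kfun s / (s - 1)) \<le> (C1 * C2) * (1 + \<bar>Im s\<bar>) powr (1/20)"
    if s: "39/40 \<le> Re s" "Re s \<le> 3" "norm (s - 1) \<ge> tau" for s
  proof -
    let ?T = "(1 + \<bar>Im s\<bar>) powr (1/40)"
    have n: "norm (s - 1) > 0" using s tau by linarith
    have "norm (Z.zser s) \<le> (C1 * ?T) * norm (s - 1)" using C1(2)[OF s] by (simp add: mult_ac)
    then have 1: "norm (Z.zser s) / norm (s - 1) \<le> C1 * ?T" using n by (simp add: divide_le_eq)
    have "norm (s - 1) * norm (Lchi s) \<le> norm (s - 1) * (C2 * ?T)"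
      using C2(2)[OF s] Xzser_eq[of s] s by (simp add: mult_ac norm_mult)
    then have 2: "norm (Lchi s) \<le> C2 * ?T" using n by simp
    have "norm (Kfun s / (s - 1)) = norm (Z.zser s) / norm (s - 1) * norm (Lchi s)"
      by (simp add: Kfun_def norm_mult norm_divide)
    also have "\<dots> \<le> (C1 * ?T) * (C2 * ?T)" using C1(1) by (intro mult_mono 1 2) auto
    also have "\<dots> = (C1 * C2) * (?T * ?T)" by simp
    also have "?T * ?T = (1 + \<bar>Im s\<bar>) powr (1/20)" by (simp flip: powr_add)
    finally show ?thesis .
  qed
  then show ?thesis using C1(1) C2(1) by (intro exI[of _ "C1 * C2"]) auto
qed

lemma Kfun_div_lower:
  assumes tau: "tau > 0"
  shows "\<exists>c>0. \<forall>x t. 1 < x \<longrightarrow> x \<le> 2 \<longrightarrow> \<bar>t\<bar> \<ge> tau \<longrightarrow>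
           norm (Kfun (Complex x t) / (Complex x t - 1)) ^ 4 \<ge> c * (x - 1) ^ 3 * (1 + \<bar>t\<bar>) powr (- 1/20)"
proof -
  obtain C1 where C1: "C1 > 0" "\<And>x. 1 < x \<Longrightarrow> x \<le> 2 \<Longrightarrow> norm (Kfun (Complex x 0) / (Complex x 0 - 1)) \<le> C1 / (x - 1)"
    using Kfun_pole_bound by blast
  obtain C2 where C2: "C2 > 0" "\<And>s. 39/40 \<le> Re s \<Longrightarrow> Re s \<le> 3 \<Longrightarrow> norm (s - 1) \<ge> tau \<Longrightarrow>
           norm (Kfun s / (s - 1)) \<le> C2 * (1 + \<bar>Im s\<bar>) powr (1/20)"
    using Kfun_div_bound[OF tau] by blast
  define D where "D = C1 ^ 3 * (C2 * 2)"
  have D: "D > 0" using C1 C2 by (simp add: D_def)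
  have "norm (Kfun (Complex x t) / (Complex x t - 1)) ^ 4 \<ge> 1 / D * (x - 1) ^ 3 * (1 + \<bar>t\<bar>) powr (- 1/20)"
    if x: "1 < x" "x \<le> 2" and t: "\<bar>t\<bar> \<ge> tau" for x t
  proof -
    define k where "k = (\<lambda>t. norm (Kfun (Complex x t) / (Complex x t - 1)))"
    define P where "P = (1 + \<bar>t\<bar>) powr (1/20)"
    have P: "P > 0" unfolding P_def by simp
    have k0: "k 0 \<le> C1 / (x - 1)" unfolding k_def using C1(2) x by blast
    have "\<bar>Im (Complex x (2 * t) - 1)\<bar> \<le> norm (Complex x (2 * t) - 1)" by (rule abs_Im_le_cmod)
    then have "norm (Complex x (2 * t) - 1) \<ge> tau" using t tau by simp
    then have "k (2 * t) \<le> C2 * (1 + \<bar>2 * t\<bar>) powr (1/20)" unfolding k_def using C2(2)[of "Complex x (2 * t)"] x by simp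
    also have "(1 + \<bar>2 * t\<bar>) powr (1/20) \<le> (2 * (1 + \<bar>t\<bar>)) powr (1/20)" by (intro powr_mono2) auto
    also have "(2 * (1 + \<bar>t\<bar>)) powr (1/20) = 2 powr (1/20) * P" unfolding P_def by (rule powr_mult)
    also have "(2 :: real) powr (1/20) \<le> 2 powr 1" by (intro powr_mono) auto
    finally have k2: "k (2 * t) \<le> C2 * 2 * P" using C2(1) P by (simp add: mult_ac)
    have kn: "k y \<ge> 0" for y by (simp add: k_def)
    have "1 \<le> k 0 ^ 3 * k t ^ 4 * k (2 * t)" using norm_Kfun_341[OF x(1)] by (simp add: k_def)
    also have "\<dots> \<le> (C1 / (x - 1)) ^ 3 * k t ^ 4 * (C2 * 2 * P)"
      using kn k0 k2 C1 x by (intro mult_mono power_mono mult_nonneg_nonneg zero_le_power) auto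
    also have "\<dots> = D * P * k t ^ 4 / (x - 1) ^ 3" by (simp add: D_def power_divide)
    finally have "(x - 1) ^ 3 \<le> D * P * k t ^ 4" using x by (simp add: le_divide_eq)
    then have "1 / D * (x - 1) ^ 3 * (1 / P) \<le> k t ^ 4"
      using D P by (simp add: field_simps)
    moreover have "(1 + \<bar>t\<bar>) powr (- 1/20) = 1 / P" unfolding P_def by (simp add: powr_minus_divide)
    ultimately show ?thesis by (simp add: k_def)
  qed
  then show ?thesis using D by (intro exI[of _ "1 / D"]) auto
qed

lemma Kfun_div_deriv_bound:
  assumes tau: "tau > 0"
  shows "\<exists>C>0. \<forall>s. 79/80 \<le> Re s \<longrightarrow> Re s \<le> 2 \<longrightarrow> \<bar>Im s\<bar> \<ge> tau \<longrightarrow>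
           norm (deriv (\<lambda>s. Kfun s / (s - 1)) s) \<le> C * (1 + \<bar>Im s\<bar>) powr (1/20)"
proof -
  obtain C where C: "C > 0" "\<And>s. 39/40 \<le> Re s \<Longrightarrow> Re s \<le> 3 \<Longrightarrow> norm (s - 1) \<ge> tau / 2 \<Longrightarrow>
           norm (Kfun s / (s - 1)) \<le> C * (1 + \<bar>Im s\<bar>) powr (1/20)"
    using Kfun_div_bound[of "tau / 2"] tau by auto
  define r where "r = min (1/80) (tau / 2)"
  have r: "r > 0" "r \<le> 1/80" "r \<le> tau / 2" using tau by (auto simp: r_def)
  have "norm (deriv (\<lambda>s. Kfun s / (s - 1)) s) \<le> (2 * C / r) * (1 + \<bar>Im s\<bar>) powr (1/20)"
    if s: "79/80 \<le> Re s" "Re s \<le> 2" "\<bar>Im s\<bar> \<ge> tau" for s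
  proof -
    have near: "39/40 \<le> Re z \<and> Re z \<le> 3 \<and> norm (z - 1) \<ge> tau / 2 \<and> \<bar>Im z\<bar> \<le> \<bar>Im s\<bar> + 1" if "norm (s - z) \<le> r" for z
    proof -
      have "\<bar>Re s - Re z\<bar> \<le> r" "\<bar>Im s - Im z\<bar> \<le> r"
        using that abs_Re_le_cmod[of "s - z"] abs_Im_le_cmod[of "s - z"] by auto
      moreover have "\<bar>Im z\<bar> \<le> norm (z - 1)" using abs_Im_le_cmod[of "z - 1"] by simp
      ultimately show ?thesis using s r by (auto simp: abs_le_iff abs_if split: if_splits)
    qed
    have hol: "(\<lambda>s. Kfun s / (s - 1)) holomorphic_on cball s r"
    proof (rule holomorphic_on_divide)
      show "Kfun holomorphic_on cball s r"
        by (rule holomorphic_on_subset[OF Kfun_holomorphic]) (use near in \<open>fastforce simp: dist_norm\<close>)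
      show "z - 1 \<noteq> 0" if "z \<in> cball s r" for z using near[of z] that tau by (auto simp: dist_norm)
    qed (intro holomorphic_intros)
    have "norm ((deriv ^^ 1) (\<lambda>s. Kfun s / (s - 1)) s) \<le> fact 1 * (2 * C * (1 + \<bar>Im s\<bar>) powr (1/20)) / r ^ 1"
    proof (rule Cauchy_inequality)
      show "(\<lambda>s. Kfun s / (s - 1)) holomorphic_on ball s r" by (rule holomorphic_on_subset[OF hol ball_subset_cball])
      show "continuous_on (cball s r) (\<lambda>s. Kfun s / (s - 1))" by (rule holomorphic_on_imp_continuous_on[OF hol])
      show "0 < r" by (rule r)
      fix z assume z: "norm (s - z) = r"
      have "norm (Kfun z / (z - 1)) \<le> C * (1 + \<bar>Im z\<bar>) powr (1/20)" using near[of z] z by (intro C) auto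
      also have "(1 + \<bar>Im z\<bar>) powr (1/20) \<le> (2 * (1 + \<bar>Im s\<bar>)) powr (1/20)" using near[of z] z by (intro powr_mono2) auto
      also have "\<dots> = 2 powr (1/20) * (1 + \<bar>Im s\<bar>) powr (1/20)" by (rule powr_mult)
      also have "\<dots> \<le> 2 powr 1 * (1 + \<bar>Im s\<bar>) powr (1/20)" by (intro mult_right_mono powr_mono) auto
      finally show "norm (Kfun z / (z - 1)) \<le> 2 * C * (1 + \<bar>Im s\<bar>) powr (1/20)"
        using C(1) by (simp add: mult_ac)
    qed
    then show ?thesis by simp
  qed
  then show ?thesis using C(1) r(1) by (intro exI[of _ "2 * C / r"]) auto
qed

lemma Kfun_zero_free_far:
  assumes tau: "tau > 0"
  shows "\<exists>c C. 0 < c \<and> c \<le> 1/80 \<and> C > 0 \<and> (\<forall>s. 1 - c * (1 + \<bar>Im s\<bar>) powr (- 1/4) \<le> Re s \<longrightarrow> Re s \<le> 2 \<longrightarrow> \<bar>Im s\<bar> \<ge> tau \<longrightarrow>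
           Kfun s \<noteq> 0 \<and> norm (deriv Kfun s / Kfun s) \<le> C * (1 + \<bar>Im s\<bar>) powr (1/4))"
proof -
  define k where "k = (\<lambda>s. Kfun s / (s - 1))"
  obtain c0 where c0: "c0 > 0" "\<And>x t. 1 < x \<Longrightarrow> x \<le> 2 \<Longrightarrow> \<bar>t\<bar> \<ge> tau \<Longrightarrow>
           norm (k (Complex x t)) ^ 4 \<ge> c0 * (x - 1) ^ 3 * (1 + \<bar>t\<bar>) powr (- 1/20)"
    using Kfun_div_lower[OF tau] unfolding k_def by blast
  obtain C1 where C1: "C1 > 0" "\<And>s. 79/80 \<le> Re s \<Longrightarrow> Re s \<le> 2 \<Longrightarrow> \<bar>Im s\<bar> \<ge> tau \<Longrightarrow>
           norm (deriv k s) \<le> C1 * (1 + \<bar>Im s\<bar>) powr (1/20)"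
    using Kfun_div_deriv_bound[OF tau] unfolding k_def by blast
  define c where "c = min (1/80) (c0 / (4 * C1) ^ 4)"
  have c: "0 < c" "c \<le> 1/80" "c \<le> c0 / (4 * C1) ^ 4" using c0 C1 by (auto simp: c_def)
  define m where "m = (c0 * c ^ 3) powr (1/4)"
  have m: "m > 0" using c0 c by (simp add: m_def)
  have m4: "m ^ 4 = c0 * c ^ 3"
  proof -
    have "m ^ 4 = m powr 4" using m by (simp add: powr_numeral)
    also have "\<dots> = c0 * c ^ 3" using c0 c by (simp add: m_def powr_powr)
    finally show ?thesis .
  qed
  have mc: "4 * C1 * c \<le> m"
  proof (rule power_le_imp_le_base[of _ 3])
    have "(4 * C1) ^ 4 * c \<le> c0" using c(3) C1 by (simp add: field_simps)
    then have "(4 * C1) ^ 4 * c * c ^ 3 \<le> c0 * c ^ 3" using c by (intro mult_right_mono) auto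
    then show "(4 * C1 * c) ^ Suc 3 \<le> m ^ Suc 3" using m4
      by (simp add: power_mult_distrib power4_eq_xxxx power3_eq_cube mult_ac)
  qed (use m in simp)
  have khol: "k holomorphic_on {s. Re s > 0} - {1}"
    unfolding k_def by (intro holomorphic_intros holomorphic_on_subset[OF Kfun_holomorphic]) auto
  have op: "open ({s. Re s > 0} - {1})" by (intro open_Diff open_halfspace_Re_gt) auto
  have main: "Kfun s \<noteq> 0 \<and> norm (deriv Kfun s / Kfun s) \<le> (1 / tau + 2 * C1 / m) * (1 + \<bar>Im s\<bar>) powr (1/4)"
    if s: "1 - c * (1 + \<bar>Im s\<bar>) powr (- 1/4) \<le> Re s" "Re s \<le> 2" "\<bar>Im s\<bar> \<ge> tau" for s
  proof -
    define T where "T = 1 + \<bar>Im s\<bar>"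
    define X where "X = c * T powr (- 1/4)"
    have T: "T \<ge> 1" by (simp add: T_def)
    have "T powr (- 1/4) \<le> T powr 0" using T by (intro powr_mono) auto
    then have X: "0 < X" "X \<le> 1/80" using c T mult_mono[of c "1/80" "T powr (- 1/4)" 1] by (auto simp: X_def)
    have low: "norm (k (Complex x (Im s))) \<ge> m * T powr (- 1/5)" if x: "1 + X \<le> x" "x \<le> 2" for x
    proof (rule power_le_imp_le_base[of _ 3])
      have "(m * T powr (- 1/5)) ^ 4 = m ^ 4 * (T powr (- 1/5)) powr 4"
        using T by (simp add: power_mult_distrib powr_numeral)
      also have "\<dots> = c0 * (c ^ 3 * T powr (- 4/5))" by (simp add: m4 powr_powr)
      also have "T powr (- 4/5) = (T powr (- 1/4)) powr 3 * T powr (- 1/20)"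
        by (simp add: powr_powr flip: powr_add)
      also have "(T powr (- 1/4)) powr 3 = (T powr (- 1/4)) ^ 3" using T by (simp add: powr_numeral)
      also have "c0 * (c ^ 3 * ((T powr (- 1/4)) ^ 3 * T powr (- 1/20))) = c0 * X ^ 3 * T powr (- 1/20)"
        by (simp add: X_def power_mult_distrib)
      also have "\<dots> \<le> c0 * (x - 1) ^ 3 * T powr (- 1/20)"
        using x X c0 by (intro mult_right_mono mult_left_mono power_mono) auto
      also have "\<dots> \<le> norm (k (Complex x (Im s))) ^ 4"
        unfolding T_def using x X s by (intro c0) auto
      finally show "(m * T powr (- 1/5)) ^ Suc 3 \<le> norm (k (Complex x (Im s))) ^ Suc 3" by simp
    qed simp
    have s1: "s \<noteq> 1" "Re s > 0" "79/80 \<le> Re s" using s tau X c by (auto simp: X_def T_def)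
    have lower: "norm (k s) \<ge> m / 2 * T powr (- 1/5)"
    proof (cases "1 + X \<le> Re s")
      case True
      have "norm (k s) \<ge> m * T powr (- 1/5)" using low[OF True s(2)] by simp
      moreover have "m * T powr (- 1/5) \<ge> 0" using m by simp
      ultimately show ?thesis by linarith
    next
      case False
      define s' where "s' = Complex (1 + X) (Im s)"
      have "norm (k s' - k s) \<le> (C1 * T powr (1/20)) * norm (s' - s)"
      proof (rule field_differentiable_bound[of "closed_segment s s'"])
        fix z assume z: "z \<in> closed_segment s s'"
        then obtain u where u: "z = (1 - u) *\<^sub>R s + u *\<^sub>R s'" "0 \<le> u" "u \<le> 1" by (auto simp: closed_segment_def)
        have "Im z = (1 - u) * Im s + u * Im s" unfolding u(1) by (simp add: s'_def)
        then have im: "Im z = Im s" by (simp add: algebra_simps)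
        have "Re z = (1 - u) * Re s + u * (1 + X)" using u by (simp add: s'_def)
        moreover have "(1 - u) * Re s + u * (1 + X) \<ge> (1 - u) * (79/80) + u * (79/80)"
          using u s1 X by (intro add_mono mult_left_mono) auto
        moreover have "(1 - u) * Re s + u * (1 + X) \<le> (1 - u) * 2 + u * 2"
          using u s X by (intro add_mono mult_left_mono) auto
        moreover have "(1 - u) * (79/80) + u * (79/80) = 79/80" "(1 - u) * 2 + u * 2 = 2"
          by (simp_all add: field_simps)
        ultimately have re: "79/80 \<le> Re z" "Re z \<le> 2" by linarith+
        have "z \<in> {s. Re s > 0} - {1}" using re im s tau by auto
        then show "(k has_field_derivative deriv k z) (at z within closed_segment s s')"
          using holomorphic_derivI[OF khol op] has_field_derivative_at_within by blast
        show "norm (deriv k z) \<le> C1 * T powr (1/20)"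
          using C1(2)[of z] re im s by (simp add: T_def)
      qed auto
      also have "norm (s' - s) = 1 + X - Re s"
        using False by (simp add: s'_def cmod_def)
      also have "\<dots> \<le> 2 * X" using s by (simp add: X_def T_def)
      finally have "norm (k s' - k s) \<le> C1 * T powr (1/20) * (2 * X)" using C1(1) by (simp add: mult_left_mono)
      also have "\<dots> = 2 * C1 * c * (T powr (1/20) * T powr (- 1/4))" by (simp add: X_def)
      also have "T powr (1/20) * T powr (- 1/4) = T powr (- 1/5)" by (simp flip: powr_add)
      also have "2 * C1 * c * T powr (- 1/5) \<le> m / 2 * T powr (- 1/5)" using mc by (intro mult_right_mono) auto
      finally have "norm (k s' - k s) \<le> m / 2 * T powr (- 1/5)" .
      moreover have "norm (k s') \<ge> m * T powr (- 1/5)" unfolding s'_def using X by (intro low) auto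
      moreover have "norm (k s') \<le> norm (k s' - k s) + norm (k s)" using norm_triangle_ineq[of "k s' - k s" "k s"] by simp
      ultimately show ?thesis by linarith
    qed
    have pos: "m / 2 * T powr (- 1/5) > 0" using m T by simp
    have k0: "k s \<noteq> 0" using lower pos by auto
    then have K0: "Kfun s \<noteq> 0" by (auto simp: k_def)
    have "(k has_field_derivative deriv k s) (at s)" using holomorphic_derivI[OF khol op] s1 by auto
    then have "((\<lambda>s. (s - 1) * k s) has_field_derivative 1 * k s + deriv k s * (s - 1)) (at s)"
      by (intro DERIV_mult) (auto intro!: derivative_eq_intros)
    then have "(Kfun has_field_derivative 1 * k s + deriv k s * (s - 1)) (at s)"
      by (rule has_field_derivative_transform_within_open[OF _ op]) (use s1 in \<open>auto simp: k_def\<close>)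
    then have "deriv Kfun s = k s + deriv k s * (s - 1)" by (simp add: DERIV_imp_deriv)
    moreover have "Kfun s = (s - 1) * k s" using s1 by (simp add: k_def)
    moreover have "(a + b * w) / (w * a) = 1 / w + b / a" if "a \<noteq> 0" "w \<noteq> 0" for a b w :: complex
      using that by (simp add: field_simps)
    ultimately have "deriv Kfun s / Kfun s = 1 / (s - 1) + deriv k s / k s"
      using s1 k0 by (simp only: right_minus_eq not_False_eq_True)
    then have "norm (deriv Kfun s / Kfun s) \<le> 1 / norm (s - 1) + norm (deriv k s) / norm (k s)"
      using norm_triangle_ineq[of "1 / (s - 1)" "deriv k s / k s"] by (simp add: norm_divide)
    also have "1 / norm (s - 1) \<le> 1 / tau * T powr (1/4)"
    proof -
      have "norm (s - 1) \<ge> tau" using abs_Im_le_cmod[of "s - 1"] s by simp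
      then have "1 / norm (s - 1) \<le> 1 / tau" using tau s1 by (intro divide_left_mono mult_pos_pos) auto
      also have "\<dots> \<le> 1 / tau * T powr (1/4)" using tau T ge_one_powr_ge_zero[of T "1/4"]
        mult_left_mono[of 1 "T powr (1/4)" "1 / tau"] by simp
      finally show ?thesis .
    qed
    also have "norm (deriv k s) / norm (k s) \<le> (C1 * T powr (1/20)) / (m / 2 * T powr (- 1/5))"
      using C1(2)[of s] s s1 lower pos C1(1) by (intro frac_le) (auto simp: T_def)
    also have "\<dots> = 2 * C1 / m * (T powr (1/20) / T powr (- 1/5))" by simp
    also have "T powr (1/20) / T powr (- 1/5) = T powr (1/4)" by (simp flip: powr_diff)
    finally show ?thesis using K0 by (simp add: T_def algebra_simps)
  qed
  show ?thesis
    by (rule exI[of _ c], rule exI[of _ "1 / tau + 2 * C1 / m"]) (use c C1 m tau main in \<open>auto intro!: add_pos_pos\<close>)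
qed

lemma Kfun_zero_free:
  "\<exists>c C. 0 < c \<and> c \<le> 1/80 \<and> C > 0 \<and> (\<forall>s. 1 - c * (1 + \<bar>Im s\<bar>) powr (- 1/4) \<le> Re s \<longrightarrow> Re s \<le> 2 \<longrightarrow>
     Kfun s \<noteq> 0 \<and> norm (deriv Kfun s / Kfun s) \<le> C * (1 + \<bar>Im s\<bar>) powr (1/4))"
proof -
  have op: "open {s. Re s > 0}" by (rule open_halfspace_Re_gt)
  have "isCont Kfun 1"
    using holomorphic_on_imp_continuous_on[OF Kfun_holomorphic] continuous_on_eq_continuous_at[OF op, of Kfun] by auto
  moreover have "Kfun 1 \<noteq> 0" by (simp add: Kfun_1)
  ultimately obtain e where e: "e > 0" "\<And>y. dist 1 y < e \<Longrightarrow> Kfun y \<noteq> 0"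
    using continuous_at_avoid by metis
  define r where "r = min (e / 4) (1/80)"
  have r: "r > 0" "r \<le> e / 4" "r \<le> 1/80" using e by (auto simp: r_def)
  obtain c1 C1 where far: "0 < c1" "c1 \<le> 1/80" "C1 > 0"
    "\<And>s. 1 - c1 * (1 + \<bar>Im s\<bar>) powr (- 1/4) \<le> Re s \<Longrightarrow> Re s \<le> 2 \<Longrightarrow> \<bar>Im s\<bar> \<ge> r \<Longrightarrow>
           Kfun s \<noteq> 0 \<and> norm (deriv Kfun s / Kfun s) \<le> C1 * (1 + \<bar>Im s\<bar>) powr (1/4)"
    using Kfun_zero_free_far[OF r(1)] by blast
  define Q where "Q = cbox (Complex (1 - r) (- r)) (Complex 2 r)"
  have Q: "s \<in> Q \<longleftrightarrow> 1 - r \<le> Re s \<and> Re s \<le> 2 \<and> \<bar>Im s\<bar> \<le> r" for s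
    by (auto simp: Q_def in_cbox_complex_iff)
  have Q0: "Kfun s \<noteq> 0" if "s \<in> Q" for s
  proof (cases "Re s > 1")
    case False
    have "norm (s - 1) \<le> \<bar>Re (s - 1)\<bar> + \<bar>Im (s - 1)\<bar>" by (rule cmod_le)
    then have "dist 1 s < e" using that False r by (auto simp: Q dist_norm norm_minus_commute)
    then show ?thesis by (rule e)
  qed (rule Kfun_nonzero)
  have sub: "Q \<subseteq> {s. Re s > 0}" using r by (auto simp: Q)
  have "continuous_on Q (\<lambda>s. deriv Kfun s / Kfun s)"
    using Q0 sub by (intro continuous_on_divide holomorphic_on_imp_continuous_on
      holomorphic_on_subset[OF holomorphic_deriv[OF Kfun_holomorphic op]] holomorphic_on_subset[OF Kfun_holomorphic]) auto
  moreover have "compact Q" by (simp add: Q_def)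
  ultimately have "bounded ((\<lambda>s. deriv Kfun s / Kfun s) ` Q)"
    by (intro compact_imp_bounded compact_continuous_image)
  then obtain B where B: "\<And>s. s \<in> Q \<Longrightarrow> norm (deriv Kfun s / Kfun s) \<le> B"
    unfolding bounded_iff by blast
  have "Kfun s \<noteq> 0 \<and> norm (deriv Kfun s / Kfun s) \<le> (C1 + \<bar>B\<bar>) * (1 + \<bar>Im s\<bar>) powr (1/4)"
    if s: "1 - min c1 r * (1 + \<bar>Im s\<bar>) powr (- 1/4) \<le> Re s" "Re s \<le> 2" for s
  proof (cases "\<bar>Im s\<bar> \<ge> r")
    case True
    have "min c1 r * (1 + \<bar>Im s\<bar>) powr (- 1/4) \<le> c1 * (1 + \<bar>Im s\<bar>) powr (- 1/4)" by (intro mult_right_mono) auto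
    then have "Kfun s \<noteq> 0 \<and> norm (deriv Kfun s / Kfun s) \<le> C1 * (1 + \<bar>Im s\<bar>) powr (1/4)"
      using s True by (intro far) auto
    moreover have "C1 * (1 + \<bar>Im s\<bar>) powr (1/4) \<le> (C1 + \<bar>B\<bar>) * (1 + \<bar>Im s\<bar>) powr (1/4)"
      by (intro mult_right_mono) auto
    ultimately show ?thesis by linarith
  next
    case False
    have "(1 + \<bar>Im s\<bar>) powr (- 1/4) \<le> (1 + \<bar>Im s\<bar>) powr 0" by (intro powr_mono) auto
    also have "\<dots> = 1" by (simp add: add_nonneg_eq_0_iff)
    finally have "min c1 r * (1 + \<bar>Im s\<bar>) powr (- 1/4) \<le> r * 1" using far r by (intro mult_mono) auto
    then have sQ: "s \<in> Q" using s False by (auto simp: Q)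
    have "1 \<le> (1 + \<bar>Im s\<bar>) powr (1/4)" by (intro ge_one_powr_ge_zero) auto
    then have "(C1 + \<bar>B\<bar>) * 1 \<le> (C1 + \<bar>B\<bar>) * (1 + \<bar>Im s\<bar>) powr (1/4)" using far by (intro mult_left_mono) auto
    moreover have "norm (deriv Kfun s / Kfun s) \<le> B" by (rule B[OF sQ])
    moreover have "B \<le> (C1 + \<bar>B\<bar>) * 1" using far(3) abs_ge_self[of B] by (simp only: mult_1_right)
    ultimately have "norm (deriv Kfun s / Kfun s) \<le> (C1 + \<bar>B\<bar>) * (1 + \<bar>Im s\<bar>) powr (1/4)" by linarith
    then show ?thesis using Q0[OF sQ] by blast
  qed
  then show ?thesis
    using far r by (intro exI[of _ "min c1 r"] exI[of _ "C1 + \<bar>B\<bar>"]) auto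
qed

section \<open>A Tauberian theorem with Gaussian smoothing\<close>

lemma integrable_exp_neg:
  assumes "e > 0"
  shows "integrable lborel (\<lambda>v :: real. indicator {a..} v * exp (- (e * v)))"
proof -
  have "(\<integral>\<^sup>+ x. ennreal (exp (- (e * x))) * indicator {a..} x \<partial>lborel) = 0 - (- exp (- (e * a)) / e)"
  proof (rule nn_integral_FTC_atLeast)
    show "((\<lambda>x. - exp (- (e * x)) / e) has_real_derivative exp (- (e * x))) (at x)" for x
      using assms by (auto intro!: derivative_eq_intros)
    have "((\<lambda>x. - exp (- (e * x)) / e) \<longlongrightarrow> - 0 / e) at_top"
      using assms by (intro tendsto_intros filterlim_compose[OF exp_at_bot] filterlim_compose[OF filterlim_uminus_at_bot_at_top]
        filterlim_tendsto_pos_mult_at_top[OF tendsto_const] filterlim_ident) auto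
    then show "((\<lambda>x. - exp (- (e * x)) / e) \<longlongrightarrow> 0) at_top" by simp
  qed auto
  then have "(\<integral>\<^sup>+ x. ennreal (indicator {a..} x * exp (- (e * x))) \<partial>lborel) = ennreal (exp (- (e * a)) / e)"
    by (subst (asm) nn_integral_cong[of _ _ "\<lambda>x. ennreal (indicator {a..} x * exp (- (e * x)))"]) (auto simp: indicator_def)
  then show ?thesis
    by (intro integrableI_nonneg) auto
qed

lemma integrable_prod_mult:
  fixes f g :: "real \<Rightarrow> real"
  assumes f: "integrable lborel f" and g: "integrable lborel g"
  shows "integrable (lborel \<Otimes>\<^sub>M lborel) (\<lambda>(x, y). f x * g y)"
proof (rule lborel_pair.Fubini_integrable)
  have [measurable]: "f \<in> borel_measurable borel" "g \<in> borel_measurable borel" using f g by auto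
  show "(\<lambda>(x, y). f x * g y) \<in> borel_measurable (lborel \<Otimes>\<^sub>M lborel)" by measurable
  show "integrable lborel (\<lambda>x. \<integral>y. norm (case (x, y) of (x, y) \<Rightarrow> f x * g y) \<partial>lborel)"
    using f g by (simp add: abs_mult)
  show "AE x in lborel. integrable lborel (\<lambda>y. case (x, y) of (x, y) \<Rightarrow> f x * g y)"
    using g by simp
qed

lemma std_gauss_integrable:
  "integrable lborel (\<lambda>x. exp (complex_of_real (- x\<^sup>2 / 2) + \<i> * of_real (b * x)))"
proof -
  have "integrable lborel (\<lambda>x. sqrt (2 * pi) * std_normal_density x)" by simp
  moreover have "(\<lambda>x. exp (complex_of_real (- x\<^sup>2 / 2) + \<i> * of_real (b * x))) \<in> borel_measurable lborel"
    by measurable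
  ultimately show ?thesis
    by (rule Bochner_Integration.integrable_bound) (auto simp: std_normal_density_def)
qed

lemma std_gauss_integral:
  "(\<integral>x. exp (complex_of_real (- x\<^sup>2 / 2) + \<i> * of_real (b * x)) \<partial>lborel) = of_real (sqrt (2 * pi) * exp (- b\<^sup>2 / 2))"
proof -
  have "of_real (exp (- b\<^sup>2 / 2)) = (CLINT x|std_normal_distribution. iexp (b * x))"
    using fun_cong[OF char_std_normal_distribution, of b] by (simp add: char_def)
  also have "\<dots> = (\<integral>x. std_normal_density x *\<^sub>R iexp (b * x) \<partial>lborel)"
    by (intro integral_density) auto
  also have "\<dots> = (\<integral>x. of_real (1 / sqrt (2 * pi)) * exp (complex_of_real (- x\<^sup>2 / 2) + \<i> * of_real (b * x)) \<partial>lborel)"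
    unfolding std_normal_density_def exp_add scaleR_conv_of_real of_real_mult exp_of_real
    by (simp only: mult.assoc)
  also have "\<dots> = of_real (1 / sqrt (2 * pi)) * (\<integral>x. exp (complex_of_real (- x\<^sup>2 / 2) + \<i> * of_real (b * x)) \<partial>lborel)"
    by (rule integral_mult_right_zero)
  finally have e: "of_real (exp (- b\<^sup>2 / 2)) = of_real (1 / sqrt (2 * pi)) * (\<integral>x. exp (complex_of_real (- x\<^sup>2 / 2) + \<i> * of_real (b * x)) \<partial>lborel)" .
  have "of_real (sqrt (2 * pi)) * of_real (1 / sqrt (2 * pi)) = (1 :: complex)"
    by (simp flip: of_real_mult)
  then show ?thesis unfolding of_real_mult e by (simp only: mult.assoc[symmetric]) simp
qed

text \<open>The entire function whose restriction to a vertical line is a Gaussian of width \<open>1 / d\<close>.\<close>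

definition gker :: "real \<Rightarrow> real \<Rightarrow> complex \<Rightarrow> complex" where
  "gker d u w = exp (of_real (d\<^sup>2 / 2) * w\<^sup>2 + of_real u * w)"

lemma gker_Complex:
  "gker d u (Complex x y) = of_real (exp (d\<^sup>2 * x\<^sup>2 / 2 + u * x)) * exp (complex_of_real (- (d * y)\<^sup>2 / 2) + \<i> * of_real ((d\<^sup>2 * x + u) * y))"
proof -
  have "of_real (d\<^sup>2 / 2) * (Complex x y)\<^sup>2 + of_real u * Complex x y
      = of_real (d\<^sup>2 * x\<^sup>2 / 2 + u * x) + (complex_of_real (- (d * y)\<^sup>2 / 2) + \<i> * of_real ((d\<^sup>2 * x + u) * y))"
    by (simp add: complex_eq_iff power2_eq_square field_simps)
  then show ?thesis by (simp only: gker_def exp_add exp_of_real)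
qed

lemma norm_gker: "norm (gker d u (Complex x y)) = exp (d\<^sup>2 * x\<^sup>2 / 2 + u * x - d\<^sup>2 * y\<^sup>2 / 2)"
  by (simp add: gker_def complex_eq_iff power2_eq_square field_simps)

lemma gker_integral:
  assumes d: "d > 0"
  shows "integrable lborel (\<lambda>y. gker d u (Complex x y))"
    and "(\<integral>y. gker d u (Complex x y) \<partial>lborel) = of_real (2 * pi * normal_density 0 d u)"
proof -
  define f where "f = (\<lambda>z. exp (complex_of_real (- z\<^sup>2 / 2) + \<i> * of_real ((d * x + u / d) * z)))"
  have eq: "gker d u (Complex x y) = of_real (exp (d\<^sup>2 * x\<^sup>2 / 2 + u * x)) * f (0 + d * y)" for y
  proof -
    have "(d\<^sup>2 * x + u) * y = (d * x + u / d) * (d * y)" using d by (simp add: field_simps power2_eq_square)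
    then show ?thesis by (simp only: gker_Complex f_def add_0)
  qed
  have fi: "integrable lborel f" unfolding f_def by (rule std_gauss_integrable)
  show "integrable lborel (\<lambda>y. gker d u (Complex x y))"
    unfolding eq using d by (intro integrable_mult_right lborel_integrable_real_affine[OF fi]) auto
  have "(\<integral>z. f z \<partial>lborel) = \<bar>d\<bar> *\<^sub>R (\<integral>y. f (0 + d * y) \<partial>lborel)"
    using d by (intro lborel_integral_real_affine) auto
  moreover have "(\<integral>z. f z \<partial>lborel) = of_real (sqrt (2 * pi) * exp (- (d * x + u / d)\<^sup>2 / 2))"
    unfolding f_def by (rule std_gauss_integral)
  ultimately have I: "(\<integral>y. f (0 + d * y) \<partial>lborel) = of_real (sqrt (2 * pi) * exp (- (d * x + u / d)\<^sup>2 / 2) / d)"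
    using d by (simp add: scaleR_conv_of_real field_simps)
  have "(\<integral>y. gker d u (Complex x y) \<partial>lborel) = of_real (exp (d\<^sup>2 * x\<^sup>2 / 2 + u * x)) * (\<integral>y. f (0 + d * y) \<partial>lborel)"
    unfolding eq by (rule integral_mult_right_zero)
  also have "\<dots> = of_real (exp (d\<^sup>2 * x\<^sup>2 / 2 + u * x) * (sqrt (2 * pi) * exp (- (d * x + u / d)\<^sup>2 / 2) / d))"
    unfolding I by simp
  also have "exp (d\<^sup>2 * x\<^sup>2 / 2 + u * x) * (sqrt (2 * pi) * exp (- (d * x + u / d)\<^sup>2 / 2) / d)
      = sqrt (2 * pi) / d * (exp (d\<^sup>2 * x\<^sup>2 / 2 + u * x) * exp (- (d * x + u / d)\<^sup>2 / 2))" by simp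
  also have "exp (d\<^sup>2 * x\<^sup>2 / 2 + u * x) * exp (- (d * x + u / d)\<^sup>2 / 2) = exp (- u\<^sup>2 / (2 * d\<^sup>2))"
    unfolding exp_add[symmetric] using d by (intro arg_cong[of _ _ exp]) (simp add: field_simps power2_eq_square)
  also have "sqrt (2 * pi) / d * exp (- u\<^sup>2 / (2 * d\<^sup>2)) = 2 * pi * normal_density 0 d u"
  proof -
    have "sqrt (2 * pi * d\<^sup>2) = sqrt (2 * pi) * d" using d by (simp add: real_sqrt_mult)
    moreover have "sqrt (2 * pi) * sqrt (2 * pi) = 2 * pi" by simp
    ultimately have "sqrt (2 * pi) / d = 2 * pi * (1 / sqrt (2 * pi * d\<^sup>2))"
      using d by (simp add: field_simps)
    then show ?thesis by (simp add: normal_density_def)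
  qed
  finally show "(\<integral>y. gker d u (Complex x y) \<partial>lborel) = of_real (2 * pi * normal_density 0 d u)" .
qed

lemma normal_density_tail:
  assumes "d > 0" "h \<ge> 0" "\<bar>x\<bar> \<ge> h"
  shows "normal_density 0 d x \<le> sqrt 2 * exp (- (h / d)\<^sup>2 / 4) * normal_density 0 (sqrt 2 * d) x"
proof -
  define A A' p where "A = 1 / sqrt (2 * pi * d\<^sup>2)" and "A' = 1 / sqrt (2 * pi * (sqrt 2 * d)\<^sup>2)"
    and "p = exp (- (h / d)\<^sup>2 / 4)"
  have "sqrt (2 * pi * (sqrt 2 * d)\<^sup>2) = sqrt 2 * sqrt (2 * pi * d\<^sup>2)"
    by (simp add: real_sqrt_mult power_mult_distrib)
  then have A: "A = sqrt 2 * A'" by (simp add: A_def A'_def)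
  have "h\<^sup>2 \<le> x\<^sup>2" using assms by (metis abs_le_square_iff abs_of_nonneg)
  then have e: "exp (- x\<^sup>2 / (2 * d\<^sup>2)) \<le> exp (- (h / d)\<^sup>2 / 4 + - x\<^sup>2 / (2 * (sqrt 2 * d)\<^sup>2))"
    using assms by (simp add: field_simps power_mult_distrib)
  have "normal_density 0 d x = A * exp (- x\<^sup>2 / (2 * d\<^sup>2))" by (simp add: normal_density_def A_def)
  also have "\<dots> \<le> A * (p * exp (- x\<^sup>2 / (2 * (sqrt 2 * d)\<^sup>2)))"
    using e unfolding exp_add p_def by (intro mult_left_mono) (auto simp: A_def)
  also have "\<dots> = sqrt 2 * p * (A' * exp (- x\<^sup>2 / (2 * (sqrt 2 * d)\<^sup>2)))" unfolding A by simp
  also have "A' * exp (- x\<^sup>2 / (2 * (sqrt 2 * d)\<^sup>2)) = normal_density 0 (sqrt 2 * d) x"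
    by (simp add: normal_density_def A'_def)
  finally show ?thesis by (simp only: p_def)
qed

locale tauber =
  fixes q :: "real \<Rightarrow> real" and B c C :: real and H :: "complex \<Rightarrow> complex" and U :: "complex set"
  assumes q_meas [measurable]: "q \<in> borel_measurable borel"
    and q_bounds: "0 \<le> q v" "q v \<le> B"
    and q_mono: "0 \<le> h \<Longrightarrow> q v * exp (- h) \<le> q (v + h)"
    and c: "0 < c" "c \<le> 1"
    and U: "\<And>w. - c * (1 + \<bar>Im w\<bar>) powr (- 1/4) \<le> Re w \<Longrightarrow> Re w \<le> 1 \<Longrightarrow> w \<in> U"
    and H_bound: "\<And>w. - c * (1 + \<bar>Im w\<bar>) powr (- 1/4) \<le> Re w \<Longrightarrow> Re w \<le> 1 \<Longrightarrow> norm (H w) \<le> C"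
    and H_hol: "H holomorphic_on U"
    and H_eq: "\<And>w. Re w > 0 \<Longrightarrow> Re w \<le> 1 \<Longrightarrow>
        H w = (\<integral>v. of_real (indicator {0..} v * (q v - 1)) * exp (- (w * of_real v)) \<partial>lborel)"
begin

definition q0 :: "real \<Rightarrow> real" where "q0 v = indicator {0..} v * (q v - 1)"

lemma q0_meas [measurable]: "q0 \<in> borel_measurable borel"
  unfolding q0_def by measurable

lemma B_nonneg: "B \<ge> 0"
  using q_bounds[of 0] by linarith

lemma abs_q0_le: "\<bar>q0 v\<bar> \<le> (B + 1) * indicator {0..} v"
  using q_bounds[of v] by (auto simp: q0_def indicator_def)

lemma C_nonneg: "C \<ge> 0"
  using H_bound[of 0] c order_trans[OF norm_ge_zero[of "H 0"]] by auto

lemma smoothed_eq: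
  assumes d: "d > 0" and e: "0 < e" "e \<le> 1"
  shows "integrable lborel (\<lambda>y. H (Complex e y) * gker d u (Complex e y))"
    and "of_real (2 * pi * (\<integral>v. q0 v * normal_density 0 d (u - v) \<partial>lborel)) = (\<integral>y. H (Complex e y) * gker d u (Complex e y) \<partial>lborel)"
proof -
  define F where "F = (\<lambda>y v. of_real (q0 v) * exp (- (Complex e y * of_real v)) * gker d u (Complex e y))"
  have Complex_eq': "Complex e y = of_real e + \<i> * of_real y" for y by (simp add: complex_eq_iff)
  have expint: "integrable lborel (\<lambda>v. (B + 1) * (indicator {0..} v *\<^sub>R exp (- (e * v))))"
    using integrable_exp_neg[OF e(1), of 0] by simp
  have meas: "(\<lambda>p. F (fst p) (snd p)) \<in> borel_measurable (lborel \<Otimes>\<^sub>M lborel)"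
    unfolding F_def gker_def Complex_eq' by measurable
  have FI: "integrable (lborel \<Otimes>\<^sub>M lborel) (case_prod F)"
  proof (rule Bochner_Integration.integrable_bound)
    let ?g = "\<lambda>(y, v). norm (gker d u (Complex e y)) * ((B + 1) * (indicator {0..} v *\<^sub>R exp (- (e * v))))"
    show "integrable (lborel \<Otimes>\<^sub>M lborel) ?g"
      using gker_integral(1)[OF d, of u e] expint
      by (intro integrable_prod_mult integrable_norm)
    show "case_prod F \<in> borel_measurable (lborel \<Otimes>\<^sub>M lborel)" using meas by (simp add: case_prod_unfold)
    show "AE p in lborel \<Otimes>\<^sub>M lborel. norm (case_prod F p) \<le> norm (?g p)"
    proof (rule AE_I2, clarify)
      fix y v
      have "norm (F y v) = \<bar>q0 v\<bar> * exp (- (e * v)) * norm (gker d u (Complex e y))"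
        by (simp add: F_def norm_mult)
      also have "\<dots> \<le> (B + 1) * indicator {0..} v * exp (- (e * v)) * norm (gker d u (Complex e y))"
        by (intro mult_right_mono abs_q0_le) auto
      finally show "norm (F y v) \<le> norm (norm (gker d u (Complex e y)) * ((B + 1) * (indicator {0..} v *\<^sub>R exp (- (e * v)))))"
        using B_nonneg by (simp add: abs_mult mult_ac)
    qed
  qed
  have inner: "(\<integral>v. F y v \<partial>lborel) = H (Complex e y) * gker d u (Complex e y)" for y
    using H_eq[of "Complex e y"] e by (simp add: F_def q0_def)
  show "integrable lborel (\<lambda>y. H (Complex e y) * gker d u (Complex e y))"
    using lborel_pair.integrable_fst[OF FI] by (simp add: inner)
  have "(\<integral>y. H (Complex e y) * gker d u (Complex e y) \<partial>lborel) = (\<integral>y. (\<integral>v. F y v \<partial>lborel) \<partial>lborel)"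
    by (simp add: inner)
  also have "\<dots> = (\<integral>v. (\<integral>y. F y v \<partial>lborel) \<partial>lborel)"
    by (rule lborel_pair.Fubini_integral[OF FI, symmetric])
  also have "\<dots> = (\<integral>v. of_real (2 * pi * (q0 v * normal_density 0 d (u - v))) \<partial>lborel)"
  proof (rule Bochner_Integration.integral_cong[OF refl])
    fix v
    have "F y v = of_real (q0 v) * gker d (u - v) (Complex e y)" for y
      unfolding F_def gker_def mult.assoc exp_add[symmetric] by (simp add: algebra_simps)
    then show "(\<integral>y. F y v \<partial>lborel) = of_real (2 * pi * (q0 v * normal_density 0 d (u - v)))"
      using gker_integral(2)[OF d, of "u - v" e] by (simp add: mult_ac)
  qed
  also have "\<dots> = of_real (\<integral>v. 2 * pi * (q0 v * normal_density 0 d (u - v)) \<partial>lborel)"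
    by (rule integral_complex_of_real)
  also have "(\<integral>v. 2 * pi * (q0 v * normal_density 0 d (u - v)) \<partial>lborel) = 2 * pi * (\<integral>v. q0 v * normal_density 0 d (u - v) \<partial>lborel)"
    by (rule integral_mult_right_zero)
  finally show "of_real (2 * pi * (\<integral>v. q0 v * normal_density 0 d (u - v) \<partial>lborel)) = (\<integral>y. H (Complex e y) * gker d u (Complex e y) \<partial>lborel)" ..
qed

definition J :: "real \<Rightarrow> real \<Rightarrow> real" where
  "J d u = (\<integral>v. q0 v * normal_density 0 d (u - v) \<partial>lborel)"

lemma norm_gker_le:
  assumes "\<bar>x\<bar> \<le> 1" "0 < d" "d \<le> 1"
  shows "norm (gker d u (Complex x y)) \<le> exp (1/2 + u * x - (d * y)\<^sup>2 / 2)"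
proof -
  have "d\<^sup>2 \<le> 1" "x\<^sup>2 \<le> 1" using assms by (simp_all add: abs_square_le_1 power_le_one)
  then have "d\<^sup>2 * x\<^sup>2 \<le> 1 * 1" by (intro mult_mono) auto
  then show ?thesis by (simp add: norm_gker power_mult_distrib)
qed

lemma J_bound:
  assumes d: "0 < d" "d \<le> 1" and u: "u \<ge> 1" and T: "T > 0"
  defines "X \<equiv> c / 2 * (2 + T) powr (- 1/4)"
  shows "\<bar>J d u\<bar> \<le> C * exp 1 * (4 * exp (- (d * T)\<^sup>2 / 2) + 2 * T * exp (- u * X) + 2 * sqrt pi / d * exp (- (d * T)\<^sup>2 / 4))"
proof -
  define e where "e = 1 / (2 * u)"
  have e: "0 < e" "e \<le> 1/2" "u * e = 1/2" using u by (auto simp: e_def field_simps)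
  have "(2 + T) powr (- 1/4) \<le> (2 + T) powr 0" using T by (intro powr_mono) auto
  then have "c / 2 * (2 + T) powr (- 1/4) \<le> 1/2 * 1" using c T by (intro mult_mono) auto
  then have X: "0 < X" "X \<le> 1/2" using c T by (auto simp: X_def)
  define f where "f = (\<lambda>w. H w * gker d u w)"
  have fe: "f (Complex e y) = H (Complex e y) * gker d u (Complex e y)" for y by (simp add: f_def)
  have Hb: "norm (H (Complex x y)) \<le> C" if "0 \<le> x" "x \<le> 1" for x y
  proof (rule H_bound)
    have "0 \<le> c * (1 + \<bar>y\<bar>) powr (- 1/4)" using c by simp
    then have "- c * (1 + \<bar>y\<bar>) powr (- 1/4) \<le> x" using that by simp
    then show "- c * (1 + \<bar>Im (Complex x y)\<bar>) powr (- 1/4) \<le> Re (Complex x y)" by simp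
  qed (use that in simp)
  have fI: "integrable lborel (\<lambda>y. f (Complex e y))" and
       fJ: "of_real (2 * pi * J d u) = (\<integral>y. f (Complex e y) \<partial>lborel)"
    using smoothed_eq[OF d(1), of e u] e unfolding J_def fe by auto
  define S where "S = box (Complex (- (2 * X)) (- (T + 1))) (Complex 1 (T + 1))"
  have S: "w \<in> S \<longleftrightarrow> - (2 * X) < Re w \<and> Re w < 1 \<and> \<bar>Im w\<bar> < T + 1" for w
    by (auto simp: S_def in_box_complex_iff)
  have region: "- c * (1 + \<bar>Im w\<bar>) powr (- 1/4) \<le> Re w \<and> Re w \<le> 1" if "w \<in> S" for w
  proof -
    have "(2 + T) powr (- 1/4) \<le> (1 + \<bar>Im w\<bar>) powr (- 1/4)"
      using that by (intro powr_mono2') (auto simp: S)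
    then have "c * (2 + T) powr (- 1/4) \<le> c * (1 + \<bar>Im w\<bar>) powr (- 1/4)" using c by (intro mult_left_mono) auto
    then show ?thesis using that by (simp add: S X_def)
  qed
  have SU: "S \<subseteq> U" using region U by blast
  have Sc: "convex S" "open S" by (auto simp: S_def convex_box open_box)
  have "f holomorphic_on S"
    unfolding f_def gker_def by (intro holomorphic_intros holomorphic_on_subset[OF H_hol SU])
  then obtain g where g: "\<And>w. w \<in> S \<Longrightarrow> (g has_field_derivative f w) (at w within S)"
    using holomorphic_convex_primitive'[OF Sc] by blast
  have g': "(g has_field_derivative f w) (at w within A)" if "w \<in> S" for w A
    using g[OF that] at_within_open[OF that Sc(2)] has_field_derivative_at_within by metis
  have seg: "norm (g b - g a) \<le> K * norm (b - a)"
    if "a \<in> S" "b \<in> S" and K: "\<And>w. w \<in> closed_segment a b \<Longrightarrow> norm (f w) \<le> K" for a b K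
  proof (rule field_differentiable_bound)
    show "convex (closed_segment a b)" by simp
    fix w assume w: "w \<in> closed_segment a b"
    then have "w \<in> S" using closed_segment_subset[OF that(1,2) Sc(1)] by blast
    then show "(g has_field_derivative f w) (at w within closed_segment a b)" by (rule g')
    show "norm (f w) \<le> K" by (rule K[OF w])
  qed auto
  have fb: "norm (f w) \<le> C * exp (1/2 + u * Re w - (d * Im w)\<^sup>2 / 2)" if "w \<in> S" "\<bar>Re w\<bar> \<le> 1" for w
    unfolding f_def norm_mult using norm_gker_le[of "Re w" d u "Im w"] that d region[OF that(1)] C_nonneg
    by (intro mult_mono H_bound) auto
  have inS: "Complex x y \<in> S" if "- X \<le> x" "x \<le> e" "\<bar>y\<bar> \<le> T" for x y
    using that X e by (simp add: S)
  have horiz: "norm (g (Complex x1 y) - g (Complex x2 y)) \<le> 2 * C * exp 1 * exp (- (d * T)\<^sup>2 / 2)"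
    if x: "- X \<le> x1" "x1 \<le> e" "- X \<le> x2" "x2 \<le> e" and y: "\<bar>y\<bar> = T" for x1 x2 y
  proof -
    have "norm (g (Complex x1 y) - g (Complex x2 y)) \<le> (C * exp (1 - (d * T)\<^sup>2 / 2)) * norm (Complex x1 y - Complex x2 y)"
    proof (rule seg)
      show "Complex x2 y \<in> S" "Complex x1 y \<in> S" using x y by (auto intro: inS)
      fix w assume "w \<in> closed_segment (Complex x2 y) (Complex x1 y)"
      then obtain t where t: "w = (1 - t) *\<^sub>R Complex x2 y + t *\<^sub>R Complex x1 y" "0 \<le> t" "t \<le> 1"
        by (auto simp: closed_segment_def)
      have im: "Im w = y" unfolding t(1) by (simp add: algebra_simps)
      have re: "Re w = (1 - t) * x2 + t * x1" unfolding t(1) by simp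
      have "(1 - t) * (- X) + t * (- X) \<le> Re w" "Re w \<le> (1 - t) * e + t * e"
        unfolding re using t x by (intro add_mono mult_left_mono; simp)+
      then have re': "- X \<le> Re w" "Re w \<le> e" by (simp_all add: algebra_simps)
      have "w \<in> S" using re' im y X e by (simp add: S)
      then have "norm (f w) \<le> C * exp (1/2 + u * Re w - (d * Im w)\<^sup>2 / 2)"
        using re' X e by (intro fb) auto
      also have "\<dots> \<le> C * exp (1 - (d * T)\<^sup>2 / 2)"
      proof -
        have "u * Re w \<le> 1/2" using mult_left_mono[OF re'(2), of u] u e by simp
        moreover have "(d * Im w)\<^sup>2 = (d * T)\<^sup>2" using im y by (metis power2_abs power_mult_distrib)
        ultimately show ?thesis using C_nonneg by (intro mult_left_mono) auto
      qed
      finally show "norm (f w) \<le> C * exp (1 - (d * T)\<^sup>2 / 2)" .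
    qed
    also have "norm (Complex x1 y - Complex x2 y) = \<bar>x1 - x2\<bar>" by (simp add: cmod_def)
    also have "(C * exp (1 - (d * T)\<^sup>2 / 2)) * \<bar>x1 - x2\<bar> \<le> (C * exp (1 - (d * T)\<^sup>2 / 2)) * 2"
      using C_nonneg x X e by (intro mult_left_mono) auto
    also have "\<dots> = 2 * C * exp 1 * exp (- (d * T)\<^sup>2 / 2)" using exp_add[of 1 "- (d * T)\<^sup>2 / 2"] by simp
    finally show ?thesis .
  qed
  have vert: "norm (g (Complex (- X) T) - g (Complex (- X) (- T))) \<le> 2 * C * exp 1 * (T * exp (- u * X))"
  proof -
    have "norm (g (Complex (- X) T) - g (Complex (- X) (- T))) \<le> (C * exp (1 - u * X)) * norm (Complex (- X) T - Complex (- X) (- T))"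
    proof (rule seg)
      show "Complex (- X) (- T) \<in> S" "Complex (- X) T \<in> S" using X e T by (auto intro!: inS)
      fix w assume "w \<in> closed_segment (Complex (- X) (- T)) (Complex (- X) T)"
      then obtain t where t: "w = (1 - t) *\<^sub>R Complex (- X) (- T) + t *\<^sub>R Complex (- X) T" "0 \<le> t" "t \<le> 1"
        by (auto simp: closed_segment_def)
      have re: "Re w = - X" unfolding t(1) by (simp add: algebra_simps)
      have im: "Im w = (1 - t) * (- T) + t * T" unfolding t(1) by simp
      have "(1 - t) * (- T) + t * (- T) \<le> Im w" "Im w \<le> (1 - t) * T + t * T"
        unfolding im using t T by (intro add_mono mult_left_mono; simp)+
      then have im': "\<bar>Im w\<bar> \<le> T" by (simp add: algebra_simps)
      have "w \<in> S" using re im' X e by (simp add: S)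
      then have "norm (f w) \<le> C * exp (1/2 + u * Re w - (d * Im w)\<^sup>2 / 2)"
        using re X by (intro fb) auto
      also have "\<dots> \<le> C * exp (1 - u * X)"
      proof -
        have "u * Re w = - (u * X)" by (simp add: re)
        then have "1/2 + u * Re w - (d * Im w)\<^sup>2 / 2 \<le> 1 - u * X" using zero_le_power2[of "d * Im w"] by linarith
        then show ?thesis using C_nonneg by (intro mult_left_mono) auto
      qed
      finally show "norm (f w) \<le> C * exp (1 - u * X)" .
    qed
    also have "norm (Complex (- X) T - Complex (- X) (- T)) = 2 * T" using T by (simp add: cmod_def real_sqrt_mult)
    also have "C * exp (1 - u * X) * (2 * T) = 2 * C * exp 1 * (T * exp (- u * X))" using exp_add[of 1 "- u * X"] by simp
    finally show ?thesis .
  qed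
  have FTC: "(\<integral>y. indicator {- T..T} y *\<^sub>R f (Complex e y) \<partial>lborel) = - \<i> * g (Complex e T) - (- \<i> * g (Complex e (- T)))"
  proof (rule integral_FTC_atLeastAtMost)
    have Ce: "Complex e = (\<lambda>y. of_real e + \<i> * of_real y)" by (auto simp: complex_eq_iff)
    show "- T \<le> T" using T by simp
    fix y assume y: "- T \<le> y" "y \<le> T"
    have "(Complex e has_vector_derivative \<i>) (at y within {- T..T})"
      unfolding Ce by (auto intro!: derivative_eq_intros)
    moreover have "(g has_field_derivative f (Complex e y)) (at (Complex e y) within Complex e ` {- T..T})"
      using y X e by (intro g' inS) auto
    ultimately have "((g \<circ> Complex e) has_vector_derivative (\<i> * f (Complex e y))) (at y within {- T..T})"
      by (rule field_vector_diff_chain_within)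
    then have "((\<lambda>y. - \<i> * (g \<circ> Complex e) y) has_vector_derivative - \<i> * (\<i> * f (Complex e y))) (at y within {- T..T})"
      by (rule has_vector_derivative_mult_right)
    then show "((\<lambda>y. - \<i> * g (Complex e y)) has_vector_derivative f (Complex e y)) (at y within {- T..T})"
      by (simp add: mult.assoc[symmetric])
  next
    have Ce: "Complex e = (\<lambda>y. of_real e + \<i> * of_real y)" by (auto simp: complex_eq_iff)
    show "continuous_on {- T..T} (\<lambda>y. f (Complex e y))"
    proof (rule continuous_on_compose2[of S f])
      show "continuous_on S f" using \<open>f holomorphic_on S\<close> by (rule holomorphic_on_imp_continuous_on)
      show "continuous_on {- T..T} (Complex e)" unfolding Ce by (intro continuous_intros)
      show "Complex e ` {- T..T} \<subseteq> S" using X e by (auto intro!: inS)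
    qed
  qed
  define I1 I2 where "I1 = (\<integral>y. indicator {- T..T} y *\<^sub>R f (Complex e y) \<partial>lborel)"
    and "I2 = (\<integral>y. indicator (- {- T..T}) y *\<^sub>R f (Complex e y) \<partial>lborel)"
  have i1: "integrable lborel (\<lambda>y. indicator {- T..T} y *\<^sub>R f (Complex e y))"
    and i2: "integrable lborel (\<lambda>y. indicator (- {- T..T}) y *\<^sub>R f (Complex e y))"
    by (intro integrable_mult_indicator fI; simp)+
  have "(\<integral>y. f (Complex e y) \<partial>lborel) = (\<integral>y. indicator {- T..T} y *\<^sub>R f (Complex e y) + indicator (- {- T..T}) y *\<^sub>R f (Complex e y) \<partial>lborel)"
    by (intro Bochner_Integration.integral_cong) (auto simp: indicator_def)
  also have "\<dots> = I1 + I2" unfolding I1_def I2_def by (rule Bochner_Integration.integral_add[OF i1 i2])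
  finally have split: "of_real (2 * pi * J d u) = I1 + I2" using fJ by simp
  have "norm I1 = norm (g (Complex e T) - g (Complex e (- T)))"
  proof -
    have "I1 = - \<i> * (g (Complex e T) - g (Complex e (- T)))" unfolding I1_def FTC by (simp add: algebra_simps)
    then show ?thesis by (simp only: norm_mult) simp
  qed
  also have "\<dots> \<le> norm (g (Complex e T) - g (Complex (- X) T)) + norm (g (Complex (- X) T) - g (Complex (- X) (- T))) + norm (g (Complex (- X) (- T)) - g (Complex e (- T)))"
  proof -
    have "g (Complex e T) - g (Complex e (- T)) = (g (Complex e T) - g (Complex (- X) T)) + (g (Complex (- X) T) - g (Complex (- X) (- T))) + (g (Complex (- X) (- T)) - g (Complex e (- T)))"
      by simp
    then show ?thesis by (metis norm_triangle_le add_mono norm_triangle_ineq order_refl)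
  qed
  also have "\<dots> \<le> 2 * C * exp 1 * exp (- (d * T)\<^sup>2 / 2) + 2 * C * exp 1 * (T * exp (- u * X)) + 2 * C * exp 1 * exp (- (d * T)\<^sup>2 / 2)"
    using X e T by (intro add_mono horiz vert) auto
  finally have n1: "norm I1 \<le> C * exp 1 * (4 * exp (- (d * T)\<^sup>2 / 2) + 2 * T * exp (- u * X))"
    by (simp add: algebra_simps)
  have n2: "norm I2 \<le> C * exp 1 * (2 * sqrt pi / d * exp (- (d * T)\<^sup>2 / 4))"
  proof -
    define K where "K = C * exp 1 * (2 * sqrt pi / d * exp (- (d * T)\<^sup>2 / 4))"
    have K: "K \<ge> 0" using C_nonneg d by (simp add: K_def)
    have le: "norm (indicator (- {- T..T}) y *\<^sub>R f (Complex e y)) \<le> K * normal_density 0 (sqrt 2 / d) y" for y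
    proof (cases "y \<in> {- T..T}")
      case False
      then have "\<bar>T\<bar> \<le> \<bar>y\<bar>" using T by (auto simp: abs_if)
      then have "(d * T)\<^sup>2 \<le> (d * y)\<^sup>2" unfolding power_mult_distrib by (intro mult_left_mono) (auto simp: abs_le_square_iff)
      then have q: "1/2 + u * e - (d * y)\<^sup>2 / 2 \<le> 1 + (- (d * T)\<^sup>2 / 4 + - (d * y)\<^sup>2 / 4)" using e by simp
      have "norm (f (Complex e y)) \<le> C * exp (1/2 + u * e - (d * y)\<^sup>2 / 2)"
        unfolding f_def norm_mult using e d by (intro mult_mono Hb norm_gker_le C_nonneg) auto
      also have "\<dots> \<le> C * exp (1 + (- (d * T)\<^sup>2 / 4 + - (d * y)\<^sup>2 / 4))" using q C_nonneg by (intro mult_left_mono) auto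
      also have "\<dots> = C * exp 1 * exp (- (d * T)\<^sup>2 / 4) * exp (- (d * y)\<^sup>2 / 4)" by (simp only: exp_add mult.assoc)
      also have "exp (- (d * y)\<^sup>2 / 4) = 2 * sqrt pi / d * normal_density 0 (sqrt 2 / d) y"
      proof -
        have "sqrt (2 * pi * (sqrt 2 / d)\<^sup>2) = 2 * sqrt pi / d"
          using d by (simp add: power_divide real_sqrt_mult real_sqrt_divide)
        then show ?thesis using d by (simp add: normal_density_def power_divide power_mult_distrib)
      qed
      finally show ?thesis using False by (simp add: K_def mult_ac)
    qed (use K in auto)
    have "norm I2 \<le> (\<integral>y. norm (indicator (- {- T..T}) y *\<^sub>R f (Complex e y)) \<partial>lborel)"
      unfolding I2_def by (rule integral_norm_bound)
    also have "\<dots> \<le> (\<integral>y. K * normal_density 0 (sqrt 2 / d) y \<partial>lborel)"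
      using d by (intro integral_mono integrable_norm i2 le integrable_mult_right integrable_normal_density) auto
    also have "\<dots> = K" using d by simp
    finally show ?thesis by (simp add: K_def)
  qed
  have "norm (of_real (2 * pi * J d u) :: complex) \<le> norm I1 + norm I2" unfolding split by (rule norm_triangle_ineq)
  then have "2 * pi * \<bar>J d u\<bar> \<le> norm I1 + norm I2" unfolding norm_of_real by (simp add: abs_mult)
  moreover have "1 * \<bar>J d u\<bar> \<le> 2 * pi * \<bar>J d u\<bar>" using pi_ge_two by (intro mult_right_mono) auto
  ultimately have "\<bar>J d u\<bar> \<le> norm I1 + norm I2" by linarith
  then show ?thesis using n1 n2 by (simp add: distrib_left)
qed

lemma J_asymp: "\<exists>D u0. D > 0 \<and> u0 \<ge> 1 \<and> (\<forall>u\<ge>u0. \<bar>J (u powr (- 3/2)) u\<bar> \<le> D * u powr (- 5/4))"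
proof -
  define G where "G = (\<lambda>u. C * exp 1 * (4 * exp (- u / 2) + 2 * u\<^sup>2 * exp (- u * (c / 2 * (2 + u\<^sup>2) powr (- 1/4))) + 2 * sqrt pi * u powr (3/2) * exp (- u / 4)))"
  have 1: "(\<lambda>u :: real. 4 * exp (- u / 2)) \<in> O[at_top](\<lambda>u. u powr (- 5/4))" by real_asymp
  have 2: "(\<lambda>u. 2 * u\<^sup>2 * exp (- u * (c / 2 * (2 + u\<^sup>2) powr (- 1/4)))) \<in> O[at_top](\<lambda>u. u powr (- 5/4))"
    using c by real_asymp
  have 3: "(\<lambda>u :: real. 2 * sqrt pi * u powr (3/2) * exp (- u / 4)) \<in> O[at_top](\<lambda>u. u powr (- 5/4))"
    using pi_gt_zero by real_asymp
  have cm: "(\<lambda>u. k * f u) \<in> O[at_top](g)" if "f \<in> O[at_top](g)" for k :: real and f g :: "real \<Rightarrow> real"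
    using that by (cases "k = 0") simp_all
  have "G \<in> O[at_top](\<lambda>u. u powr (- 5/4))"
    unfolding G_def mult.assoc[of C] by (rule cm, rule cm, rule sum_in_bigo(1)[OF sum_in_bigo(1)[OF 1 2] 3])
  then obtain D where D: "D > 0" "\<forall>\<^sub>F u in at_top. norm (G u) \<le> D * norm (u powr (- 5/4))"
    using landau_o.bigE by blast
  then obtain u1 where u1: "\<And>u. u \<ge> u1 \<Longrightarrow> norm (G u) \<le> D * norm (u powr (- 5/4))"
    by (auto simp: eventually_at_top_linorder)
  have "\<bar>J (u powr (- 3/2)) u\<bar> \<le> D * u powr (- 5/4)" if u: "u \<ge> max 1 u1" for u
  proof -
    define d where "d = u powr (- 3/2)"
    have "d \<le> u powr 0" unfolding d_def using u by (intro powr_mono) auto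
    then have d: "0 < d" "d \<le> 1" using u by (auto simp: d_def)
    have "u\<^sup>2 = u powr 2" using u by (simp add: powr_numeral)
    then have "d * u\<^sup>2 = u powr (1/2)" by (simp add: d_def flip: powr_add)
    then have dT: "(d * u\<^sup>2)\<^sup>2 = u" using u by (simp add: powr_half_sqrt)
    have "1 / d = u powr (3/2)" unfolding d_def by (simp add: powr_minus_divide)
    then have d1: "2 * sqrt pi / d = 2 * sqrt pi * u powr (3/2)" by (metis mult.right_neutral times_divide_eq_right)
    have "\<bar>J d u\<bar> \<le> G u" using J_bound[OF d, of u "u\<^sup>2"] u unfolding dT d1 by (simp add: G_def)
    then show ?thesis using u1[of u] u by (simp add: d_def)
  qed
  then show ?thesis using D(1) by (intro exI[of _ D] exI[of _ "max 1 u1"]) auto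
qed

lemma unsmooth:
  assumes p [measurable]: "p \<in> borel_measurable borel" and bd: "\<And>v. \<bar>p v\<bar> \<le> B1"
    and d: "d > 0" and h: "h \<ge> 0" and k: "\<And>v. \<bar>u - v\<bar> \<le> h \<Longrightarrow> k \<le> p v"
  shows "k \<le> (\<integral>v. p v * normal_density 0 d (u - v) \<partial>lborel) + (B1 + \<bar>k\<bar>) * (sqrt 2 * exp (- (h / d)\<^sup>2 / 4))"
proof -
  have nd: "normal_density 0 s (u - v) = normal_density u s v" for s v
    by (simp add: normal_density_def power2_commute)
  have B1: "B1 \<ge> 0" using bd[of 0] by linarith
  define E where "E = (B1 + \<bar>k\<bar>) * (sqrt 2 * exp (- (h / d)\<^sup>2 / 4))"
  have E: "E \<ge> 0" using B1 by (simp add: E_def)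
  have I: "integrable lborel (\<lambda>v. p v * normal_density u d v)"
  proof (rule Bochner_Integration.integrable_bound)
    show "integrable lborel (\<lambda>v. B1 * normal_density u d v)" using d by simp
    show "AE v in lborel. norm (p v * normal_density u d v) \<le> norm (B1 * normal_density u d v)"
      using bd B1 by (auto simp: abs_mult intro!: mult_right_mono)
  qed simp
  have I2: "integrable lborel (\<lambda>v. k * normal_density u d v - E * normal_density u (sqrt 2 * d) v)" using d by simp
  have "k - E = (\<integral>v. k * normal_density u d v - E * normal_density u (sqrt 2 * d) v \<partial>lborel)"
    using d by (simp add: Bochner_Integration.integral_diff)
  also have "\<dots> \<le> (\<integral>v. p v * normal_density u d v \<partial>lborel)"
  proof (rule integral_mono[OF I2 I])
    fix v
    show "k * normal_density u d v - E * normal_density u (sqrt 2 * d) v \<le> p v * normal_density u d v"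
    proof (cases "\<bar>u - v\<bar> \<le> h")
      case True
      then have "k * normal_density u d v \<le> p v * normal_density u d v" by (intro mult_right_mono k) auto
      moreover have "E * normal_density u (sqrt 2 * d) v \<ge> 0" using E by simp
      ultimately show ?thesis by linarith
    next
      case False
      then have "normal_density 0 d (u - v) \<le> sqrt 2 * exp (- (h / d)\<^sup>2 / 4) * normal_density 0 (sqrt 2 * d) (u - v)"
        using d h by (intro normal_density_tail) auto
      then have "(B1 + \<bar>k\<bar>) * normal_density u d v \<le> (B1 + \<bar>k\<bar>) * (sqrt 2 * exp (- (h / d)\<^sup>2 / 4) * normal_density u (sqrt 2 * d) v)"
        unfolding nd using B1 by (intro mult_left_mono) auto
      then have 1: "(B1 + \<bar>k\<bar>) * normal_density u d v \<le> E * normal_density u (sqrt 2 * d) v" by (simp add: E_def mult_ac)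
      have "k - p v \<le> B1 + \<bar>k\<bar>" using bd[of v] by linarith
      then have "(k - p v) * normal_density u d v \<le> (B1 + \<bar>k\<bar>) * normal_density u d v" by (intro mult_right_mono) auto
      with 1 show ?thesis by (simp add: algebra_simps)
    qed
  qed
  finally show ?thesis by (simp add: nd E_def)
qed

text \<open>Since \<open>q (v + h) \<ge> q v * exp (- h)\<close>, the value \<open>q u\<close> controls \<open>q\<close> from below to the right of \<open>u\<close>
  and from above to the left of \<open>u\<close>, so it is compared with Gaussian means centred at \<open>u \<pm> h\<close>.\<close>

theorem tauberian: "\<exists>D. \<forall>u\<ge>1. \<bar>q u - 1\<bar> \<le> D * u powr (- 5/4)"
proof -
  obtain D u0 where J: "D > 0" "u0 \<ge> 1" "\<And>u. u \<ge> u0 \<Longrightarrow> \<bar>J (u powr (- 3/2)) u\<bar> \<le> D * u powr (- 5/4)"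
    using J_asymp by blast
  have "(\<lambda>u :: real. exp (- sqrt u / 32)) \<in> O[at_top](\<lambda>u. u powr (- 5/4))" by real_asymp
  then obtain D2 where D2: "D2 > 0" "\<forall>\<^sub>F u in at_top. norm (exp (- sqrt u / 32)) \<le> D2 * norm (u powr (- 5/4))"
    using landau_o.bigE by blast
  then obtain u1 where u1: "\<And>u. u \<ge> u1 \<Longrightarrow> exp (- sqrt u / 32) \<le> D2 * u powr (- 5/4)"
    by (auto simp: eventually_at_top_linorder)
  define K where "K = (2 * B + 2 + 2 * B + 4 * B) * sqrt 2"
  define U0 where "U0 = Max {4, 2 * u0, u1}"
  have U0: "U0 \<ge> 4" "U0 \<ge> 2 * u0" "U0 \<ge> u1" by (auto simp: U0_def)
  have large: "\<bar>q u - 1\<bar> \<le> (4 * B + 4 * D + K * D2) * u powr (- 5/4)" if u: "u \<ge> U0" for u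
  proof -
    have u4: "u \<ge> 4" using u U0 by simp
    define h where "h = u powr (- 5/4)"
    have "h \<le> u powr (- 1)" unfolding h_def using u4 by (intro powr_mono) auto
    also have "\<dots> \<le> 1/4" using u4 by (simp add: powr_minus field_simps)
    finally have h: "0 < h" "h \<le> 1/4" using u4 by (auto simp: h_def)
    have err: "\<bar>J (w powr (- 3/2)) w\<bar> \<le> 4 * D * h"
        "sqrt 2 * exp (- (h / w powr (- 3/2))\<^sup>2 / 4) \<le> sqrt 2 * (D2 * h)" if w: "w \<ge> u / 2" for w
    proof -
      have "\<bar>J (w powr (- 3/2)) w\<bar> \<le> D * w powr (- 5/4)" using w u U0 by (intro J) auto
      also have "\<dots> \<le> D * (u / 2) powr (- 5/4)" using w u4 J(1) by (intro mult_left_mono powr_mono2') auto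
      also have "(u / 2) powr (- 5/4) = 2 powr (5/4) * h" unfolding h_def by (simp add: powr_divide powr_minus field_simps)
      also have "D * (2 powr (5/4) * h) \<le> D * (2 powr 2 * h)"
        using J(1) h by (intro mult_left_mono mult_right_mono powr_mono) auto
      finally show "\<bar>J (w powr (- 3/2)) w\<bar> \<le> 4 * D * h" by simp
      have "(u / 2) powr (3/2) \<le> w powr (3/2)" using w u4 by (intro powr_mono2) auto
      then have "h * (u / 2) powr (3/2) \<le> h * w powr (3/2)" using h by (intro mult_left_mono) auto
      moreover have "h * (u / 2) powr (3/2) = u powr (1/4) / 2 powr (3/2)"
        unfolding h_def by (simp add: powr_divide flip: powr_add)
      moreover have "h / w powr (- 3/2) = h * w powr (3/2)" by (simp add: powr_minus_divide)
      ultimately have "u powr (1/4) / 2 powr (3/2) \<le> h / w powr (- 3/2)" by simp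
      then have "(u powr (1/4) / 2 powr (3/2))\<^sup>2 \<le> (h / w powr (- 3/2))\<^sup>2" by (intro power_mono) auto
      moreover have "(u powr (1/4) / 2 powr (3/2))\<^sup>2 = sqrt u / 8"
      proof -
        have "(u powr (1/4))\<^sup>2 = u powr (1/2)" by (simp add: power2_eq_square flip: powr_add)
        moreover have "((2 :: real) powr (3/2))\<^sup>2 = 2 powr 3" by (simp add: power2_eq_square flip: powr_add)
        ultimately show ?thesis using u4 by (simp add: power_divide powr_half_sqrt powr_numeral)
      qed
      ultimately have "exp (- (h / w powr (- 3/2))\<^sup>2 / 4) \<le> exp (- sqrt u / 32)" by simp
      also have "\<dots> \<le> D2 * h" unfolding h_def using u U0 by (intro u1) auto
      finally show "sqrt 2 * exp (- (h / w powr (- 3/2))\<^sup>2 / 4) \<le> sqrt 2 * (D2 * h)" by simp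
    qed
    have q0b: "\<bar>q0 v\<bar> \<le> B + 1" for v using abs_q0_le[of v] B_nonneg by (cases "v \<ge> 0") auto
    have q0': "q0 v = q v - 1" if "v \<ge> 0" for v using that by (simp add: q0_def)
    have qB: "0 \<le> q u" "q u \<le> B" using q_bounds by auto
    have Bh: "0 \<le> B * h" "B * h \<le> B * 1" using B_nonneg h mult_left_mono[of h 1 B] by auto
    have upper: "q u - 1 \<le> (4 * B + 4 * D + K * D2) * h"
    proof -
      define k where "k = q u - 1 - 2 * B * h"
      have "k \<le> (\<integral>v. q0 v * normal_density 0 ((u + h) powr (- 3/2)) (u + h - v) \<partial>lborel)
          + (B + 1 + \<bar>k\<bar>) * (sqrt 2 * exp (- (h / (u + h) powr (- 3/2))\<^sup>2 / 4))"
      proof (rule unsmooth)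
        fix v assume "\<bar>u + h - v\<bar> \<le> h"
        then have v: "u \<le> v" "v - u \<le> 2 * h" by linarith+
        have "1 - 2 * h \<le> exp (- (v - u))" using exp_ge_add_one_self[of "- (v - u)"] v by linarith
        then have "q u * (1 - 2 * h) \<le> q u * exp (- (v - u))" using qB by (intro mult_left_mono) auto
        also have "\<dots> \<le> q (u + (v - u))" using v by (intro q_mono) auto
        finally have "q u * (1 - 2 * h) \<le> q v" by simp
        moreover have "q u * h \<le> B * h" using qB h by (intro mult_right_mono) auto
        ultimately show "k \<le> q0 v" using v u4 by (simp add: q0' k_def algebra_simps)
      qed (use h u4 q0b in auto)
      also have "\<dots> \<le> 4 * D * h + (2 * B + 2 + 2 * B + 4 * B) * (sqrt 2 * (D2 * h))"
      proof (rule add_mono[OF _ mult_mono])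
        show "(\<integral>v. q0 v * normal_density 0 ((u + h) powr (- 3/2)) (u + h - v) \<partial>lborel) \<le> 4 * D * h"
          using err(1)[of "u + h"] h u4 by (simp add: J_def)
        show "B + 1 + \<bar>k\<bar> \<le> 2 * B + 2 + 2 * B + 4 * B" unfolding k_def using qB Bh by (simp add: abs_if)
        show "sqrt 2 * exp (- (h / (u + h) powr (- 3/2))\<^sup>2 / 4) \<le> sqrt 2 * (D2 * h)"
          using h u4 by (intro err) auto
      qed (use B_nonneg in auto)
      finally show ?thesis using Bh by (simp add: k_def K_def algebra_simps)
    qed
    have lower: "1 - q u \<le> (4 * B + 4 * D + K * D2) * h"
    proof -
      define k where "k = 1 - q u - 4 * B * h"
      have "k \<le> (\<integral>v. - q0 v * normal_density 0 ((u - h) powr (- 3/2)) (u - h - v) \<partial>lborel)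
          + (B + 1 + \<bar>k\<bar>) * (sqrt 2 * exp (- (h / (u - h) powr (- 3/2))\<^sup>2 / 4))"
      proof (rule unsmooth)
        fix v assume "\<bar>u - h - v\<bar> \<le> h"
        then have v: "v \<le> u" "u - v \<le> 2 * h" by linarith+
        have "1 - 2 * h \<le> exp (- (u - v))" using exp_ge_add_one_self[of "- (u - v)"] v by linarith
        then have "q v * (1 - 2 * h) \<le> q v * exp (- (u - v))" using q_bounds by (intro mult_left_mono) auto
        also have "\<dots> \<le> q (v + (u - v))" using v by (intro q_mono) auto
        finally have "q v * (1 - 2 * h) \<le> q u" by simp
        moreover have "q v * h \<le> B * h" using q_bounds h by (intro mult_right_mono) auto
        ultimately have "q v \<le> q u + 2 * (B * h)" by (simp add: algebra_simps)
        then show "k \<le> - q0 v" using v u4 h Bh by (simp add: q0' k_def)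
      qed (use h u4 q0b in auto)
      also have "\<dots> \<le> 4 * D * h + (2 * B + 2 + 2 * B + 4 * B) * (sqrt 2 * (D2 * h))"
      proof (rule add_mono[OF _ mult_mono])
        show "(\<integral>v. - q0 v * normal_density 0 ((u - h) powr (- 3/2)) (u - h - v) \<partial>lborel) \<le> 4 * D * h"
          using err(1)[of "u - h"] h u4 by (simp add: J_def)
        show "B + 1 + \<bar>k\<bar> \<le> 2 * B + 2 + 2 * B + 4 * B" unfolding k_def using qB Bh by (simp add: abs_if)
        show "sqrt 2 * exp (- (h / (u - h) powr (- 3/2))\<^sup>2 / 4) \<le> sqrt 2 * (D2 * h)"
          using h u4 by (intro err) auto
      qed (use B_nonneg in auto)
      finally show ?thesis using Bh by (simp add: k_def K_def algebra_simps)
    qed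
    show ?thesis using upper lower unfolding h_def by (simp add: abs_if)
  qed
  define M where "M = (4 * B + 4 * D + K * D2) + (B + 1) * U0 powr (5/4)"
  have K: "K \<ge> 0" using B_nonneg by (simp add: K_def)
  have "\<bar>q u - 1\<bar> \<le> M * u powr (- 5/4)" if u: "u \<ge> 1" for u
  proof (cases "u \<ge> U0")
    case True
    have "\<bar>q u - 1\<bar> \<le> (4 * B + 4 * D + K * D2) * u powr (- 5/4)" by (rule large[OF True])
    also have "\<dots> \<le> M * u powr (- 5/4)" unfolding M_def using B_nonneg by (intro mult_right_mono) auto
    finally show ?thesis .
  next
    case False
    have "\<bar>q u - 1\<bar> \<le> (B + 1) * 1" using q_bounds[of u] by auto
    also have "(B + 1) * 1 \<le> (B + 1) * (U0 powr (5/4) * u powr (- 5/4))"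
    proof (rule mult_left_mono)
      have "u powr (5/4) \<le> U0 powr (5/4)" using False u by (intro powr_mono2) auto
      then have "u powr (5/4) * u powr (- 5/4) \<le> U0 powr (5/4) * u powr (- 5/4)" by (intro mult_right_mono) auto
      then show "1 \<le> U0 powr (5/4) * u powr (- 5/4)" using u by (simp flip: powr_add)
    qed (use B_nonneg in simp)
    also have "\<dots> = (B + 1) * U0 powr (5/4) * u powr (- 5/4)" by (simp only: mult.assoc)
    also have "\<dots> \<le> M * u powr (- 5/4)" unfolding M_def using B_nonneg J(1) K D2(1) by (intro mult_right_mono) auto
    finally show ?thesis .
  qed
  then show ?thesis by blast
qed

end

section \<open>Sums of the von Mangoldt functions\<close>

definition nset :: "real \<Rightarrow> nat set" where
  "nset x = {n. n \<ge> 1 \<and> real n \<le> x}"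

definition summ :: "(nat \<Rightarrow> real) \<Rightarrow> real \<Rightarrow> real" where
  "summ a x = (\<Sum>n\<in>nset x. a n)"

lemma nset_eq: "nset x = {1..nat \<lfloor>x\<rfloor>}"
proof (rule Set.set_eqI)
  fix n :: nat
  have "1 \<le> n \<Longrightarrow> n \<le> nat \<lfloor>x\<rfloor> \<longleftrightarrow> int n \<le> \<lfloor>x\<rfloor>" by arith
  then show "n \<in> nset x \<longleftrightarrow> n \<in> {1..nat \<lfloor>x\<rfloor>}" by (auto simp: nset_def le_floor_iff)
qed

lemma finite_nset [simp]: "finite (nset x)"
  by (simp add: nset_eq)

lemma finite_nset' [simp]: "finite {n. Suc 0 \<le> n \<and> real n \<le> x}"
  using finite_nset[of x] by (simp add: nset_def)

lemma nset_of_nat: "nset (real N) = {1..N}"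
  by (simp add: nset_eq)

lemma summ_mono:
  assumes "\<And>n. n \<ge> 1 \<Longrightarrow> a n \<ge> 0" "x \<le> y"
  shows "summ a x \<le> summ a y"
  unfolding summ_def using assms by (intro sum_mono2) (auto simp: nset_def)

lemma summ_nonneg: "(\<And>n. n \<ge> 1 \<Longrightarrow> a n \<ge> 0) \<Longrightarrow> summ a x \<ge> 0"
  unfolding summ_def by (intro sum_nonneg) (auto simp: nset_def)

lemma summ_less_1: "x < 1 \<Longrightarrow> summ a x = 0"
  unfolding summ_def by (rule sum.neutral) (auto simp: nset_def)

lemma summ_add: "summ (\<lambda>n. a n + b n) x = summ a x + summ b x"
  by (simp add: summ_def sum.distrib)

lemma summ_cmult: "summ (\<lambda>n. c * a n) x = c * summ a x"
  by (simp add: summ_def sum_distrib_left)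

lemma summ_dconv: "summ (dconv a b) x = (\<Sum>k\<in>nset x. b k * summ a (x / real k))"
proof -
  have "summ (dconv a b) x = (\<Sum>(n, d)\<in>(SIGMA n:nset x. {d. d dvd n}). a d * b (n div d))"
    unfolding summ_def dconv_def by (intro sum.Sigma) (auto simp: nset_def)
  also have "\<dots> = (\<Sum>(k, d)\<in>(SIGMA k:nset x. nset (x / real k)). b k * a d)"
  proof (rule sum.reindex_bij_witness[of _ "\<lambda>(k, d). (k * d, d)" "\<lambda>(n, d). (n div d, d)"])
    fix p assume "p \<in> (SIGMA n:nset x. {d. d dvd n})"
    then obtain d k where p: "p = (d * k, d)" "d * k \<ge> 1" "real (d * k) \<le> x" by (auto simp: nset_def)
    then have dk: "d \<ge> 1" "k \<ge> 1" by (auto simp: Suc_le_eq)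
    have "real k * 1 \<le> real k * real d" using dk by (intro mult_left_mono) auto
    then have "real k \<le> x" using p(3) by (simp add: mult.commute)
    then show "(case p of (n, d) \<Rightarrow> (n div d, d)) \<in> (SIGMA k:nset x. nset (x / real k))"
      using p dk by (auto simp: nset_def field_simps)
    show "(case (case p of (n, d) \<Rightarrow> (n div d, d)) of (k, d) \<Rightarrow> (k * d, d)) = p" using p dk by auto
    show "(case (case p of (n, d) \<Rightarrow> (n div d, d)) of (k, d) \<Rightarrow> b k * a d) = (case p of (n, d) \<Rightarrow> a d * b (n div d))"
      using p by auto
  next
    fix p assume "p \<in> (SIGMA k:nset x. nset (x / real k))"
    then obtain k d where p: "p = (k, d)" "k \<ge> 1" "d \<ge> 1" "real d \<le> x / real k" by (auto simp: nset_def)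
    then have "real (k * d) \<le> x" by (simp add: field_simps)
    moreover have "k * d \<ge> 1" using p by (simp add: Suc_le_eq)
    ultimately show "(case p of (k, d) \<Rightarrow> (k * d, d)) \<in> (SIGMA n:nset x. {d. d dvd n})" using p by (auto simp: nset_def)
    show "(case (case p of (k, d) \<Rightarrow> (k * d, d)) of (n, d) \<Rightarrow> (n div d, d)) = p" using p by auto
  qed
  also have "\<dots> = (\<Sum>k\<in>nset x. \<Sum>d\<in>nset (x / real k). b k * a d)"
    by (subst sum.Sigma) auto
  finally show ?thesis by (simp add: summ_def sum_distrib_left)
qed

lemma ln_fact_eq: "ln (fact N :: real) = (\<Sum>d\<in>{1..M}. mangoldt d * real (N div d))" if "N \<le> M"
proof -
  have "ln (fact N :: real) = (\<Sum>n\<in>{1..N}. ln (real n))"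
    by (induction N) (simp_all add: ln_mult)
  also have "\<dots> = (\<Sum>n\<in>{1..N}. \<Sum>d\<in>{1..M}. if d dvd n then mangoldt d else 0)"
  proof (rule sum.cong[OF refl])
    fix n assume n: "n \<in> {1..N}"
    have "ln (real n) = (\<Sum>d | d dvd n. mangoldt d)" using mangoldt_sum[of n, where ?'a = real] n by simp
    also have "\<dots> = (\<Sum>d\<in>{d \<in> {1..M}. d dvd n}. mangoldt d)"
      using n that by (intro sum.cong) (auto dest: dvd_imp_le simp: Suc_le_eq intro: Nat.gr0I)
    also have "\<dots> = (\<Sum>d\<in>{1..M}. if d dvd n then mangoldt d else 0)" by (rule sum.inter_filter) simp
    finally show "ln (real n) = (\<Sum>d\<in>{1..M}. if d dvd n then mangoldt d else 0)" .
  qed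
  also have "\<dots> = (\<Sum>d\<in>{1..M}. \<Sum>n\<in>{1..N}. if d dvd n then mangoldt d else 0)" by (rule sum.swap)
  also have "\<dots> = (\<Sum>d\<in>{1..M}. mangoldt d * real (N div d))"
  proof (rule sum.cong[OF refl])
    fix d assume d: "d \<in> {1..M}"
    have "{n \<in> {1..N}. d dvd n} = (\<lambda>k. d * k) ` {1..N div d}"
    proof (rule Set.set_eqI, rule iffI)
      fix n assume "n \<in> {n \<in> {1..N}. d dvd n}"
      then obtain k where k: "n = d * k" "1 \<le> n" "n \<le> N" by auto
      then have "k \<ge> 1" by (auto simp: Suc_le_eq intro: Nat.gr0I)
      moreover have "k \<le> N div d" using k d by (simp add: less_eq_div_iff_mult_less_eq mult.commute)
      ultimately show "n \<in> (\<lambda>k. d * k) ` {1..N div d}" using k by auto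
    qed (use d in \<open>auto simp: less_eq_div_iff_mult_less_eq mult.commute Suc_le_eq\<close>)
    moreover have "inj_on (\<lambda>k. d * k) {1..N div d}" using d by (auto simp: inj_on_def)
    ultimately have "card {n \<in> {1..N}. d dvd n} = N div d" by (simp add: card_image)
    then show "(\<Sum>n\<in>{1..N}. if d dvd n then mangoldt d else 0) = (mangoldt d :: real) * real (N div d)"
      by (simp flip: sum.inter_filter)
  qed
  finally show ?thesis .
qed

lemma chebyshev_step: "(\<Sum>d\<in>{1..2 * m}. mangoldt d) \<le> (\<Sum>d\<in>{1..m}. mangoldt d) + 2 * real m"
proof -
  have "(\<Sum>d\<in>{m<..2 * m}. mangoldt d * 1) \<le> (\<Sum>d\<in>{m<..2 * m}. mangoldt d * (real (2 * m div d) - 2 * real (m div d)))"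
  proof (intro sum_mono mult_left_mono)
    fix d assume "d \<in> {m<..2 * m}"
    then have "m div d = 0" "2 * m div d \<ge> 1" by (auto simp: Suc_le_eq div_greater_zero_iff)
    then show "1 \<le> real (2 * m div d) - 2 * real (m div d)" by simp
  qed (rule mangoldt_nonneg)
  also have "\<dots> \<le> (\<Sum>d\<in>{1..2 * m}. mangoldt d * (real (2 * m div d) - 2 * real (m div d)))"
  proof (rule sum_mono2)
    fix d
    have "2 * (m div d) \<le> 2 * m div d" 
      by (cases "d = 0") (simp_all add: less_eq_div_iff_mult_less_eq div_times_less_eq_dividend mult.assoc)
    then have "real (2 * (m div d)) \<le> real (2 * m div d)" by (rule of_nat_mono)
    then have "2 * real (m div d) \<le> real (2 * m div d)" by (simp only: of_nat_mult of_nat_numeral)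
    then show "0 \<le> mangoldt d * (real (2 * m div d) - 2 * real (m div d))"
      by (intro mult_nonneg_nonneg mangoldt_nonneg) (simp only: diff_ge_0_iff_ge)
  qed auto
  also have "\<dots> = (\<Sum>d\<in>{1..2 * m}. mangoldt d * real (2 * m div d)) - 2 * (\<Sum>d\<in>{1..2 * m}. mangoldt d * real (m div d))"
    by (simp only: right_diff_distrib sum_subtractf sum_distrib_left mult.left_commute)
  also have "\<dots> = ln (fact (2 * m)) - 2 * ln (fact m)"
  proof -
    have "m \<le> 2 * m" by simp
    then show ?thesis by (simp only: ln_fact_eq[of "2 * m" "2 * m", OF order_refl] ln_fact_eq[of m "2 * m"])
  qed
  also have "\<dots> = ln (real (2 * m choose m))"
  proof -
    have "2 * m - m = m" by simp
    then have e: "real (2 * m choose m) = fact (2 * m) / (fact m * fact m)"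
      using binomial_fact[of m "2 * m", where ?'a = real] by simp
    have "ln (fact (2 * m) / (fact m * fact m) :: real) = ln (fact (2 * m)) - ln (fact m * fact m)"
      by (rule ln_divide_pos) (simp_all only: fact_gt_zero mult_pos_pos)
    moreover have "ln (fact m * fact m :: real) = ln (fact m) + ln (fact m)"
      by (rule ln_mult_pos) (simp_all only: fact_gt_zero)
    ultimately show ?thesis unfolding e by linarith
  qed
  also have "\<dots> \<le> ln (2 ^ (2 * m))"
  proof -
    have "2 * m choose m \<le> 2 ^ (2 * m)" by (rule binomial_le_pow2)
    then have "real (2 * m choose m) \<le> real (2 ^ (2 * m))" by (rule of_nat_mono)
    moreover have "2 * m choose m > 0" by simp
    ultimately show ?thesis by (simp add: ln_le_cancel_iff del: zero_less_binomial_iff binomial_eq_0_iff)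
  qed
  also have "\<dots> = 2 * real m * ln 2" by (simp add: ln_realpow)
  also have "\<dots> \<le> 2 * real m * 1" by (intro mult_left_mono) (use ln_le_minus_one[of 2] in auto)
  finally have "(\<Sum>d\<in>{m<..2 * m}. mangoldt d) \<le> 2 * real m" by simp
  moreover have "{1..2 * m} = {1..m} \<union> {m<..2 * m}" by auto
  then have "(\<Sum>d\<in>{1..2 * m}. mangoldt d) = (\<Sum>d\<in>{1..m}. mangoldt d) + (\<Sum>d\<in>{m<..2 * m}. (mangoldt d :: real))"
    by (simp only:) (rule sum.union_disjoint, auto)
  ultimately show ?thesis by linarith
qed

lemma chebyshev_nat: "(\<Sum>d\<in>{1..n}. mangoldt d) \<le> 4 * real n"
proof (induction n rule: less_induct)
  case (less n)
  define m where "m = n div 2"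
  show ?case
  proof (cases "n = 0")
    case False
    then have IH: "(\<Sum>d\<in>{1..m}. mangoldt d) \<le> 4 * real m" by (intro less) (simp add: m_def)
    show ?thesis
    proof (cases "even n")
      case True
      then have n: "n = 2 * m" by (simp add: m_def)
      show ?thesis unfolding n using chebyshev_step[of m] IH by simp
    next
      case False
      then have n: "n = Suc (2 * m)" by (simp add: m_def)
      have "mangoldt (Suc (2 * m)) \<le> ln (real (Suc (2 * m)))" by (rule mangoldt_le) simp
      also have "\<dots> \<le> 2 * real m" using ln_le_minus_one[of "real (Suc (2 * m))"] by simp
      finally show ?thesis unfolding n using chebyshev_step[of m] IH by (simp del: atLeastAtMost_iff)
    qed
  qed simp
qed

lemma chebyshev: "x \<ge> 0 \<Longrightarrow> summ mangoldt x \<le> 4 * x"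
  using chebyshev_nat[of "nat \<lfloor>x\<rfloor>"] of_nat_floor[of x] unfolding summ_def nset_eq by linarith

lemma complex_exp_integral:
  assumes z: "Re z > 0"
  shows "integrable lborel (\<lambda>v. of_real (indicator {a..} v) * exp (- (z * of_real v)))"
    and "(\<integral>v. of_real (indicator {a..} v) * exp (- (z * of_real v)) \<partial>lborel) = exp (- (z * of_real a)) / z"
proof -
  let ?f = "\<lambda>v. of_real (indicator {a..} v) * exp (- (z * of_real v))"
  have z0: "z \<noteq> 0" using z by auto
  show I: "integrable lborel ?f"
  proof (rule Bochner_Integration.integrable_bound[OF integrable_exp_neg[OF z, of a]])
    show "?f \<in> borel_measurable lborel" by measurable
  qed (auto simp: norm_mult indicator_def)
  define G where "G = (\<lambda>v. - exp (- (z * of_real v)) / z)"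
  have fin: "(\<integral>v. indicator {..b} v *\<^sub>R ?f v \<partial>lborel) = G b - G a" if "b \<ge> a" for b
  proof -
    have "(\<integral>v. indicator {..b} v *\<^sub>R ?f v \<partial>lborel) = (\<integral>v. indicator {a..b} v *\<^sub>R exp (- (z * of_real v)) \<partial>lborel)"
      by (intro Bochner_Integration.integral_cong) (auto simp: indicator_def)
    also have "\<dots> = G b - G a"
    proof (rule integral_FTC_atLeastAtMost[OF that])
      show "(G has_vector_derivative exp (- (z * of_real x))) (at x within {a..b})" for x
        unfolding G_def using z0 by (auto intro!: derivative_eq_intros has_vector_derivative_real_field)
      show "continuous_on {a..b} (\<lambda>v. exp (- (z * complex_of_real v)))" by (intro continuous_intros)
    qed
    finally show ?thesis .
  qed
  have "((\<lambda>b. \<integral>v. indicator {..b} v *\<^sub>R ?f v \<partial>lborel) \<longlongrightarrow> (\<integral>v. ?f v \<partial>lborel)) at_top"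
    by (rule tendsto_integral_at_top[OF _ I]) simp
  moreover have "\<forall>\<^sub>F b in at_top. (\<integral>v. indicator {..b} v *\<^sub>R ?f v \<partial>lborel) = G b - G a"
    using eventually_ge_at_top[of a] by eventually_elim (rule fin)
  ultimately have "((\<lambda>b. G b - G a) \<longlongrightarrow> (\<integral>v. ?f v \<partial>lborel)) at_top"
    by (rule Lim_transform_eventually)
  moreover have "((\<lambda>b. G b - G a) \<longlongrightarrow> 0 - G a) at_top"
  proof (intro tendsto_intros)
    have "((\<lambda>b. exp (- (r * b)) / k) \<longlongrightarrow> 0) at_top" if "r > 0" "k > 0" for r k :: real
      using that by real_asymp
    then have "((\<lambda>b. exp (- (Re z * b)) / norm z) \<longlongrightarrow> 0) at_top" using z z0 by simp
    then show "(G \<longlongrightarrow> 0) at_top"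
      by (rule Lim_null_comparison[rotated]) (simp add: G_def norm_divide)
  qed
  ultimately have "(\<integral>v. ?f v \<partial>lborel) = 0 - G a" using tendsto_unique trivial_limit_at_top_linorder by blast
  then show "(\<integral>v. ?f v \<partial>lborel) = exp (- (z * of_real a)) / z" by (simp add: G_def)
qed

lemma summ_exp_measurable [measurable]: "(\<lambda>v. summ a (exp v)) \<in> borel_measurable borel"
proof -
  have "(\<lambda>v. summ a (exp v)) = (\<lambda>v. \<Sum>n. (if n \<ge> 1 \<and> real n \<le> exp v then a n else 0))"
  proof
    fix v
    have "(\<lambda>n. if n \<ge> 1 \<and> real n \<le> exp v then a n else 0) sums (\<Sum>n\<in>nset (exp v). if n \<ge> 1 \<and> real n \<le> exp v then a n else 0)"
      by (rule sums_finite) (auto simp: nset_def)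
    moreover have "(\<Sum>n\<in>nset (exp v). if n \<ge> 1 \<and> real n \<le> exp v then a n else 0) = summ a (exp v)"
      unfolding summ_def by (rule sum.cong) (auto simp: nset_def)
    ultimately show "summ a (exp v) = (\<Sum>n. if n \<ge> 1 \<and> real n \<le> exp v then a n else 0)" by (simp add: sums_iff)
  qed
  also have "\<dots> \<in> borel_measurable borel" by measurable
  finally show ?thesis .
qed

lemma dser_laplace:
  assumes z: "Re z > 0" and a: "abs_conv a (Re z)"
  shows "integrable lborel (\<lambda>v. of_real (indicator {0..} v * summ a (exp v)) * exp (- (z * of_real v)))"
    and "(\<integral>v. of_real (indicator {0..} v * summ a (exp v)) * exp (- (z * of_real v)) \<partial>lborel) = dser a z / z"
proof -
  define f where "f = (\<lambda>n v. of_real (if n \<ge> 1 then a n else 0) * (of_real (indicator {ln (real n)..} v) * exp (- (z * of_real v))))"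
  have fi: "integrable lborel (f n)" for n
    unfolding f_def by (intro integrable_mult_right complex_exp_integral z)
  have fin: "f n v = 0" if "n \<notin> nset (exp v)" for n v
  proof (cases "n = 0")
    case False
    then have "exp v < real n" using that by (auto simp: nset_def)
    then have "v < ln (real n)" by (metis exp_gt_zero ln_exp ln_less_cancel_iff order.strict_trans)
    then show ?thesis by (simp add: f_def)
  qed (simp add: f_def)
  have sm: "(\<lambda>n. f n v) sums (of_real (indicator {0..} v * summ a (exp v)) * exp (- (z * of_real v)))" for v
  proof -
    have "(\<lambda>n. f n v) sums (\<Sum>n\<in>nset (exp v). f n v)" by (rule sums_finite) (auto intro: fin)
    also have "(\<Sum>n\<in>nset (exp v). f n v) = of_real (indicator {0..} v * summ a (exp v)) * exp (- (z * of_real v))"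
    proof -
      have "f n v = of_real (a n) * exp (- (z * of_real v))" if "n \<in> nset (exp v)" for n
      proof -
        have "real n > 0" "real n \<le> exp v" "n \<ge> 1" using that by (auto simp: nset_def)
        then have "ln (real n) \<le> v" by (metis exp_gt_zero ln_exp ln_le_cancel_iff)
        then show ?thesis using \<open>n \<ge> 1\<close> by (simp add: f_def)
      qed
      then have "(\<Sum>n\<in>nset (exp v). f n v) = of_real (summ a (exp v)) * exp (- (z * of_real v))"
        by (simp add: summ_def sum_distrib_right)
      moreover have "v < 0 \<Longrightarrow> summ a (exp v) = 0" by (rule summ_less_1) simp
      ultimately show ?thesis by (cases "v \<ge> 0") auto
    qed
    finally show ?thesis .
  qed
  have nrm: "(\<integral>v. norm (f n v) \<partial>lborel) = \<bar>a n\<bar> * real n powr (- Re z) / Re z" for n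
  proof (cases "n = 0")
    case False
    have "of_real (\<integral>v. norm (f n v) \<partial>lborel) = (\<integral>v. complex_of_real (norm (f n v)) \<partial>lborel)"
      by (rule integral_complex_of_real[symmetric])
    also have "\<dots> = (\<integral>v. of_real \<bar>a n\<bar> * (of_real (indicator {ln (real n)..} v) * exp (- (of_real (Re z) * of_real v))) \<partial>lborel)"
      using False by (intro Bochner_Integration.integral_cong) (auto simp: f_def norm_mult indicator_def simp flip: exp_of_real)
    also have "\<dots> = of_real \<bar>a n\<bar> * (exp (- (of_real (Re z) * of_real (ln (real n)))) / of_real (Re z))"
      using complex_exp_integral(2)[of "of_real (Re z)" "ln (real n)"] z by simp
    also have "\<dots> = of_real (\<bar>a n\<bar> * real n powr (- Re z) / Re z)"
      using False by (simp add: powr_def flip: exp_of_real)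
    finally show ?thesis using of_real_eq_iff by blast
  qed (simp add: f_def)
  have S: "summable (\<lambda>n. \<integral>v. norm (f n v) \<partial>lborel)"
    unfolding nrm using a unfolding abs_conv_def by (rule summable_divide)
  have AEs: "AE v in lborel. summable (\<lambda>n. norm (f n v))"
  proof (rule AE_I2)
    fix v show "summable (\<lambda>n. norm (f n v))"
      by (rule summable_finite[of "nset (exp v)"]) (auto intro: fin)
  qed
  have sf: "(\<lambda>v. \<Sum>n. f n v) = (\<lambda>v. of_real (indicator {0..} v * summ a (exp v)) * exp (- (z * of_real v)))"
    using sm by (auto simp: sums_iff)
  show "integrable lborel (\<lambda>v. of_real (indicator {0..} v * summ a (exp v)) * exp (- (z * of_real v)))"
    using integrable_suminf[OF fi AEs S] unfolding sf .
  have "(\<integral>v. of_real (indicator {0..} v * summ a (exp v)) * exp (- (z * of_real v)) \<partial>lborel) = (\<Sum>n. \<integral>v. f n v \<partial>lborel)"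
    unfolding sf[symmetric] by (rule integral_suminf[OF fi AEs S])
  also have "\<dots> = (\<Sum>n. of_real (a n) * of_nat n powr (- z) / z)"
  proof (rule suminf_cong)
    fix n show "(\<integral>v. f n v \<partial>lborel) = of_real (a n) * of_nat n powr (- z) / z"
    proof (cases "n = 0")
      case False
      have "(\<integral>v. f n v \<partial>lborel) = of_real (a n) * (exp (- (z * of_real (ln (real n)))) / z)"
        unfolding f_def using False complex_exp_integral(2)[OF z, of "ln (real n)"] by simp
      then show ?thesis using False by (simp add: powr_def)
    qed (simp add: f_def)
  qed
  also have "\<dots> = dser a z / z"
    unfolding dser_def using dser_sums[OF a] by (intro suminf_divide) (simp add: sums_iff)
  finally show "(\<integral>v. of_real (indicator {0..} v * summ a (exp v)) * exp (- (z * of_real v)) \<partial>lborel) = dser a z / z" .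
qed

lemma summ_lamQ_le: "x \<ge> 0 \<Longrightarrow> summ lamQ x \<le> 8 * x"
proof -
  assume "x \<ge> 0"
  have "summ lamQ x \<le> summ (\<lambda>n. 2 * mangoldt n) x" unfolding summ_def by (intro sum_mono lamQ_le)
  also have "\<dots> \<le> 8 * x" using chebyshev[OF \<open>x \<ge> 0\<close>] by (simp add: summ_cmult)
  finally show ?thesis .
qed

definition wt :: "real \<Rightarrow> real" where "wt x = (1 + ln x) powr (- 5/4)"

lemma lamQ_tauber: "\<exists>D. \<forall>u\<ge>1. \<bar>summ lamQ (exp u) * exp (- u) - 1\<bar> \<le> D * u powr (- 5/4)"
proof -
  obtain c C where K: "0 < c" "c \<le> 1/80" "C > 0"
    "\<And>s. 1 - c * (1 + \<bar>Im s\<bar>) powr (- 1/4) \<le> Re s \<Longrightarrow> Re s \<le> 2 \<Longrightarrow>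
     Kfun s \<noteq> 0 \<and> norm (deriv Kfun s / Kfun s) \<le> C * (1 + \<bar>Im s\<bar>) powr (1/4)"
    using Kfun_zero_free by blast
  define U where "U = {w. Re w > - 1 \<and> Kfun (1 + w) \<noteq> 0}"
  define H where "H = (\<lambda>w. (- (deriv Kfun (1 + w) / Kfun (1 + w)) - 1) / (1 + w))"
  have near: "Re w \<ge> - 1/2" if "- c * (1 + \<bar>Im w\<bar>) powr (- 1/4) \<le> Re w" for w
  proof -
    have "(1 + \<bar>Im w\<bar>) powr (- 1/4) \<le> (1 + \<bar>Im w\<bar>) powr 0" by (intro powr_mono) auto
    also have "\<dots> = 1" by (simp add: add_nonneg_eq_0_iff)
    finally have "c * (1 + \<bar>Im w\<bar>) powr (- 1/4) \<le> 1/2 * 1" using K by (intro mult_mono) auto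
    then show ?thesis using that by linarith
  qed
  interpret tauber "\<lambda>v. summ lamQ (exp v) * exp (- v)" 8 c "3 * (C + 1)" H U
  proof
    show "(\<lambda>v. summ lamQ (exp v) * exp (- v)) \<in> borel_measurable borel" by measurable
    show "0 \<le> summ lamQ (exp v) * exp (- v)" for v
      using lamQ_nonneg by (intro mult_nonneg_nonneg summ_nonneg) auto
    show "summ lamQ (exp v) * exp (- v) \<le> 8" for v
    proof -
      have "summ lamQ (exp v) * exp (- v) \<le> 8 * exp v * exp (- v)" by (intro mult_right_mono summ_lamQ_le) auto
      also have "\<dots> = 8" by (simp flip: exp_add)
      finally show ?thesis .
    qed
    show "summ lamQ (exp v) * exp (- v) * exp (- h) \<le> summ lamQ (exp (v + h)) * exp (- (v + h))" if "0 \<le> h" for h v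
    proof -
      have "summ lamQ (exp v) \<le> summ lamQ (exp (v + h))" using lamQ_nonneg that by (intro summ_mono) auto
      then have "summ lamQ (exp v) * exp (- (v + h)) \<le> summ lamQ (exp (v + h)) * exp (- (v + h))" by (intro mult_right_mono) auto
      moreover have "exp (- v) * exp (- h) = exp (- (v + h))" by (simp flip: exp_add)
      ultimately show ?thesis by (simp only: mult.assoc)
    qed
    show "0 < c" "c \<le> 1" using K by auto
    show "w \<in> U" if "- c * (1 + \<bar>Im w\<bar>) powr (- 1/4) \<le> Re w" "Re w \<le> 1" for w
      using near[OF that(1)] K(4)[of "1 + w"] that by (auto simp: U_def)
    show "norm (H w) \<le> 3 * (C + 1)" if w: "- c * (1 + \<bar>Im w\<bar>) powr (- 1/4) \<le> Re w" "Re w \<le> 1" for w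
    proof -
      define T where "T = 1 + \<bar>Im w\<bar>"
      have T: "T \<ge> 1" by (simp add: T_def)
      have "norm (deriv Kfun (1 + w) / Kfun (1 + w)) \<le> C * T powr (1/4)" using K(4)[of "1 + w"] w by (simp add: T_def)
      also have "\<dots> \<le> C * T powr 1" using K T by (intro mult_left_mono powr_mono) auto
      finally have "norm (deriv Kfun (1 + w) / Kfun (1 + w)) \<le> C * T" using T by simp
      moreover have "norm (- (deriv Kfun (1 + w) / Kfun (1 + w)) - 1) \<le> norm (deriv Kfun (1 + w) / Kfun (1 + w)) + 1"
        using norm_triangle_ineq4[of "- (deriv Kfun (1 + w) / Kfun (1 + w))" 1] by simp
      ultimately have n: "norm (- (deriv Kfun (1 + w) / Kfun (1 + w)) - 1) \<le> (C + 1) * T" using T by (simp add: distrib_right)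
      have "\<bar>Im w\<bar> \<le> norm (1 + w)" using abs_Im_le_cmod[of "1 + w"] by simp
      moreover have "1 / 2 \<le> norm (1 + w)" using complex_Re_le_cmod[of "1 + w"] near[OF w(1)] by simp
      moreover have "(1 + a) / 3 \<le> N" if "a \<le> N" "1 / 2 \<le> N" for a N :: real using that by simp
      ultimately have d: "norm (1 + w) \<ge> T / 3" unfolding T_def by blast
      have "norm (H w) \<le> ((C + 1) * T) / (T / 3)"
        unfolding H_def norm_divide using n d T K by (intro frac_le) auto
      also have "\<dots> = 3 * (C + 1)" using T by simp
      finally show ?thesis .
    qed
    show "H holomorphic_on U"
    proof -
      have op: "open {s. Re s > 0}" by (rule open_halfspace_Re_gt)
      have sh: "(\<lambda>w. 1 + w) ` U \<subseteq> {s. Re s > 0}" by (auto simp: U_def)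
      have "(Kfun \<circ> (\<lambda>w. 1 + w)) holomorphic_on U"
        by (rule holomorphic_on_compose[OF _ holomorphic_on_subset[OF Kfun_holomorphic sh]]) (intro holomorphic_intros)
      moreover have "(deriv Kfun \<circ> (\<lambda>w. 1 + w)) holomorphic_on U"
        by (rule holomorphic_on_compose[OF _ holomorphic_on_subset[OF holomorphic_deriv[OF Kfun_holomorphic op] sh]]) (intro holomorphic_intros)
      moreover have "1 + w \<noteq> 0" if "w \<in> U" for w using that by (auto simp: U_def complex_eq_iff)
      ultimately show ?thesis unfolding H_def o_def by (intro holomorphic_intros) (auto simp: U_def)
    qed
    show "H w = (\<integral>v. of_real (indicator {0..} v * (summ lamQ (exp v) * exp (- v) - 1)) * exp (- (w * of_real v)) \<partial>lborel)"
      if w: "Re w > 0" "Re w \<le> 1" for w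
    proof -
      have z: "Re (1 + w) > 0" "Re (1 + w) > 1" using w by auto
      have w0: "w \<noteq> 0" using w by auto
      have "Re (1 + w) \<noteq> Re 0" using z by simp
      then have w1: "1 + w \<noteq> 0" by metis
      have 1: "of_real (indicator {0..} v * (summ lamQ (exp v) * exp (- v) - 1)) * exp (- (w * of_real v))
        = of_real (indicator {0..} v * summ lamQ (exp v)) * exp (- ((1 + w) * of_real v)) - of_real (indicator {0..} v) * exp (- (w * of_real v))" for v
      proof -
        have "exp (- ((1 + w) * of_real v)) = of_real (exp (- v)) * exp (- (w * of_real v))"
          by (simp add: exp_of_real[symmetric] exp_add[symmetric] algebra_simps)
        then show ?thesis by (simp add: algebra_simps)
      qed
      have "(\<integral>v. of_real (indicator {0..} v * (summ lamQ (exp v) * exp (- v) - 1)) * exp (- (w * of_real v)) \<partial>lborel)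
          = dser lamQ (1 + w) / (1 + w) - exp (- (w * of_real 0)) / w"
        unfolding 1 using dser_laplace[OF z(1) abs_conv_lamQ[OF z(2)]] complex_exp_integral[OF w(1), of 0]
        by (subst Bochner_Integration.integral_diff) simp_all
      also have "\<dots> = H w"
      proof -
        have "deriv Kfun (1 + w) / Kfun (1 + w) = 1 / w - dser lamQ (1 + w)" using Kfun_log_deriv[OF z(2)] by simp
        moreover have "d / (1 + w) - 1 / w = (- (1 / w - d) - 1) / (1 + w)" for d
          using w0 w1 by (simp add: field_simps)
        ultimately show ?thesis by (simp add: H_def)
      qed
      finally show ?thesis ..
    qed
  qed
  show ?thesis by (rule tauberian)
qed

lemma wt_pos: "x \<ge> 1 \<Longrightarrow> wt x > 0"
  using ln_ge_zero[of x] by (simp add: wt_def add_nonneg_eq_0_iff)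

lemma summ_lamQ_asymp: "\<exists>D>0. \<forall>x\<ge>1. \<bar>summ lamQ x - x\<bar> \<le> D * (x * wt x)"
proof -
  obtain D where D: "\<And>u. u \<ge> 1 \<Longrightarrow> \<bar>summ lamQ (exp u) * exp (- u) - 1\<bar> \<le> D * u powr (- 5/4)"
    using lamQ_tauber by blast
  define D' where "D' = 4 * (\<bar>D\<bar> + 9)"
  have p: "2 powr (5/4) \<le> (4 :: real)" using powr_mono[of "5/4" 2 "2 :: real"] by simp
  have "\<bar>summ lamQ x - x\<bar> \<le> D' * (x * wt x)" if x: "x \<ge> 1" for x
  proof -
    define u where "u = ln x"
    have u: "u \<ge> 0" "exp u = x" using x by (auto simp: u_def)
    have "\<bar>summ lamQ (exp u) * exp (- u) - 1\<bar> \<le> D' * wt x"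
    proof (cases "u \<ge> 1")
      case True
      have "u powr (- 5/4) \<le> ((1 + u) / 2) powr (- 5/4)" using True by (intro powr_mono2') auto
      also have "\<dots> = 2 powr (5/4) * wt x" by (simp add: wt_def u_def powr_divide powr_minus field_simps)
      also have "\<dots> \<le> 4 * wt x" using p wt_pos[OF x] by (intro mult_right_mono) auto
      finally have "\<bar>D\<bar> * u powr (- 5/4) \<le> \<bar>D\<bar> * (4 * wt x)" by (intro mult_left_mono) auto
      moreover have "D * u powr (- 5/4) \<le> \<bar>D\<bar> * u powr (- 5/4)" by (intro mult_right_mono) auto
      ultimately show ?thesis using D[OF True] wt_pos[OF x] by (simp add: D'_def algebra_simps)
    next
      case False
      have "2 powr (- 5/4) \<le> wt x" unfolding wt_def u_def[symmetric] using False u by (intro powr_mono2') auto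
      moreover have "1 / 4 \<le> 2 powr (- 5/4 :: real)" using p by (simp add: powr_minus field_simps)
      ultimately have w: "1 \<le> 4 * wt x" by linarith
      have "0 \<le> summ lamQ (exp u) * exp (- u)" using lamQ_nonneg by (intro mult_nonneg_nonneg summ_nonneg) auto
      moreover have "summ lamQ (exp u) * exp (- u) \<le> 8 * exp u * exp (- u)" by (intro mult_right_mono summ_lamQ_le) auto
      moreover have "8 * exp u * exp (- u) = 8" by (simp flip: exp_add)
      ultimately have "\<bar>summ lamQ (exp u) * exp (- u) - 1\<bar> \<le> 9 * 1" by linarith
      also have "\<dots> \<le> 9 * (4 * wt x)" using w by (intro mult_left_mono) auto
      also have "\<dots> \<le> D' * wt x" using wt_pos[OF x] by (simp add: D'_def)
      finally show ?thesis .
    qed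
    then have "\<bar>summ lamQ (exp u) * exp (- u) - 1\<bar> * x \<le> D' * wt x * x" using x by (intro mult_right_mono) auto
    moreover have "\<bar>summ lamQ (exp u) * exp (- u) - 1\<bar> * x = \<bar>(summ lamQ (exp u) * exp (- u) - 1) * x\<bar>" using x by (simp add: abs_mult)
    moreover have "(summ lamQ (exp u) * exp (- u) - 1) * x = summ lamQ x - x"
      using u x by (simp add: left_diff_distrib exp_minus)
    ultimately show ?thesis by (simp add: mult_ac)
  qed
  moreover have "D' > 0" by (simp add: D'_def)
  ultimately show ?thesis by blast
qed

lemma one_plus_ln_powr_le:
  fixes p e :: real
  assumes "p > 0" "e > 0"
  shows "\<exists>K>0. \<forall>x\<ge>1. (1 + ln x) powr p \<le> K * x powr e"
proof -
  define d where "d = e / p"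
  have d: "d > 0" using assms by (simp add: d_def)
  have "(1 + ln x) powr p \<le> (1 + 1 / d) powr p * x powr e" if x: "x \<ge> 1" for x :: real
  proof -
    have "ln x \<le> x powr d / d" using x d by (intro ln_le_powr) auto
    moreover have "1 \<le> x powr d" using x d by (intro ge_one_powr_ge_zero) auto
    ultimately have "1 + ln x \<le> (1 + 1 / d) * x powr d" by (simp add: algebra_simps)
    then have "(1 + ln x) powr p \<le> ((1 + 1 / d) * x powr d) powr p" using x assms by (intro powr_mono2) auto
    also have "\<dots> = (1 + 1 / d) powr p * (x powr d) powr p" by (rule powr_mult)
    also have "(x powr d) powr p = x powr e" using assms by (simp add: powr_powr d_def)
    finally show ?thesis .
  qed
  moreover have "(1 + 1 / d) powr p > 0" using d add_pos_pos[of 1 "1 / d"] by simp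
  ultimately show ?thesis by blast
qed

definition lamE :: "nat \<Rightarrow> real" where "lamE n = lamR n - lamQ n / 2"

lemma lamE_eq: "lamE n = mangoldt n * (if aprimedivisor n mod 4 = 3 then (1 + chi n) / 2 else (1 - chi n) / 2)"
  by (simp add: lamE_def lamR_def lamQ_def field_simps)

lemma lamE_bounds: "0 \<le> lamE n" "lamE n \<le> mangoldt n"
proof -
  define c where "c = (if aprimedivisor n mod 4 = 3 then (1 + chi n) / 2 else (1 - chi n) / 2)"
  have c: "0 \<le> c" "c \<le> 1" using abs_chi_le_1[of n] by (auto simp: abs_le_iff c_def)
  have m: "mangoldt n \<ge> (0 :: real)" by (rule mangoldt_nonneg)
  show "0 \<le> lamE n" unfolding lamE_eq c_def[symmetric] using c m by (intro mult_nonneg_nonneg)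
  show "lamE n \<le> mangoldt n" unfolding lamE_eq c_def[symmetric] using mult_left_mono[OF c(2) m] by simp
qed

definition ex :: "nat \<Rightarrow> nat" where "ex p = (if p = 2 then 1 else 2)"

definition P23 :: "nat set" where "P23 = insert 2 {p. prime p \<and> p mod 4 = 3}"

lemma P23_prime: "p \<in> P23 \<Longrightarrow> prime p"
  by (auto simp: P23_def)

lemma lamE_P23:
  assumes "p \<in> P23" "k > 0"
  shows "lamE (p ^ (ex p * k)) = (real (ex p) * ln p) / 2"
proof -
  have p: "prime p" using assms P23_prime by blast
  have "ex p * k > 0" using assms by (simp add: ex_def)
  then have "lamE (p ^ (ex p * k)) = ln p * (if p mod 4 = 3 then (1 + chi p ^ (ex p * k)) / 2 else (1 - chi p ^ (ex p * k)) / 2)"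
    using p by (simp add: lamE_eq aprimedivisor_prime_power chi_power)
  then show ?thesis
  proof (cases "p = 2")
    case True
    then show ?thesis using \<open>lamE _ = _\<close> assms(2) by (simp add: chi_def ex_def)
  next
    case False
    then have "p mod 4 = 3" using assms by (auto simp: P23_def)
    then show ?thesis using \<open>lamE _ = _\<close> False by (simp add: chi_def ex_def power_mult)
  qed
qed

lemma lamE_nonzeroE:
  assumes "lamE n \<noteq> 0"
  obtains p k where "p \<in> P23" "k > 0" "n = p ^ (ex p * k)"
proof -
  have "mangoldt n \<noteq> (0 :: real)" using assms by (auto simp: lamE_eq)
  then have "primepow n" by (auto simp: mangoldt_def split: if_splits)
  then obtain p m where pm: "prime p" "m > 0" "n = p ^ m" by (auto simp: primepow_def)
  have E: "lamE n = ln p * (if p mod 4 = 3 then (1 + chi p ^ m) / 2 else (1 - chi p ^ m) / 2)"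
    using pm by (simp add: lamE_eq aprimedivisor_prime_power chi_power)
  show thesis
  proof (cases "p = 2")
    case True
    then show ?thesis using that[of p m] pm by (simp add: P23_def ex_def)
  next
    case p2: False
    show ?thesis
    proof (cases "p mod 4 = 3")
      case True
      then have "chi p = -1" by (simp add: chi_def)
      then have "even m" using assms E True by (cases "even m") auto
      then obtain k where "m = 2 * k" by blast
      then show ?thesis using that[of p k] pm True p2 by (simp add: P23_def ex_def)
    next
      case False
      have "odd p" using p2 pm(1) prime_odd_nat prime_ge_2_nat[of p] by (metis le_neq_implies_less)
      then have "p mod 4 = 1" using False by presburger
      then have "chi p = 1" by (simp add: chi_def)
      then show ?thesis using assms E False by simp
    qed
  qed
qed

lemma lamE_square:
  assumes "lamE n \<noteq> 0"
  shows "\<exists>j\<ge>1. n = j\<^sup>2 \<or> n = 2 * j\<^sup>2"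
proof -
  obtain p k where pk: "p \<in> P23" "k > 0" "n = p ^ (ex p * k)" using assms by (rule lamE_nonzeroE)
  have p1: "p \<ge> 1" using P23_prime[OF pk(1)] prime_ge_1_nat by blast
  show ?thesis
  proof (cases "p = 2")
    case False
    then have "n = (p ^ k)\<^sup>2" using pk by (simp add: ex_def mult.commute flip: power_mult)
    then show ?thesis using p1 by (intro exI[of _ "p ^ k"]) auto
  next
    case True
    then have n: "n = 2 ^ k" using pk by (simp add: ex_def)
    show ?thesis
    proof (cases "even k")
      case True
      then obtain j where "k = 2 * j" by blast
      then have "n = (2 ^ j)\<^sup>2" using n by (simp add: mult.commute flip: power_mult)
      then show ?thesis by (intro exI[of _ "2 ^ j"]) auto
    next
      case False
      then obtain j where "k = 2 * j + 1" using oddE by blast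
      then have "n = 2 * (2 ^ j)\<^sup>2" using n by (simp add: mult.commute flip: power_mult)
      then show ?thesis by (intro exI[of _ "2 ^ j"]) auto
    qed
  qed
qed

lemma lamE_sum_le:
  assumes A: "finite A" and h: "\<And>n. h n \<ge> 0"
  shows "(\<Sum>n\<in>A. lamE n * h n) \<le> (\<Sum>j\<in>{j. j \<ge> 1 \<and> j\<^sup>2 \<in> A}. lamE (j\<^sup>2) * h (j\<^sup>2)) + (\<Sum>j\<in>{j. j \<ge> 1 \<and> 2 * j\<^sup>2 \<in> A}. lamE (2 * j\<^sup>2) * h (2 * j\<^sup>2))"
proof -
  define f1 f2 where "f1 = (\<lambda>j :: nat. j\<^sup>2)" and "f2 = (\<lambda>j :: nat. 2 * j\<^sup>2)"
  define A1 A2 where "A1 = {j. j \<ge> 1 \<and> f1 j \<in> A}" and "A2 = {j. j \<ge> 1 \<and> f2 j \<in> A}"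
  have i1: "inj f1" and i2: "inj f2" by (auto simp: inj_def f1_def f2_def)
  have fin: "finite (f1 ` A1)" "finite (f2 ` A2)" using A by (auto simp: A1_def A2_def intro: finite_subset)
  have nn: "0 \<le> lamE n * h n" for n using lamE_bounds h by simp
  have "(\<Sum>n\<in>A. lamE n * h n) = (\<Sum>n\<in>{n \<in> A. lamE n \<noteq> 0}. lamE n * h n)"
    using A by (intro sum.mono_neutral_right) auto
  also have "\<dots> \<le> (\<Sum>n\<in>f1 ` A1 \<union> f2 ` A2. lamE n * h n)"
  proof (rule sum_mono2)
    show "finite (f1 ` A1 \<union> f2 ` A2)" using fin by simp
    show "{n \<in> A. lamE n \<noteq> 0} \<subseteq> f1 ` A1 \<union> f2 ` A2"
    proof
      fix n assume n: "n \<in> {n \<in> A. lamE n \<noteq> 0}"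
      then obtain j where "j \<ge> 1" "n = j\<^sup>2 \<or> n = 2 * j\<^sup>2" using lamE_square by blast
      then show "n \<in> f1 ` A1 \<union> f2 ` A2" using n by (auto simp: A1_def A2_def f1_def f2_def)
    qed
  qed (rule nn)
  also have "\<dots> \<le> (\<Sum>n\<in>f1 ` A1. lamE n * h n) + (\<Sum>n\<in>f2 ` A2. lamE n * h n)"
    using fin nn by (simp add: sum_Un sum_nonneg)
  also have "(\<Sum>n\<in>f1 ` A1. lamE n * h n) = (\<Sum>j\<in>A1. lamE (f1 j) * h (f1 j))"
    using i1 by (intro sum.reindex_cong[of f1]) (auto intro: inj_on_subset)
  also have "(\<Sum>n\<in>f2 ` A2. lamE n * h n) = (\<Sum>j\<in>A2. lamE (f2 j) * h (f2 j))"
    using i2 by (intro sum.reindex_cong[of f2]) (auto intro: inj_on_subset)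
  finally show ?thesis by (simp add: A1_def A2_def f1_def f2_def)
qed

lemma summ_lamE_le:
  assumes x: "x \<ge> 1"
  shows "summ lamE x \<le> 2 * sqrt x * ln x"
proof -
  have lam: "lamE n \<le> ln x" if "n \<in> nset x" for n
  proof -
    have "lamE n \<le> ln (real n)" using lamE_bounds(2)[of n] mangoldt_le[of n] that by (simp add: nset_def)
    also have "\<dots> \<le> ln x" using that by (simp add: nset_def)
    finally show ?thesis .
  qed
  have sub: "{j. j \<ge> 1 \<and> j\<^sup>2 \<in> nset x} \<subseteq> nset (sqrt x)" "{j. j \<ge> 1 \<and> 2 * j\<^sup>2 \<in> nset x} \<subseteq> nset (sqrt x)"
  proof -
    have "real j \<le> sqrt x" if "2 * (real j)\<^sup>2 \<le> x" for j :: nat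
      by (rule real_le_rsqrt) (use that zero_le_power2[of "real j"] in linarith)
    then show "{j. j \<ge> 1 \<and> 2 * j\<^sup>2 \<in> nset x} \<subseteq> nset (sqrt x)" by (auto simp: nset_def)
  qed (auto simp: nset_def intro!: real_le_rsqrt)
  have c: "card (nset (sqrt x)) \<le> sqrt x" using x of_nat_floor[of "sqrt x"] by (simp add: nset_eq)
  have bd: "(\<Sum>j\<in>J. lamE (f j) * 1) \<le> sqrt x * ln x" if J: "J \<subseteq> nset (sqrt x)" "\<And>j. j \<in> J \<Longrightarrow> f j \<in> nset x" for J f
  proof -
    have "(\<Sum>j\<in>J. lamE (f j) * 1) \<le> (\<Sum>j\<in>J. ln x)" using lam J by (intro sum_mono) auto
    also have "\<dots> = real (card J) * ln x" by simp
    also have "\<dots> \<le> sqrt x * ln x"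
    proof (rule mult_right_mono)
      have "card J \<le> card (nset (sqrt x))" using J by (intro card_mono) auto
      then show "real (card J) \<le> sqrt x" using c by linarith
    qed (use x in simp)
    finally show ?thesis .
  qed
  have "summ lamE x = (\<Sum>n\<in>nset x. lamE n * 1)" by (simp add: summ_def)
  also have "\<dots> \<le> (\<Sum>j\<in>{j. j \<ge> 1 \<and> j\<^sup>2 \<in> nset x}. lamE (j\<^sup>2) * 1) + (\<Sum>j\<in>{j. j \<ge> 1 \<and> 2 * j\<^sup>2 \<in> nset x}. lamE (2 * j\<^sup>2) * 1)"
    by (intro lamE_sum_le) auto
  also have "\<dots> \<le> sqrt x * ln x + sqrt x * ln x"
    by (intro add_mono bd sub) auto
  finally show ?thesis by simp
qed

lemma abs_conv_lamE: "abs_conv lamE (3/4)"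
proof -
  define g where "g = (\<lambda>j :: nat. 8 * real j powr (- 5/4))"
  have gs: "summable g" unfolding g_def by (intro summable_mult) (simp add: summable_real_powr_iff)
  have le: "lamE n * real n powr (- (3/4)) \<le> g j" if j: "j \<ge> 1" "j\<^sup>2 \<le> n" for n j
  proof -
    have n: "n \<ge> 1" using j by (metis le_trans one_le_power)
    have "lamE n \<le> ln (real n)" using lamE_bounds(2)[of n] mangoldt_le[of n] n by simp
    also have "\<dots> \<le> real n powr (1/8) / (1/8)" by (intro ln_le_powr) auto
    finally have "lamE n * real n powr (- (3/4)) \<le> (8 * real n powr (1/8)) * real n powr (- (3/4))"
      by (intro mult_right_mono) auto
    also have "\<dots> = 8 * real n powr (- 5/8)" by (simp flip: powr_add)
    also have "real n powr (- 5/8) \<le> real (j\<^sup>2) powr (- 5/8)"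
      using j by (intro powr_mono2') (auto simp del: of_nat_power)
    also have "real (j\<^sup>2) powr (- 5/8) = real j powr (- 5/4)"
    proof -
      have "real (j\<^sup>2) = real j powr 2" using j by (simp add: powr_numeral)
      then show ?thesis by (simp only: powr_powr) simp
    qed
    finally show ?thesis by (simp add: g_def)
  qed
  have "(\<Sum>n\<in>A. lamE n * real n powr (- (3/4))) \<le> 2 * suminf g" if A: "finite A" for A
  proof -
    have gb: "(\<Sum>j\<in>J. lamE (f j) * real (f j) powr (- (3/4))) \<le> suminf g" if "finite J" "\<And>j. j \<in> J \<Longrightarrow> j \<ge> 1 \<and> j\<^sup>2 \<le> f j" for J f
    proof -
      have "(\<Sum>j\<in>J. lamE (f j) * real (f j) powr (- (3/4))) \<le> (\<Sum>j\<in>J. g j)" using that le by (intro sum_mono) auto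
      also have "\<dots> \<le> suminf g" by (rule sum_le_suminf[OF gs that(1)]) (simp add: g_def)
      finally show ?thesis .
    qed
    have "finite {j. j \<ge> 1 \<and> j\<^sup>2 \<in> A}" "finite {j. j \<ge> 1 \<and> 2 * j\<^sup>2 \<in> A}"
      using A finite_subset[OF _ finite_vimageI[of A "\<lambda>j. j\<^sup>2"], of "{j. j \<ge> 1 \<and> j\<^sup>2 \<in> A}"]
        finite_subset[OF _ finite_vimageI[of A "\<lambda>j. 2 * j\<^sup>2"], of "{j. j \<ge> 1 \<and> 2 * j\<^sup>2 \<in> A}"]
      by (auto simp: inj_def)
    then have "(\<Sum>j\<in>{j. j \<ge> 1 \<and> j\<^sup>2 \<in> A}. lamE (j\<^sup>2) * real (j\<^sup>2) powr (- (3/4))) + (\<Sum>j\<in>{j. j \<ge> 1 \<and> 2 * j\<^sup>2 \<in> A}. lamE (2 * j\<^sup>2) * real (2 * j\<^sup>2) powr (- (3/4))) \<le> suminf g + suminf g"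
      by (intro add_mono gb) auto
    moreover have "(\<Sum>n\<in>A. lamE n * real n powr (- (3/4))) \<le> (\<Sum>j\<in>{j. j \<ge> 1 \<and> j\<^sup>2 \<in> A}. lamE (j\<^sup>2) * real (j\<^sup>2) powr (- (3/4))) + (\<Sum>j\<in>{j. j \<ge> 1 \<and> 2 * j\<^sup>2 \<in> A}. lamE (2 * j\<^sup>2) * real (2 * j\<^sup>2) powr (- (3/4)))"
      by (rule lamE_sum_le[OF A]) simp
    ultimately show ?thesis by linarith
  qed
  then have "summable (\<lambda>n. lamE n * real n powr (- (3/4)))"
    using lamE_bounds by (intro summableI_nonneg_bounded) auto
  then show ?thesis using lamE_bounds by (simp add: abs_conv_def)
qed

lemma lamR_le: "lamR n \<le> 2 * mangoldt n"
proof -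
  have "(if aprimedivisor n mod 4 = 3 then 1 + chi n else 1) \<le> 2" using abs_chi_le_1[of n] by (auto simp: abs_le_iff)
  from mult_left_mono[OF this mangoldt_nonneg[of n]] show ?thesis by (simp add: lamR_def)
qed

lemma summ_lamR_le: "x \<ge> 0 \<Longrightarrow> summ lamR x \<le> 8 * x"
proof -
  assume "x \<ge> 0"
  have "summ lamR x \<le> summ (\<lambda>n. 2 * mangoldt n) x" unfolding summ_def by (intro sum_mono lamR_le)
  also have "\<dots> \<le> 8 * x" using chebyshev[OF \<open>x \<ge> 0\<close>] by (simp add: summ_cmult)
  finally show ?thesis .
qed

lemma summ_lamR_asymp: "\<exists>D>0. \<forall>x\<ge>1. \<bar>summ lamR x - x / 2\<bar> \<le> D * (x * wt x)"
proof -
  obtain D where D: "D > 0" "\<And>x. x \<ge> 1 \<Longrightarrow> \<bar>summ lamQ x - x\<bar> \<le> D * (x * wt x)"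
    using summ_lamQ_asymp by blast
  obtain K where K: "K > 0" "\<And>x :: real. x \<ge> 1 \<Longrightarrow> (1 + ln x) powr (9/4) \<le> K * x powr (1/2)"
    using one_plus_ln_powr_le[of "9/4" "1/2"] by auto
  have "\<bar>summ lamR x - x / 2\<bar> \<le> (D / 2 + 2 * K) * (x * wt x)" if x: "x \<ge> 1" for x
  proof -
    have l: "1 + ln x > 0" using x ln_ge_zero[OF x] by linarith
    have "summ lamR x = summ (\<lambda>n. 1/2 * lamQ n + lamE n) x" by (simp add: lamE_def)
    then have e: "summ lamR x - x / 2 = summ lamQ x / 2 - x / 2 + summ lamE x"
      unfolding summ_add summ_cmult by simp
    have "summ lamE x \<le> 2 * sqrt x * ln x" by (rule summ_lamE_le[OF x])
    also have "\<dots> \<le> 2 * sqrt x * (1 + ln x)" using x by (intro mult_left_mono) auto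
    also have "1 + ln x = (1 + ln x) powr (9/4) * wt x" unfolding wt_def using l by (simp flip: powr_add)
    also have "2 * sqrt x * ((1 + ln x) powr (9/4) * wt x) \<le> 2 * sqrt x * (K * x powr (1/2) * wt x)"
      using K(2)[OF x] wt_pos[OF x] x by (intro mult_left_mono mult_right_mono) auto
    also have "\<dots> = 2 * K * (sqrt x * sqrt x * wt x)" using x by (simp add: powr_half_sqrt)
    also have "sqrt x * sqrt x = x" using x by simp
    finally have "summ lamE x \<le> 2 * K * (x * wt x)" .
    moreover have "summ lamE x \<ge> 0" using lamE_bounds by (intro summ_nonneg) auto
    ultimately have "\<bar>summ lamR x - x / 2\<bar> \<le> D * (x * wt x) / 2 + 2 * K * (x * wt x)"
      unfolding e using D(2)[OF x] by linarith
    then show ?thesis by (simp add: algebra_simps)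
  qed
  moreover have "D / 2 + 2 * K > 0" using D K by simp
  ultimately show ?thesis by blast
qed

lemma abs_conv_add:
  assumes "abs_conv a x" "abs_conv b x"
  shows "abs_conv (\<lambda>n. a n + b n) x"
  unfolding abs_conv_def
proof (rule summable_comparison_test'[where N = 0])
  show "summable (\<lambda>n. \<bar>a n\<bar> * real n powr (- x) + \<bar>b n\<bar> * real n powr (- x))"
    using assms unfolding abs_conv_def by (rule summable_add)
  show "norm (\<bar>a n + b n\<bar> * real n powr (- x)) \<le> \<bar>a n\<bar> * real n powr (- x) + \<bar>b n\<bar> * real n powr (- x)" for n
    using mult_right_mono[OF abs_triangle_ineq[of "a n" "b n"], of "real n powr (- x)"] by (simp add: distrib_right)
qed

definition rser :: "(nat \<Rightarrow> real) \<Rightarrow> real \<Rightarrow> real" where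
  "rser a x = (\<Sum>n. a n * real n powr (- x))"

lemma rser_sums: "abs_conv a x \<Longrightarrow> (\<lambda>n. a n * real n powr (- x)) sums rser a x"
  unfolding rser_def abs_conv_def
  by (rule summable_sums[OF summable_rabs_cancel]) (simp add: abs_mult)

lemma dser_of_real: "abs_conv a x \<Longrightarrow> dser a (of_real x) = of_real (rser a x)"
proof -
  assume a: "abs_conv a x"
  have "(\<lambda>n. of_real (a n * real n powr (- x))) sums (of_real (rser a x) :: complex)"
    using rser_sums[OF a] by (rule sums_of_real)
  moreover have "of_real (a n * real n powr (- x)) = of_real (a n) * (of_nat n :: complex) powr (- of_real x)" for n
    using powr_of_real[of "real n" "- x"] by simp
  ultimately have "(\<lambda>n. of_real (a n) * (of_nat n :: complex) powr (- of_real x)) sums of_real (rser a x)" by (simp only:)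
  then show ?thesis unfolding dser_def by (rule sums_unique[symmetric])
qed

lemma abs_conv_indR: "x > 1 \<Longrightarrow> abs_conv indR x"
  by (rule abs_conv_bounded[of _ 1]) (use indR_nonneg indR_le_1 in auto)

lemma abs_conv_lamR: "x > 1 \<Longrightarrow> abs_conv lamR x"
  using lamR_le lamR_nonneg by (intro abs_conv_mangoldt_bound[of _ 2]) auto

text \<open>The Dirichlet series of \<^const>\<open>indR\<close> is a square root of the Dedekind zeta function up to
  a factor that converges beyond the line 1.\<close>

lemma rser_indR_square:
  assumes x: "x > 1"
  shows "of_real ((x - 1) * rser indR x ^ 2) = Kfun (of_real x) * exp (2 * dser (\<lambda>n. lamE n / ln n) (of_real x))"
proof -
  have s: "Re (of_real x) > 1" using x by simp
  have "abs_conv (\<lambda>n. lamE n / ln n) x"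
    using x by (intro abs_conv_div_ln abs_conv_mono[OF abs_conv_lamE]) auto
  then have e: "dser (\<lambda>n. lamE n / ln n + lamE n / ln n) (of_real x) = dser (\<lambda>n. lamE n / ln n) (of_real x) + dser (\<lambda>n. lamE n / ln n) (of_real x)"
    by (intro dser_add) auto
  have "abs_conv (\<lambda>n. lamE n / ln n + lamE n / ln n) x"
    using x by (intro abs_conv_add abs_conv_div_ln abs_conv_mono[OF abs_conv_lamE]) auto
  then have "dser (\<lambda>n. lamQ n / ln n + (lamE n / ln n + lamE n / ln n)) (of_real x) = dser (\<lambda>n. lamQ n / ln n) (of_real x) + 2 * dser (\<lambda>n. lamE n / ln n) (of_real x)"
    using x e abs_conv_div_ln[OF abs_conv_lamQ[OF x]] by (subst dser_add) auto
  moreover have "dser (\<lambda>n. lamR n / ln n + lamR n / ln n) (of_real x) = 2 * dser (\<lambda>n. lamR n / ln n) (of_real x)"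
    using x abs_conv_div_ln[OF abs_conv_lamR[OF x]] by (subst dser_add) auto
  moreover have "(\<lambda>n. lamR n / ln n + lamR n / ln n) = (\<lambda>n. lamQ n / ln n + (lamE n / ln n + lamE n / ln n))"
    by (rule ext) (simp add: lamE_def add_divide_distrib[symmetric] diff_divide_distrib[symmetric])
  ultimately have d: "2 * dser (\<lambda>n. lamR n / ln n) (of_real x) = dser (\<lambda>n. lamQ n / ln n) (of_real x) + 2 * dser (\<lambda>n. lamE n / ln n) (of_real x)"
    by simp
  have "dser indR (of_real x) = exp (dser (\<lambda>n. lamR n / ln n) (of_real x))"
    by (rule dser_eq_exp[OF _ _ _ _ s]) (use indR_ln abs_conv_indR abs_conv_lamR in auto)
  then have "dser indR (of_real x) ^ 2 = exp (2 * dser (\<lambda>n. lamR n / ln n) (of_real x))"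
    by (simp add: exp_double)
  then have "of_real ((x - 1) * rser indR x ^ 2) = (of_real x - 1) * exp (dser (\<lambda>n. lamQ n / ln n) (of_real x)) * exp (2 * dser (\<lambda>n. lamE n / ln n) (of_real x))"
    using dser_of_real[OF abs_conv_indR[OF x]] by (simp add: d exp_add)
  then show ?thesis using Kfun_eq_exp[OF s] by simp
qed

lemma exp_lamE_sum: "exp (2 * dser (\<lambda>n. lamE n / ln n) 1) = of_real (2 * (\<Prod>p. euler_factor p)\<^sup>2)"
proof -
  define g where "g = (\<lambda>n. 2 * (lamE n / ln n) * real n powr (- 1))"
  have ac: "abs_conv (\<lambda>n. lamE n / ln n) 1" by (intro abs_conv_div_ln abs_conv_mono[OF abs_conv_lamE]) auto
  have g_nonneg: "g n \<ge> 0" for n using lamE_bounds[of n] ln_nat_nonneg[of n] by (simp add: g_def)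
  define V where "V = 2 * rser (\<lambda>n. lamE n / ln n) 1"
  have "g sums V" using sums_mult[OF rser_sums[OF ac], of 2] by (simp add: g_def V_def mult.assoc)
  then have gV: "(g has_sum V) UNIV" using g_nonneg by (intro sums_nonneg_imp_has_sum) auto
  define f where "f = (\<lambda>(p :: nat, k :: nat). p ^ (ex p * k))"
  define I where "I = (SIGMA p:P23. {0<..} :: (nat \<times> nat) set)"
  have inj: "inj_on f I"
  proof (rule inj_onI)
    fix a b assume ab: "a \<in> I" "b \<in> I" "f a = f b"
    obtain p k q l where a: "a = (p, k)" "p \<in> P23" "k > 0" and b: "b = (q, l)" "q \<in> P23" "l > 0"
      using ab by (auto simp: I_def)
    have pq: "prime p" "prime q" using a b P23_prime by auto
    have e: "p ^ (ex p * k) = q ^ (ex q * l)" using ab(3) a b by (simp add: f_def)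
    have ek: "ex p * k > 0" "ex q * l > 0" using a b by (auto simp: ex_def)
    have "p dvd q ^ (ex q * l)" using e ek by (metis dvd_power)
    then have "p dvd q" using pq prime_dvd_power by blast
    then have "p = q" using pq primes_dvd_imp_eq by blast
    moreover have "p > 1" using pq prime_gt_1_nat by blast
    ultimately have "ex p * k = ex q * l" using e by (metis power_inject_exp)
    then have "k = l" using \<open>p = q\<close> by (simp add: ex_def split: if_splits)
    then show "a = b" using a b \<open>p = q\<close> by simp
  qed
  have g0: "g n = 0" if "n \<notin> f ` I" for n
  proof (rule ccontr)
    assume "g n \<noteq> 0"
    then have "lamE n \<noteq> 0" by (auto simp: g_def)
    then obtain p k where "p \<in> P23" "k > 0" "n = p ^ (ex p * k)" by (rule lamE_nonzeroE)
    then have "n \<in> f ` I" by (auto simp: f_def I_def intro!: image_eqI[of _ _ "(p, k)"])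
    then show False using that by simp
  qed
  define t where "t = (\<lambda>p. 1 / real p ^ ex p)"
  have gf: "g (f (p, k)) = t p ^ k / real k" if "p \<in> P23" "k > 0" for p k
  proof -
    have p: "prime p" using that P23_prime by blast
    have p1: "real p > 1" using p prime_gt_1_nat by simp
    have e0: "real (ex p) > 0" by (simp add: ex_def)
    have A: "ln (real (p ^ (ex p * k))) = real (ex p) * real k * ln p" using p1 by (simp add: ln_realpow)
    have T: "real (p ^ (ex p * k)) powr (- 1) = t p ^ k" using p1
      by (simp add: t_def powr_minus power_divide power_mult divide_inverse power_inverse)
    have "g (f (p, k)) = 2 * (lamE (p ^ (ex p * k)) / ln (real (p ^ (ex p * k)))) * real (p ^ (ex p * k)) powr (- 1)"
      by (simp only: g_def f_def prod.case)
    then have "g (f (p, k)) = 2 * ((real (ex p) * ln p) / 2 / (real (ex p) * real k * ln p)) * t p ^ k"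
      by (simp only: A T lamE_P23[OF that])
    moreover have "2 * ((r * L) / 2 / (r * k' * L)) * T = T / k'" if "r > 0" "L > 0" "k' > 0" for r L k' T :: real
      using that by (simp add: field_simps)
    moreover have "ln (real p) > 0" using p1 by simp
    ultimately show ?thesis using e0 that by (simp only: of_nat_0_less_iff)
  qed
  have t01: "0 < t p" "t p < 1" if "p \<in> P23" for p
  proof -
    have "real p > 1" using P23_prime[OF that] prime_gt_1_nat by simp
    then have "real p ^ ex p > 1" by (intro one_less_power) (auto simp: ex_def)
    moreover have "0 < 1 / w" "1 / w < 1" if "w > 1" for w :: real using that by simp_all
    ultimately show "0 < t p" "t p < 1" unfolding t_def by blast+
  qed
  have "(g has_sum V) (f ` I)"
    using gV by (rule has_sum_cong_neutral[THEN iffD1, rotated -1]) (use g0 in auto)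
  then have "((\<lambda>i. g (f i)) has_sum V) I" using has_sum_reindex[OF inj, of g V] by (simp add: o_def)
  then have "((\<lambda>p. - ln (1 - t p)) has_sum V) P23"
    unfolding I_def
  proof (rule has_sum_Sigma')
    fix p assume p: "p \<in> P23"
    have "(\<lambda>n. - (- ((- (- t p)) ^ n) / real n)) sums - ln (1 + - t p)"
      using t01[OF p] by (intro sums_minus ln_series') auto
    then have "(\<lambda>n. t p ^ n / real n) sums - ln (1 - t p)" by simp
    then have "((\<lambda>n. t p ^ n / real n) has_sum - ln (1 - t p)) UNIV"
      using t01[OF p] by (intro sums_nonneg_imp_has_sum) auto
    then have "((\<lambda>n. t p ^ n / real n) has_sum - ln (1 - t p)) {0<..}"
      by (rule has_sum_cong_neutral[THEN iffD1, rotated -1]) auto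
    then show "((\<lambda>k. g (f (p, k))) has_sum - ln (1 - t p)) {0<..}"
      by (rule has_sum_cong[THEN iffD1, rotated]) (use gf[OF p] in auto)
  qed
  define h where "h = (\<lambda>p. if prime p \<and> p mod 4 = 3 then - ln (1 - t p) else 0)"
  have "((\<lambda>p. - ln (1 - t p)) has_sum (V - (- ln (1 - t 2)))) (P23 - {2})"
    using \<open>((\<lambda>p. - ln (1 - t p)) has_sum V) P23\<close>
    by (intro has_sum_Diff) (auto simp: P23_def intro!: has_sum_finiteI)
  also have "- ln (1 - t 2) = ln 2" by (simp add: t_def ex_def ln_div)
  also have "((\<lambda>p. - ln (1 - t p)) has_sum (V - ln 2)) (P23 - {2}) \<longleftrightarrow> (h has_sum (V - ln 2)) UNIV"
    by (rule has_sum_cong_neutral) (auto simp: h_def P23_def)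
  finally have "(h has_sum (V - ln 2)) UNIV" .
  then have hs: "h sums (V - ln 2)" by (rule has_sum_imp_sums)
  have ef: "euler_factor p = exp (h p / 2)" for p
  proof (cases "prime p \<and> p mod 4 = 3")
    case True
    then have P: "p \<in> P23" by (auto simp: P23_def)
    have "p \<noteq> 2" using True by auto
    then have "t p = 1 / (real p)\<^sup>2" by (simp add: t_def ex_def)
    moreover have "[p = 3] (mod 4)" using True by (simp add: cong_def)
    ultimately have "euler_factor p = (1 - t p) powr (- 1 / 2)" using True by (simp add: euler_factor_def)
    also have "\<dots> = exp (h p / 2)" using True t01[OF P] by (simp add: powr_def h_def)
    finally show ?thesis .
  qed (auto simp: euler_factor_def h_def cong_def)
  have "(\<lambda>n. \<Prod>k<n. euler_factor k) \<longlonglongrightarrow> exp ((V - ln 2) / 2)"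
  proof -
    have "(\<Prod>k<n. euler_factor k) = exp ((\<Sum>k<n. h k) / 2)" for n
      by (simp add: ef exp_sum sum_divide_distrib)
    moreover have "(\<lambda>n. exp ((\<Sum>k<n. h k) / 2)) \<longlonglongrightarrow> exp ((V - ln 2) / 2)"
      using hs unfolding sums_def by (intro tendsto_intros) auto
    ultimately show ?thesis by simp
  qed
  then have "(\<Prod>p. euler_factor p) = exp ((V - ln 2) / 2)" by (rule prodinf_eq_prod_lim') simp
  then have "(\<Prod>p. euler_factor p)\<^sup>2 = exp (V - ln 2)" by (simp flip: exp_double)
  then have "2 * (\<Prod>p. euler_factor p)\<^sup>2 = exp V" by (simp add: exp_diff)
  moreover have "2 * dser (\<lambda>n. lamE n / ln n) 1 = of_real V" using dser_of_real[OF ac] by (simp add: V_def)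
  ultimately show ?thesis by (simp flip: exp_of_real)
qed

lemma rser_indR_limit: "((\<lambda>w. w * rser indR (1 + w) ^ 2) \<longlongrightarrow> pi / 2 * (\<Prod>p. euler_factor p)\<^sup>2) (at_right 0)"
proof -
  have "isCont Kfun 1"
    using holomorphic_on_imp_continuous_on[OF Kfun_holomorphic] continuous_on_eq_continuous_at[OF open_halfspace_Re_gt[of 0], of Kfun] by auto
  moreover have "isCont (dser (\<lambda>n. lamE n / ln n)) 1"
    using dser_deriv[OF abs_conv_div_ln[OF abs_conv_lamE], of 1] by (intro DERIV_isCont) auto
  ultimately have c: "isCont (\<lambda>s. Kfun s * exp (2 * dser (\<lambda>n. lamE n / ln n) s)) 1" by (intro continuous_intros)
  have "((\<lambda>w. of_real (1 + w) :: complex) \<longlongrightarrow> of_real (1 + 0)) (at_right 0)" by (intro tendsto_intros)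
  then have l: "((\<lambda>w. of_real (1 + w) :: complex) \<longlongrightarrow> 1) (at_right 0)" by simp
  have "((\<lambda>w. Kfun (of_real (1 + w)) * exp (2 * dser (\<lambda>n. lamE n / ln n) (of_real (1 + w)))) \<longlongrightarrow> Kfun 1 * exp (2 * dser (\<lambda>n. lamE n / ln n) 1)) (at_right 0)"
    using isCont_tendsto_compose[OF c l] .
  moreover have "\<forall>\<^sub>F w in at_right 0. Kfun (of_real (1 + w)) * exp (2 * dser (\<lambda>n. lamE n / ln n) (of_real (1 + w))) = of_real (w * rser indR (1 + w) ^ 2)"
    using eventually_at_right_less[of "0 :: real"]
  proof eventually_elim
    case (elim w)
    then show ?case using rser_indR_square[of "1 + w"] by simp
  qed
  ultimately have "((\<lambda>w. of_real (w * rser indR (1 + w) ^ 2)) \<longlongrightarrow> Kfun 1 * exp (2 * dser (\<lambda>n. lamE n / ln n) 1)) (at_right 0)"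
    by (rule Lim_transform_eventually)
  also have "Kfun 1 * exp (2 * dser (\<lambda>n. lamE n / ln n) 1) = of_real (pi / 2 * (\<Prod>p. euler_factor p)\<^sup>2)"
    unfolding exp_lamE_sum Kfun_1 of_real_mult[symmetric] by (rule arg_cong[of _ _ of_real]) simp
  finally show ?thesis by (simp only: tendsto_of_real_iff)
qed

lemma rser_indR_bound: "\<exists>C>0. \<forall>w. 0 < w \<longrightarrow> w \<le> 1 \<longrightarrow> rser indR (1 + w) \<le> C / sqrt w"
proof -
  define l where "l = pi / 2 * (\<Prod>p. euler_factor p)\<^sup>2"
  have "\<forall>\<^sub>F w in at_right 0. w * rser indR (1 + w) ^ 2 < l + 1"
    using order_tendstoD(2)[OF rser_indR_limit, of "l + 1"] by (simp add: l_def)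
  then obtain d where d: "d > 0" "\<And>w. 0 < w \<Longrightarrow> w < d \<Longrightarrow> w * rser indR (1 + w) ^ 2 < l + 1"
    by (auto simp: eventually_at_right_field)
  define e where "e = min (d / 2) 1"
  have e: "0 < e" "e < d" "e \<le> 1" using d by (auto simp: e_def)
  have nn: "rser indR (1 + w) \<ge> 0" if "w > 0" for w
    by (rule sums_le[OF _ sums_zero rser_sums[OF abs_conv_indR]]) (use that indR_nonneg in auto)
  have mono: "rser indR (1 + w) \<le> rser indR (1 + e)" if "w \<ge> e" for w
  proof (rule sums_le)
    show "(\<lambda>n. indR n * real n powr (- (1 + w))) sums rser indR (1 + w)" using that e by (intro rser_sums abs_conv_indR) auto
    show "(\<lambda>n. indR n * real n powr (- (1 + e))) sums rser indR (1 + e)" using e by (intro rser_sums abs_conv_indR) auto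
    fix n :: nat
    show "indR n * real n powr (- (1 + w)) \<le> indR n * real n powr (- (1 + e))"
      using that indR_nonneg[of n] by (cases "n = 0") (auto intro!: mult_left_mono powr_mono)
  qed
  define C where "C = sqrt (\<bar>l\<bar> + 1) + rser indR (1 + e)"
  have C: "C > 0" using nn[OF e(1)] by (simp add: C_def add_pos_nonneg)
  have "rser indR (1 + w) \<le> C / sqrt w" if w: "0 < w" "w \<le> 1" for w
  proof (cases "w < d")
    case True
    have "(sqrt w * rser indR (1 + w))\<^sup>2 \<le> \<bar>l\<bar> + 1" using d(2)[OF w(1) True] w by (simp add: power_mult_distrib)
    then have "sqrt w * rser indR (1 + w) \<le> sqrt (\<bar>l\<bar> + 1)" by (rule real_le_rsqrt)
    also have "\<dots> \<le> C" using nn[OF e(1)] by (simp add: C_def)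
    finally show ?thesis using w by (simp add: pos_le_divide_eq mult.commute)
  next
    case False
    have "sqrt w * rser indR (1 + w) \<le> 1 * rser indR (1 + e)"
      using w False e nn[OF w(1)] by (intro mult_mono mono) auto
    also have "\<dots> \<le> C" by (simp add: C_def)
    finally show ?thesis using w by (simp add: pos_le_divide_eq mult.commute)
  qed
  then show ?thesis using C by blast
qed

section \<open>The number of sums of two squares\<close>

definition MR :: "real \<Rightarrow> real" where "MR x = summ (\<lambda>n. indR n / real n) x"

lemma MR_nonneg: "MR x \<ge> 0"
  unfolding MR_def using indR_nonneg by (intro summ_nonneg) auto

lemma MR_mono: "x \<le> y \<Longrightarrow> MR x \<le> MR y"
  unfolding MR_def using indR_nonneg by (intro summ_mono) auto

lemma dconv_div: "dconv (\<lambda>n. a n / real n) (\<lambda>n. b n / real n) n = dconv a b n / real n"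
proof (cases "n = 0")
  case False
  show ?thesis unfolding dconv_def sum_divide_distrib
  proof (rule sum.cong[OF refl])
    fix d assume "d \<in> {d. d dvd n}"
    then obtain k where "n = d * k" by auto
    moreover from this False have "d > 0" "k > 0" by auto
    ultimately show "a d / real d * (b (n div d) / real (n div d)) = a d * b (n div d) / real n" by simp
  qed
qed simp

lemma sum_wt_le: "(\<Sum>n\<in>{1..N}. wt (real n) / real n) \<le> 5"
proof (cases "N = 0")
  case False
  then have "N \<ge> 1" by simp
  then have "(\<Sum>n\<in>{1..N}. wt (real n) / real n) \<le> 5 - 4 * (1 + ln (real N)) powr (- 1/4)"
  proof (induction N rule: dec_induct)
    case base
    show ?case by (simp add: wt_def)
  next
    case (step N)
    let ?h = "\<lambda>t :: real. - 4 * (1 + ln t) powr (- 1/4)"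
    have pos: "1 + ln z > 0" if "z \<ge> 1" for z :: real using ln_ge_zero[OF that] by linarith
    have N1: "real N \<ge> 1" using step by simp
    have "\<exists>z>real N. z < real (Suc N) \<and> ?h (real (Suc N)) - ?h (real N) = (real (Suc N) - real N) * (wt z / z)"
    proof (rule MVT2)
      fix z assume z: "real N \<le> z" "z \<le> real (Suc N)"
      then have "z \<ge> 1" using N1 by linarith
      have "(?h has_real_derivative - 4 * ((- 1/4) * (1 + ln z) powr (- 1/4 - 1) * (1 / z))) (at z)"
        using pos[OF \<open>z \<ge> 1\<close>] \<open>z \<ge> 1\<close> by (auto intro!: derivative_eq_intros)
      then show "(?h has_real_derivative wt z / z) (at z)" by (simp add: wt_def)
    qed simp
    then obtain z where z: "real N < z" "z < real (Suc N)" "?h (real (Suc N)) - ?h (real N) = wt z / z" by auto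
    have "wt (real (Suc N)) / real (Suc N) \<le> wt z / z"
    proof (rule frac_le)
      have "ln z \<le> ln (real (Suc N))" using z N1 by (subst ln_le_cancel_iff) auto
      then show "wt (real (Suc N)) \<le> wt z" unfolding wt_def using pos[of z] z N1 by (intro powr_mono2') auto
      show "0 \<le> wt z" by (simp add: wt_def)
    qed (use z N1 in auto)
    moreover have "(\<Sum>n\<in>{1..Suc N}. wt (real n) / real n) = (\<Sum>n\<in>{1..N}. wt (real n) / real n) + wt (real (Suc N)) / real (Suc N)" by simp
    ultimately show ?case using step.IH z(3) by linarith
  qed
  moreover have "4 * (1 + ln (real N)) powr (- 1/4) \<ge> 0" by simp
  ultimately show ?thesis by linarith
qed simp

lemma harmonic_shift_bounds:
  assumes "N \<ge> 1"
  shows "\<bar>(\<Sum>n\<in>{1..N}. 1 / (real n + 1)) - ln (real N)\<bar> \<le> 1"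
proof -
  have 1: "(\<Sum>n\<in>{1..N}. 1 / (real n + 1)) \<le> ln (real N + 1)" for N
  proof (induction N)
    case (Suc N)
    have "ln ((real N + 1) / (real N + 2)) \<le> (real N + 1) / (real N + 2) - 1" by (rule ln_le_minus_one) simp
    also have "\<dots> = - (1 / (real N + 2))" by (simp add: field_simps)
    also have "ln ((real N + 1) / (real N + 2)) = ln (real N + 1) - ln (real N + 2)" by (rule ln_divide_pos) auto
    finally show ?case using Suc by (simp add: add.commute)
  qed simp
  have 2: "ln (real N + 2) - ln 2 \<le> (\<Sum>n\<in>{1..N}. 1 / (real n + 1))" for N
  proof (induction N)
    case (Suc N)
    have "ln ((real N + 3) / (real N + 2)) \<le> (real N + 3) / (real N + 2) - 1" by (rule ln_le_minus_one) simp
    also have "\<dots> = 1 / (real N + 2)" by (simp add: field_simps)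
    also have "ln ((real N + 3) / (real N + 2)) = ln (real N + 3) - ln (real N + 2)" by (rule ln_divide_pos) auto
    finally show ?case using Suc by (simp add: add.commute)
  qed simp
  have N: "real N \<ge> 1" using assms by simp
  have "ln (real N + 1) \<le> ln (2 * real N)" using N by (subst ln_le_cancel_iff) auto
  also have "\<dots> = ln 2 + ln (real N)" using N by (intro ln_mult_pos) auto
  finally have 3: "ln (real N + 1) \<le> ln 2 + ln (real N)" .
  have 4: "ln (real N) \<le> ln (real N + 2)" using N by (subst ln_le_cancel_iff) auto
  have 5: "ln 2 \<le> (1 :: real)" using ln_le_minus_one[of "2 :: real"] by simp
  show ?thesis using 1[of N] 2[of N] 3 4 5 by linarith
qed

lemma sum_div_by_parts:
  "(\<Sum>n\<in>{1..N}. a n / real n) = (\<Sum>n\<in>{1..N}. a n) / (real N + 1) + (\<Sum>n\<in>{1..N}. (\<Sum>k\<in>{1..n}. a k) / (real n * (real n + 1)))"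
proof (induction N)
  case (Suc N)
  define S where "S = (\<Sum>n\<in>{1..N}. a n)"
  have S: "(\<Sum>n\<in>{1..Suc N}. a n) = S + a (Suc N)" by (simp add: S_def)
  have gen: "s / m + b / m = (s + b) / (m + 1) + (s + b) / (m * (m + 1))" if "m > 0" for s b m :: real
  proof -
    have "1 / (m + 1) + 1 / (m * (m + 1)) = (m + 1) / (m * (m + 1))" using that by (simp add: add_divide_distrib)
    then have "1 / (m + 1) + 1 / (m * (m + 1)) = 1 / m" using that by simp
    then have "(s + b) * (1 / m) = (s + b) * (1 / (m + 1) + 1 / (m * (m + 1)))" by simp
    then show ?thesis by (simp only: distrib_left add_divide_distrib[symmetric]) simp
  qed
  have "(\<Sum>n\<in>{1..Suc N}. a n / real n) = (\<Sum>n\<in>{1..N}. a n / real n) + a (Suc N) / (real N + 1)" by (simp add: add.commute)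
  also have "\<dots> = (\<Sum>n\<in>{1..N}. (\<Sum>k\<in>{1..n}. a k) / (real n * (real n + 1))) + (S / (real N + 1) + a (Suc N) / (real N + 1))"
    using Suc by (simp add: S_def)
  also have "S / (real N + 1) + a (Suc N) / (real N + 1) = (S + a (Suc N)) / (real N + 1 + 1) + (S + a (Suc N)) / ((real N + 1) * (real N + 1 + 1))"
    by (rule gen) simp
  finally have "(\<Sum>n\<in>{1..Suc N}. a n / real n) = (\<Sum>n\<in>{1..N}. (\<Sum>k\<in>{1..n}. a k) / (real n * (real n + 1)))
     + ((S + a (Suc N)) / (real N + 1 + 1) + (S + a (Suc N)) / ((real N + 1) * (real N + 1 + 1)))" .
  moreover have "(\<Sum>n\<in>{1..Suc N}. (\<Sum>k\<in>{1..n}. a k) / (real n * (real n + 1)))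
     = (\<Sum>k\<in>{1..Suc N}. a k) / (real (Suc N) * (real (Suc N) + 1)) + (\<Sum>n\<in>{1..N}. (\<Sum>k\<in>{1..n}. a k) / (real n * (real n + 1)))"
    by (rule sum.nat_ivl_Suc') simp
  moreover have "real (Suc N) = real N + 1" by simp
  ultimately show ?case unfolding S by (simp only: add_ac)
qed simp

lemma summ_lamR_div: "\<exists>D>0. \<forall>x\<ge>1. \<bar>summ (\<lambda>n. lamR n / real n) x - ln x / 2\<bar> \<le> D"
proof -
  obtain D where D: "D > 0" "\<And>x. x \<ge> 1 \<Longrightarrow> \<bar>summ lamR x - x / 2\<bar> \<le> D * (x * wt x)"
    using summ_lamR_asymp by blast
  have "\<bar>summ (\<lambda>n. lamR n / real n) x - ln x / 2\<bar> \<le> 9 + 5 * D" if x: "x \<ge> 1" for x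
  proof -
    define N where "N = nat \<lfloor>x\<rfloor>"
    have fl: "\<lfloor>x\<rfloor> \<ge> 1" using x by linarith
    then have "int N = \<lfloor>x\<rfloor>" by (simp add: N_def)
    then have N1: "N \<ge> 1" using fl by linarith
    have "real N = of_int \<lfloor>x\<rfloor>" using fl by (simp add: N_def)
    then have Nx: "real N \<le> x" "x \<le> real N + 1" by linarith+
    define A where "A = (\<lambda>n. summ lamR (real n))"
    have A: "A n = (\<Sum>k\<in>{1..n}. lamR k)" for n by (simp add: A_def summ_def nset_of_nat)
    define e where "e = (\<lambda>n. A n - real n / 2)"
    have e: "\<bar>e n\<bar> \<le> D * (real n * wt (real n))" if "n \<ge> 1" for n using D(2)[of "real n"] that by (simp add: e_def A_def)
    have "summ (\<lambda>n. lamR n / real n) x = (\<Sum>n\<in>{1..N}. lamR n / real n)" by (simp add: summ_def nset_eq N_def)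
    also have "\<dots> = A N / (real N + 1) + (\<Sum>n\<in>{1..N}. A n / (real n * (real n + 1)))" unfolding A by (rule sum_div_by_parts)
    also have "(\<Sum>n\<in>{1..N}. A n / (real n * (real n + 1))) = (\<Sum>n\<in>{1..N}. (1 / (real n + 1)) / 2 + e n / (real n * (real n + 1)))"
    proof (rule sum.cong[OF refl])
      fix n assume "n \<in> {1..N}"
      then have n0: "real n > 0" by simp
      have gen: "(m / 2 + y) / (m * (m + 1)) = (1 / (m + 1)) / 2 + y / (m * (m + 1))" if "m > 0" for m y :: real
      proof -
        have "m / 2 / (m * (m + 1)) = (1 / (m + 1)) / 2" using that by simp
        then show ?thesis by (simp only: add_divide_distrib)
      qed
      have "A n = real n / 2 + e n" by (simp add: e_def)
      then show "A n / (real n * (real n + 1)) = (1 / (real n + 1)) / 2 + e n / (real n * (real n + 1))"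
        by (simp only: gen[OF n0])
    qed
    also have "\<dots> = (\<Sum>n\<in>{1..N}. 1 / (real n + 1)) / 2 + (\<Sum>n\<in>{1..N}. e n / (real n * (real n + 1)))"
      by (simp only: sum.distrib sum_divide_distrib)
    finally have eq: "summ (\<lambda>n. lamR n / real n) x = A N / (real N + 1) + ((\<Sum>n\<in>{1..N}. 1 / (real n + 1)) / 2 + (\<Sum>n\<in>{1..N}. e n / (real n * (real n + 1))))" .
    have "\<bar>\<Sum>n\<in>{1..N}. e n / (real n * (real n + 1))\<bar> \<le> (\<Sum>n\<in>{1..N}. D * (wt (real n) / real n))"
    proof (rule order_trans[OF sum_abs], rule sum_mono)
      fix n assume n: "n \<in> {1..N}"
      then have n1: "real n \<ge> 1" by simp
      have "\<bar>e n / (real n * (real n + 1))\<bar> = \<bar>e n\<bar> / (real n * (real n + 1))" using n1 by (simp add: abs_mult)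
      also have "\<dots> \<le> (D * (real n * wt (real n))) / (real n * real n)"
        using e[of n] n n1 wt_pos[OF n1] D(1) by (intro frac_le) auto
      also have "\<dots> = D * (wt (real n) / real n)" using n1 by simp
      finally show "\<bar>e n / (real n * (real n + 1))\<bar> \<le> D * (wt (real n) / real n)" .
    qed
    also have "\<dots> = D * (\<Sum>n\<in>{1..N}. wt (real n) / real n)" by (simp only: sum_distrib_left)
    also have "\<dots> \<le> D * 5" using D(1) sum_wt_le[of N] by (intro mult_left_mono) auto
    finally have b1: "\<bar>\<Sum>n\<in>{1..N}. e n / (real n * (real n + 1))\<bar> \<le> D * 5" .
    have "0 \<le> A N" unfolding A_def using lamR_nonneg by (intro summ_nonneg) auto
    moreover have "A N \<le> 8 * (real N + 1)" unfolding A_def using summ_lamR_le[of "real N"] by simp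
    ultimately have b2: "0 \<le> A N / (real N + 1)" "A N / (real N + 1) \<le> 8" by (simp_all add: divide_le_eq)
    have l1: "ln (real N) \<le> ln x" using Nx N1 by simp
    have "ln x \<le> ln (2 * real N)" using Nx N1 x by (subst ln_le_cancel_iff) auto
    also have "\<dots> = ln 2 + ln (real N)" using N1 by (intro ln_mult_pos) auto
    also have "ln 2 \<le> (1 :: real)" using ln_le_minus_one[of "2 :: real"] by simp
    finally have l2: "ln x \<le> 1 + ln (real N)" by simp
    show ?thesis unfolding eq using harmonic_shift_bounds[OF N1] b1 b2 l1 l2 by linarith
  qed
  moreover have "9 + 5 * D > 0" using D by simp
  ultimately show ?thesis by blast
qed

lemma MR_bound: "\<exists>C>0. \<forall>x\<ge>1. MR x \<le> C * sqrt (1 + ln x)"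
proof -
  obtain C where C: "C > 0" "\<And>w. 0 < w \<Longrightarrow> w \<le> 1 \<Longrightarrow> rser indR (1 + w) \<le> C / sqrt w"
    using rser_indR_bound by blast
  have large: "MR x \<le> exp 1 * C * sqrt (ln x)" if x: "x \<ge> exp 1" for x
  proof -
    have x0: "x > 0" using x exp_gt_zero[of 1] by linarith
    have l: "ln x \<ge> 1" using x x0 by (simp add: ln_ge_iff)
    define w where "w = 1 / ln x"
    have w: "0 < w" "w \<le> 1" using l by (auto simp: w_def)
    have ac: "abs_conv indR (1 + w)" using w by (intro abs_conv_indR) auto
    have "MR x \<le> (\<Sum>n\<in>nset x. exp 1 * (indR n * real n powr (- (1 + w))))"
      unfolding MR_def summ_def
    proof (rule sum_mono)
      fix n assume n: "n \<in> nset x"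
      then have n1: "real n \<ge> 1" "real n \<le> x" by (auto simp: nset_def)
      have "w * ln (real n) \<le> w * ln x" using n1 w by (intro mult_left_mono) auto
      also have "\<dots> = 1" using l by (simp add: w_def)
      finally have "real n powr w \<le> exp 1" using n1 by (simp add: powr_def)
      then have "real n powr w * (indR n * real n powr (- (1 + w))) \<le> exp 1 * (indR n * real n powr (- (1 + w)))"
        using indR_nonneg by (intro mult_right_mono) auto
      moreover have "real n powr w * (indR n * real n powr (- (1 + w))) = indR n / real n"
      proof -
        have "real n powr w * real n powr (- (1 + w)) = real n powr (- 1)" by (simp flip: powr_add)
        then show ?thesis using n1 by (simp add: powr_minus divide_inverse mult_ac)
      qed
      ultimately show "indR n / real n \<le> exp 1 * (indR n * real n powr (- (1 + w)))" by simp
    qed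
    also have "\<dots> = exp 1 * (\<Sum>n\<in>nset x. indR n * real n powr (- (1 + w)))" by (simp only: sum_distrib_left)
    also have "(\<Sum>n\<in>nset x. indR n * real n powr (- (1 + w))) \<le> rser indR (1 + w)"
      unfolding rser_def using rser_sums[OF ac] indR_nonneg by (intro sum_le_suminf) (auto simp: sums_iff)
    also have "rser indR (1 + w) \<le> C / sqrt w" by (rule C(2)[OF w])
    also have "C / sqrt w = C * sqrt (ln x)" by (simp add: w_def real_sqrt_divide)
    finally show ?thesis by (simp add: mult_ac)
  qed
  have "MR x \<le> exp 1 * C * sqrt (1 + ln x)" if x: "x \<ge> 1" for x
  proof (cases "x \<ge> exp 1")
    case True
    have "exp 1 * C * sqrt (ln x) \<le> exp 1 * C * sqrt (1 + ln x)" using C(1) by (intro mult_left_mono) auto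
    then show ?thesis using large[OF True] by linarith
  next
    case False
    have "MR x \<le> MR (exp 1)" using False by (intro MR_mono) auto
    also have "\<dots> \<le> exp 1 * C * 1" using large[of "exp 1"] by simp
    also have "\<dots> \<le> exp 1 * C * sqrt (1 + ln x)" using C(1) x by (intro mult_left_mono) auto
    finally show ?thesis .
  qed
  then show ?thesis using C(1) by (intro exI[of _ "exp 1 * C"]) auto
qed

text \<open>This is the integral of \<open>\<lambda>v. MR (exp v)\<close> over \<open>[0, u]\<close>.\<close>

definition TR :: "real \<Rightarrow> real" where
  "TR u = (\<Sum>k\<in>nset (exp u). indR k / real k * (u - ln (real k)))"

lemma MR_TR: "\<exists>D>0. \<forall>u\<ge>0. \<bar>MR (exp u) * u - 3 / 2 * TR u\<bar> \<le> D * MR (exp u)"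
proof -
  obtain D where D: "D > 0" "\<And>x. x \<ge> 1 \<Longrightarrow> \<bar>summ (\<lambda>n. lamR n / real n) x - ln x / 2\<bar> \<le> D"
    using summ_lamR_div by blast
  have "\<bar>MR (exp u) * u - 3 / 2 * TR u\<bar> \<le> D * MR (exp u)" if u: "u \<ge> 0" for u
  proof -
    define g where "g = (\<lambda>k. indR k / real k)"
    have g: "g k \<ge> 0" for k using indR_nonneg by (simp add: g_def)
    define L where "L = (\<lambda>k. summ (\<lambda>n. lamR n / real n) (exp u / real k))"
    have "(\<Sum>k\<in>nset (exp u). g k * ln (real k)) = summ (dconv (\<lambda>n. lamR n / real n) (\<lambda>n. indR n / real n)) (exp u)"
      unfolding summ_def dconv_div indR_ln[symmetric] by (simp add: g_def)
    also have "\<dots> = (\<Sum>k\<in>nset (exp u). g k * L k)" unfolding summ_dconv g_def L_def ..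
    finally have 1: "(\<Sum>k\<in>nset (exp u). g k * ln (real k)) = (\<Sum>k\<in>nset (exp u). g k * L k)" .
    have "MR (exp u) * u - 3 / 2 * TR u = (\<Sum>k\<in>nset (exp u). g k * u - 3 / 2 * (g k * (u - ln (real k))))"
    proof -
      have "MR (exp u) = (\<Sum>k\<in>nset (exp u). g k)" "TR u = (\<Sum>k\<in>nset (exp u). g k * (u - ln (real k)))"
        by (simp_all add: MR_def summ_def TR_def g_def)
      then show ?thesis by (simp only: sum_subtractf sum_distrib_left sum_distrib_right)
    qed
    also have "\<dots> = (\<Sum>k\<in>nset (exp u). g k * ln (real k) - (g k * (u - ln (real k))) / 2)"
    proof (rule sum.cong[OF refl])
      fix k
      have "g k * u = g k * (u - ln (real k)) + g k * ln (real k)" by (simp add: algebra_simps)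
      then show "g k * u - 3 / 2 * (g k * (u - ln (real k))) = g k * ln (real k) - (g k * (u - ln (real k))) / 2"
        by linarith
    qed
    also have "\<dots> = (\<Sum>k\<in>nset (exp u). g k * L k - (g k * (u - ln (real k))) / 2)"
      unfolding sum_subtractf 1 ..
    also have "\<bar>\<dots>\<bar> \<le> (\<Sum>k\<in>nset (exp u). D * g k)"
    proof (rule order_trans[OF sum_abs], rule sum_mono)
      fix k assume k: "k \<in> nset (exp u)"
      then have k1: "real k \<ge> 1" "real k \<le> exp u" by (auto simp: nset_def)
      have "ln (exp u / real k) = u - ln (real k)" using k1 by (subst ln_divide_pos) auto
      then have "\<bar>L k - (u - ln (real k)) / 2\<bar> \<le> D" using D(2)[of "exp u / real k"] k1 by (simp add: L_def)
      then have "g k * \<bar>L k - (u - ln (real k)) / 2\<bar> \<le> g k * D" using g by (intro mult_left_mono)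
      moreover have "\<bar>g k * L k - (g k * (u - ln (real k))) / 2\<bar> = g k * \<bar>L k - (u - ln (real k)) / 2\<bar>"
      proof -
        have "g k * L k - (g k * (u - ln (real k))) / 2 = g k * (L k - (u - ln (real k)) / 2)"
          by (simp only: right_diff_distrib times_divide_eq_right)
        then show ?thesis using g[of k] by (simp only: abs_mult abs_of_nonneg)
      qed
      ultimately show "\<bar>g k * L k - (g k * (u - ln (real k))) / 2\<bar> \<le> D * g k" by (simp add: mult.commute)
    qed
    also have "\<dots> = D * MR (exp u)" by (simp add: MR_def summ_def g_def sum_distrib_left)
    finally show ?thesis .
  qed
  then show ?thesis using D(1) by blast
qed

lemma TR_eq:
  assumes "u \<le> b"
  shows "TR u = (\<Sum>k\<in>nset (exp b). indR k / real k * max 0 (u - ln (real k)))"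
    and "MR (exp u) = (\<Sum>k\<in>nset (exp b). indR k / real k * (if ln (real k) \<le> u then 1 else 0))"
proof -
  have iff: "ln (real k) \<le> u \<longleftrightarrow> k \<in> nset (exp u)" if "k \<in> nset (exp b)" for k
  proof -
    have "real k > 0" "k \<ge> 1" using that by (auto simp: nset_def)
    have "ln (real k) \<le> u \<longleftrightarrow> exp (ln (real k)) \<le> exp u" by (rule exp_le_cancel_iff[symmetric])
    also have "exp (ln (real k)) = real k" using \<open>real k > 0\<close> by (rule exp_ln)
    finally show ?thesis using \<open>k \<ge> 1\<close> by (simp only: nset_def mem_Collect_eq True_implies_equals conj_absorb simp_thms)
  qed
  have sub: "nset (exp u) \<subseteq> nset (exp b)"
  proof
    fix k assume "k \<in> nset (exp u)"
    moreover have "exp u \<le> exp b" using assms by simp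
    ultimately show "k \<in> nset (exp b)" unfolding nset_def by (auto intro: order_trans)
  qed
  show "TR u = (\<Sum>k\<in>nset (exp b). indR k / real k * max 0 (u - ln (real k)))"
    unfolding TR_def
  proof (rule sum.mono_neutral_cong_left)
    show "\<forall>k\<in>nset (exp b) - nset (exp u). indR k / real k * max 0 (u - ln (real k)) = 0"
    proof
      fix k assume "k \<in> nset (exp b) - nset (exp u)"
      then have "\<not> ln (real k) \<le> u" using iff by blast
      then show "indR k / real k * max 0 (u - ln (real k)) = 0" by simp
    qed
    fix k assume "k \<in> nset (exp u)"
    then have "ln (real k) \<le> u" using iff sub by blast
    then show "indR k / real k * (u - ln (real k)) = indR k / real k * max 0 (u - ln (real k))" by simp
  qed (use sub in auto)
  show "MR (exp u) = (\<Sum>k\<in>nset (exp b). indR k / real k * (if ln (real k) \<le> u then 1 else 0))"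
    unfolding MR_def summ_def
  proof (rule sum.mono_neutral_cong_left)
    show "\<forall>k\<in>nset (exp b) - nset (exp u). indR k / real k * (if ln (real k) \<le> u then 1 else 0) = 0"
      using iff by auto
    show "indR k / real k = indR k / real k * (if ln (real k) \<le> u then 1 else 0)" if "k \<in> nset (exp u)" for k
      using iff sub that by auto
  qed (use sub in auto)
qed

lemma TR_limit: "\<exists>l K. \<forall>u\<ge>1. \<bar>TR u * u powr (- 3/2) - l\<bar> \<le> K / u"
proof -
  obtain D where D: "D > 0" "\<And>u. u \<ge> 0 \<Longrightarrow> \<bar>MR (exp u) * u - 3 / 2 * TR u\<bar> \<le> D * MR (exp u)"
    using MR_TR by blast
  obtain C where C: "C > 0" "\<And>x. x \<ge> 1 \<Longrightarrow> MR x \<le> C * sqrt (1 + ln x)"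
    using MR_bound by blast
  define K where "K = D * (C * sqrt 2)"
  have K: "K > 0" using D C by (simp add: K_def)
  define phi where "phi = (\<lambda>u. TR u * u powr (- 3/2))"
  define phi' where "phi' = (\<lambda>u. MR (exp u) * u powr (- 3/2) + - 3/2 * u powr (- 3/2 - 1) * TR u)"
  have phi'_bound: "\<bar>phi' u\<bar> \<le> K * u powr (- 2)" if u: "u \<ge> 1" for u
  proof -
    have "u powr (- 3/2) = u * u powr (- 5/2)" using u powr_add[of u 1 "- 5/2"] by simp
    then have "phi' u = (MR (exp u) * u - 3/2 * TR u) * u powr (- 5/2)" by (simp add: phi'_def algebra_simps)
    then have "\<bar>phi' u\<bar> = \<bar>MR (exp u) * u - 3/2 * TR u\<bar> * u powr (- 5/2)" by (simp add: abs_mult)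
    also have "\<dots> \<le> D * MR (exp u) * u powr (- 5/2)" using D(2)[of u] u by (intro mult_right_mono) auto
    also have "MR (exp u) \<le> C * (sqrt 2 * u powr (1/2))"
    proof -
      have "MR (exp u) \<le> C * sqrt (1 + u)" using C(2)[of "exp u"] u by simp
      also have "sqrt (1 + u) \<le> sqrt (2 * u)" using u by simp
      also have "sqrt (2 * u) = sqrt 2 * u powr (1/2)" using u by (simp add: real_sqrt_mult powr_half_sqrt)
      finally show ?thesis using C(1) by simp
    qed
    then have "D * MR (exp u) * u powr (- 5/2) \<le> D * (C * (sqrt 2 * u powr (1/2))) * u powr (- 5/2)"
      using D(1) by (intro mult_right_mono mult_left_mono) auto
    also have "\<dots> = K * (u powr (1/2) * u powr (- 5/2))" by (simp add: K_def)
    also have "u powr (1/2) * u powr (- 5/2) = u powr (- 2)" by (simp flip: powr_add)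
    finally show ?thesis .
  qed
  have diff: "\<bar>phi b - phi a\<bar> \<le> K / a - K / b" if ab: "1 \<le> a" "a \<le> b" for a b
  proof -
    define S where "S = (\<lambda>k. ln (real k)) ` nset (exp b)"
    have "finite S" by (simp add: S_def)
    then have I: "(phi' has_integral phi b - phi a) {a..b}"
    proof (rule fundamental_theorem_of_calculus_interior_strong)
      show "a \<le> b" by fact
      show "continuous_on {a..b} phi"
      proof -
        have "continuous_on {a..b} (\<lambda>u. (\<Sum>k\<in>nset (exp b). indR k / real k * max 0 (u - ln (real k))) * u powr (- 3/2))"
          using ab by (intro continuous_intros) auto
        then show ?thesis by (rule continuous_on_cong[THEN iffD1, rotated -1]) (auto simp: phi_def TR_eq(1)[of _ b])
      qed
      fix u assume u: "u \<in> {a<..<b} - S"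
      have u0: "u > 0" using u ab by auto
      have d1: "((\<lambda>u. max 0 (u - ln (real k))) has_real_derivative (if ln (real k) \<le> u then 1 else 0)) (at u)"
        if k: "k \<in> nset (exp b)" for k
      proof (cases "ln (real k) < u")
        case True
        have "((\<lambda>u. u - ln (real k)) has_real_derivative 1) (at u)" by (auto intro!: derivative_eq_intros)
        then have "((\<lambda>u. max 0 (u - ln (real k))) has_real_derivative 1) (at u)"
          by (rule has_field_derivative_transform_within_open[of _ _ _ "{ln (real k)<..}"]) (use True in auto)
        then show ?thesis using True by simp
      next
        case False
        moreover have "ln (real k) \<noteq> u" using u k by (auto simp: S_def)
        ultimately have gt: "ln (real k) > u" by simp
        have "((\<lambda>u :: real. 0) has_real_derivative 0) (at u)" by simp
        then have "((\<lambda>u. max 0 (u - ln (real k))) has_real_derivative 0) (at u)"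
          by (rule has_field_derivative_transform_within_open[of _ _ _ "{..<ln (real k)}"]) (use gt in auto)
        then show ?thesis using gt by simp
      qed
      have "((\<lambda>u. \<Sum>k\<in>nset (exp b). indR k / real k * max 0 (u - ln (real k))) has_real_derivative
          (\<Sum>k\<in>nset (exp b). indR k / real k * (if ln (real k) \<le> u then 1 else 0))) (at u)"
        by (intro DERIV_sum DERIV_cmult d1)
      then have "(TR has_real_derivative (\<Sum>k\<in>nset (exp b). indR k / real k * (if ln (real k) \<le> u then 1 else 0))) (at u)"
        by (rule has_field_derivative_transform_within_open[of _ _ _ "{a<..<b}"]) (use u in \<open>auto simp: TR_eq(1)[of _ b]\<close>)
      then have dT: "(TR has_real_derivative MR (exp u)) (at u)" using u by (simp add: TR_eq(2)[of u b])
      have dp: "((\<lambda>u. u powr (- 3/2)) has_real_derivative - 3/2 * u powr (- 3/2 - 1)) (at u)"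
        using has_real_derivative_powr[OF u0, of "- 3/2"] by simp
      have "(phi has_real_derivative phi' u) (at u)"
        unfolding phi_def phi'_def by (rule DERIV_mult[OF dT dp])
      then show "(phi has_vector_derivative phi' u) (at u)" by (simp add: has_real_derivative_iff_has_vector_derivative)
    qed
    have J: "((\<lambda>u. K * u powr (- 2)) has_integral (- K / b - (- K / a))) {a..b}"
    proof (rule fundamental_theorem_of_calculus)
      show "a \<le> b" by fact
      fix u assume u: "u \<in> {a..b}"
      have "((\<lambda>u. - K / u) has_real_derivative K * u powr (- 2)) (at u)"
        using u ab by (auto intro!: derivative_eq_intros simp: powr_minus powr_numeral power2_eq_square field_simps)
      then show "((\<lambda>u. - K / u) has_vector_derivative K * u powr (- 2)) (at u within {a..b})"
        by (simp add: has_real_derivative_iff_has_vector_derivative has_vector_derivative_at_within)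
    qed
    have le: "phi' u \<le> K * u powr (- 2)" "- phi' u \<le> K * u powr (- 2)" if "u \<in> {a..b}" for u
      using phi'_bound[of u] ab that by (auto simp: abs_le_iff)
    have "phi b - phi a \<le> - K / b - (- K / a)"
      by (rule has_integral_le[OF I J]) (rule le)
    moreover have "- (phi b - phi a) \<le> - K / b - (- K / a)"
      by (rule has_integral_le[OF has_integral_neg[OF I] J]) (rule le)
    ultimately show ?thesis by (simp add: abs_le_iff)
  qed
  have "Cauchy (\<lambda>n. phi (real (Suc n)))"
  proof (rule metric_CauchyI)
    fix e :: real assume e: "e > 0"
    obtain N where N: "K / e < real N" using reals_Archimedean2 by blast
    have small: "\<bar>phi (real (Suc m)) - phi (real (Suc n))\<bar> < e" if "N \<le> n" "n \<le> m" for m n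
    proof -
      have "\<bar>phi (real (Suc m)) - phi (real (Suc n))\<bar> \<le> K / real (Suc n) - K / real (Suc m)" using that by (intro diff) auto
      also have "\<dots> \<le> K / real (Suc n)" using K by simp
      also have "\<dots> < e"
      proof -
        have "K / e < real (Suc n)" using N that by linarith
        then show ?thesis using e by (simp add: divide_less_eq mult.commute)
      qed
      finally show ?thesis .
    qed
    show "\<exists>M. \<forall>m\<ge>M. \<forall>n\<ge>M. dist (phi (real (Suc m))) (phi (real (Suc n))) < e"
    proof (intro exI[of _ N] allI impI)
      fix m n assume "m \<ge> N" "n \<ge> N"
      then show "dist (phi (real (Suc m))) (phi (real (Suc n))) < e"
        using small[of n m] small[of m n] by (cases "n \<le> m") (auto simp: dist_real_def abs_minus_commute)
    qed
  qed
  then obtain l where l: "(\<lambda>n. phi (real (Suc n))) \<longlonglongrightarrow> l" using Cauchy_convergent_iff convergent_def by blast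
  have "\<bar>phi u - l\<bar> \<le> K / u" if u: "u \<ge> 1" for u
  proof -
    have "(\<lambda>n. \<bar>phi (real (Suc n)) - phi u\<bar>) \<longlonglongrightarrow> \<bar>l - phi u\<bar>" by (intro tendsto_intros l)
    moreover have "\<forall>\<^sub>F n in sequentially. \<bar>phi (real (Suc n)) - phi u\<bar> \<le> K / u"
      using eventually_ge_at_top[of "nat \<lceil>u\<rceil>"]
    proof eventually_elim
      case (elim n)
      have "u \<le> real (nat \<lceil>u\<rceil>)" by (rule real_nat_ceiling_ge)
      then have un: "u \<le> real (Suc n)" using elim by linarith
      have "\<bar>phi (real (Suc n)) - phi u\<bar> \<le> K / u - K / real (Suc n)" by (rule diff[OF u un])
      also have "\<dots> \<le> K / u" using K by simp
      finally show ?case .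
    qed
    ultimately have "\<bar>l - phi u\<bar> \<le> K / u" by (rule tendsto_upperbound) simp
    then show ?thesis by (simp add: abs_minus_commute)
  qed
  then show ?thesis unfolding phi_def by blast
qed

lemma MR_asymp_ex: "\<exists>c K. K > 0 \<and> c \<ge> 0 \<and> (\<forall>u\<ge>1. \<bar>MR (exp u) - c * sqrt u\<bar> \<le> K / sqrt u)"
proof -
  obtain D where D: "D > 0" "\<And>u. u \<ge> 0 \<Longrightarrow> \<bar>MR (exp u) * u - 3 / 2 * TR u\<bar> \<le> D * MR (exp u)"
    using MR_TR by blast
  obtain C where C: "C > 0" "\<And>x. x \<ge> 1 \<Longrightarrow> MR x \<le> C * sqrt (1 + ln x)"
    using MR_bound by blast
  obtain l K where l: "\<And>u. u \<ge> 1 \<Longrightarrow> \<bar>TR u * u powr (- 3/2) - l\<bar> \<le> K / u"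
    using TR_limit by blast
  have K0: "K \<ge> 0" using l[of 1] by linarith
  define c where "c = 3 / 2 * l"
  define K2 where "K2 = 3 / 2 * K + D * (C * sqrt 2)"
  have K2: "K2 > 0" using K0 D C by (simp add: K2_def add_nonneg_pos)
  have bd: "\<bar>MR (exp u) - c * sqrt u\<bar> \<le> K2 / sqrt u" if u: "u \<ge> 1" for u
  proof -
    define p where "p = TR u * u powr (- 3/2)"
    have su: "sqrt u > 0" "sqrt u * sqrt u = u" using u by auto
    have "u powr (3/2) = u * sqrt u" using u powr_add[of u 1 "1/2"] by (simp add: powr_half_sqrt)
    moreover have "u powr (- 3/2) * u powr (3/2) = 1" using u by (simp flip: powr_add)
    ultimately have "TR u = p * (u * sqrt u)" unfolding p_def by (metis mult.assoc mult.right_neutral)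
    have "MR (exp u) \<le> C * sqrt (1 + u)" using C(2)[of "exp u"] u by simp
    also have "sqrt (1 + u) \<le> sqrt (2 * u)" using u by simp
    finally have M: "MR (exp u) \<le> C * (sqrt 2 * sqrt u)" using C(1) by (simp add: real_sqrt_mult)
    have "\<bar>MR (exp u) * u - 3/2 * (p * (u * sqrt u))\<bar> \<le> D * (C * (sqrt 2 * sqrt u))"
      using order_trans[OF D(2)[of u, unfolded \<open>TR u = p * (u * sqrt u)\<close>] mult_left_mono[OF M]] u D(1) by linarith
    moreover have "MR (exp u) * u - 3/2 * (p * (u * sqrt u)) = u * (MR (exp u) - 3/2 * p * sqrt u)" by (simp add: algebra_simps)
    ultimately have "u * \<bar>MR (exp u) - 3/2 * p * sqrt u\<bar> \<le> D * (C * (sqrt 2 * sqrt u))" using u by (simp add: abs_mult)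
    then have "sqrt u * (sqrt u * \<bar>MR (exp u) - 3/2 * p * sqrt u\<bar>) \<le> sqrt u * (D * (C * sqrt 2))"
      using su by (simp add: mult.assoc[symmetric]) (simp add: mult_ac)
    then have "sqrt u * \<bar>MR (exp u) - 3/2 * p * sqrt u\<bar> \<le> D * (C * sqrt 2)" using su by simp
    then have 1: "\<bar>MR (exp u) - 3/2 * p * sqrt u\<bar> \<le> D * (C * sqrt 2) / sqrt u" using su by (simp add: pos_le_divide_eq mult.commute)
    have "\<bar>p - l\<bar> * sqrt u \<le> K / u * sqrt u" using l[OF u] su by (intro mult_right_mono) (auto simp: p_def)
    also have "K / u * sqrt u = K / sqrt u" using su by (metis (no_types, lifting) divide_divide_eq_left nonzero_mult_div_cancel_right order_less_irrefl times_divide_eq_left divide_divide_eq_right)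
    finally have z: "\<bar>(p - l) * sqrt u\<bar> \<le> K / sqrt u" using su by (simp add: abs_mult)
    have "3/2 * p * sqrt u - c * sqrt u = 3/2 * ((p - l) * sqrt u)" by (simp add: c_def algebra_simps)
    then have "\<bar>3/2 * p * sqrt u - c * sqrt u\<bar> = 3/2 * \<bar>(p - l) * sqrt u\<bar>" by (simp only: abs_mult[of "3/2"])
    with z have 2: "\<bar>3/2 * p * sqrt u - c * sqrt u\<bar> \<le> 3/2 * (K / sqrt u)" by linarith
    have "\<bar>MR (exp u) - c * sqrt u\<bar> \<le> D * (C * sqrt 2) / sqrt u + 3/2 * (K / sqrt u)" using 1 2 by linarith
    then show ?thesis by (simp add: K2_def add_divide_distrib)
  qed
  have "c \<ge> 0"
  proof (rule ccontr)
    assume "\<not> c \<ge> 0"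
    then have c: "c < 0" by simp
    define u where "u = 1 + K2 / (- c)"
    have "K2 / (- c) > 0" using K2 c by (intro divide_pos_pos) auto
    then have u: "u \<ge> 1" "u > K2 / (- c)" by (auto simp: u_def)
    have "- c * u > K2" using u(2) c by (simp add: field_simps)
    moreover have "- c * sqrt u \<le> K2 / sqrt u" using bd[OF u(1)] MR_nonneg[of "exp u"] by linarith
    then have "- c * sqrt u * sqrt u \<le> K2" using u by (simp add: pos_le_divide_eq)
    then have "- c * (sqrt u * sqrt u) \<le> K2" by (simp only: mult.assoc)
    ultimately show False using u by simp
  qed
  then show ?thesis using K2 bd by blast
qed

lemma gamma_laplace:
  fixes x w :: real
  assumes x: "x > 0" and w: "w > 0"
  shows "has_bochner_integral lborel (\<lambda>v. indicator {0..} v * (v powr (x - 1) * exp (- (w * v)))) (Gamma x * w powr (- x))"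
proof -
  define f where "f = (\<lambda>t :: real. indicator {0..} t * (t powr (x - 1) * exp (- t)))"
  have fm: "f \<in> borel_measurable borel" unfolding f_def by measurable
  have "((\<lambda>t. if t \<in> {0..} then t powr (x - 1) / exp t else 0) has_integral Gamma x) UNIV"
    using Gamma_integral_real[OF x] by (simp only: has_integral_restrict_UNIV)
  also have "(\<lambda>t. if t \<in> {0..} then t powr (x - 1) / exp t else 0) = f"
    by (auto simp: f_def exp_minus divide_inverse indicator_def)
  finally have fI: "(f has_integral Gamma x) UNIV" .
  have "integral\<^sup>N lborel (\<lambda>t. ennreal (f t)) = ennreal (Gamma x)"
    using nn_integral_has_integral_lborel[OF fm _ fI] by (simp add: f_def)
  then have "has_bochner_integral lborel f (Gamma x)"
    using fm x by (intro has_bochner_integral_nn_integral) (auto simp: f_def Gamma_real_pos less_imp_le)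
  then have "has_bochner_integral lborel (\<lambda>v. f (0 + w * v)) (Gamma x /\<^sub>R \<bar>w\<bar>)"
    using w lborel_has_bochner_integral_real_affine_iff[of w f "Gamma x" 0] by simp
  then have "has_bochner_integral lborel (\<lambda>v. w powr (1 - x) * f (0 + w * v)) (w powr (1 - x) * (Gamma x /\<^sub>R \<bar>w\<bar>))"
    by (rule has_bochner_integral_mult_right)
  moreover have "w powr (1 - x) * f (0 + w * v) = indicator {0..} v * (v powr (x - 1) * exp (- (w * v)))" for v
  proof (cases "v \<ge> 0")
    case True
    have "(w * v) powr (x - 1) = w powr (x - 1) * v powr (x - 1)" by (rule powr_mult)
    moreover have "w powr (1 - x) * w powr (x - 1) = 1" using w by (simp flip: powr_add)
    ultimately have "w powr (1 - x) * (w * v) powr (x - 1) = v powr (x - 1)" by (simp add: mult.assoc[symmetric])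
    then show ?thesis using True w by (simp add: f_def mult.assoc[symmetric])
  next
    case False
    then have "\<not> w * v \<ge> 0" using w by (simp add: zero_le_mult_iff)
    then show ?thesis using False by (simp add: f_def)
  qed
  moreover have "w powr (1 - x) * (Gamma x /\<^sub>R \<bar>w\<bar>) = Gamma x * w powr (- x)"
    using w by (simp add: powr_diff powr_minus divide_inverse)
  ultimately show ?thesis by (simp only:)
qed

lemma MR_laplace:
  assumes w: "w > 0"
  shows "has_bochner_integral lborel (\<lambda>v. indicator {0..} v * (MR (exp v) * exp (- (w * v)))) (rser indR (1 + w) / w)"
proof -
  define a where "a = (\<lambda>n. indR n / real n)"
  have p: "a n * real n powr (- w) = indR n * real n powr (- (1 + w))" for n
  proof (cases "n = 0")
    case False
    have 1: "real n powr (- (1 + w)) = real n powr (- 1) * real n powr (- w)"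
      using powr_add[of "real n" "- 1" "- w"] by (simp only: minus_add_distrib)
    have 2: "real n powr (- 1) = 1 / real n" using False by (simp add: powr_minus divide_inverse)
    show ?thesis unfolding a_def 1 2 by simp
  qed (simp add: a_def)
  have "abs_conv indR (1 + w)" using w by (intro abs_conv_indR) auto
  then have ac: "abs_conv a w" using p indR_nonneg by (simp add: abs_conv_def a_def)
  have r: "rser a w = rser indR (1 + w)" unfolding rser_def p ..
  have z: "Re (of_real w) > 0" "abs_conv a (Re (of_real w))" using w ac by auto
  have e: "of_real (indicator {0..} v * summ a (exp v)) * exp (- (of_real w * of_real v)) = complex_of_real (indicator {0..} v * (MR (exp v) * exp (- (w * v))))" for v
    by (simp add: MR_def a_def exp_of_real[symmetric])
  have I: "integrable lborel (\<lambda>v. complex_of_real (indicator {0..} v * (MR (exp v) * exp (- (w * v)))))"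
    using dser_laplace(1)[OF z] unfolding e .
  have "(\<integral>v. complex_of_real (indicator {0..} v * (MR (exp v) * exp (- (w * v)))) \<partial>lborel) = of_real (rser indR (1 + w) / w)"
    using dser_laplace(2)[OF z] dser_of_real[OF ac] unfolding e r by simp
  then have "complex_of_real (\<integral>v. indicator {0..} v * (MR (exp v) * exp (- (w * v))) \<partial>lborel) = of_real (rser indR (1 + w) / w)"
    unfolding integral_complex_of_real .
  then have "(\<integral>v. indicator {0..} v * (MR (exp v) * exp (- (w * v))) \<partial>lborel) = rser indR (1 + w) / w"
    by (simp only: of_real_eq_iff)
  moreover have "integrable lborel (\<lambda>v. indicator {0..} v * (MR (exp v) * exp (- (w * v))))"
    using I by (simp only: complex_of_real_integrable_eq)
  ultimately show ?thesis by (simp add: has_bochner_integral_iff)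
qed

definition PR :: real where "PR = (\<Prod>p. euler_factor p)"

lemma PR_ge_1: "PR \<ge> 1"
  unfolding PR_def
proof (rule prodinf_nonneg)
  have "convergent_prod euler_factor"
    using abs_convergent_prod_euler_factor by (rule abs_convergent_prod_imp_convergent_prod)
  then show "euler_factor has_prod (\<Prod>p. euler_factor p)" by (rule convergent_prod_has_prod)
  show "1 \<le> euler_factor p" for p
  proof (cases "prime p \<and> [p = 3] (mod 4)")
    case True
    then have "real p > 1" using prime_gt_1_nat by simp
    then have "1 / (real p)\<^sup>2 < 1" "0 \<le> 1 / (real p)\<^sup>2" by (simp_all add: one_less_power)
    then have "1 powr (- 1/2) \<le> (1 - 1 / (real p)\<^sup>2) powr (- 1/2)" by (intro powr_mono2') auto
    then show ?thesis using True by (simp add: euler_factor_def)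
  next
    case False
    then show ?thesis unfolding euler_factor_def by (subst if_not_P) simp_all
  qed
qed

lemma MR_asymp: "\<exists>K>0. \<forall>u\<ge>1. \<bar>MR (exp u) - sqrt 2 * PR * sqrt u\<bar> \<le> K / sqrt u"
proof -
  obtain c K where cK: "K > 0" "c \<ge> 0" "\<And>u. u \<ge> 1 \<Longrightarrow> \<bar>MR (exp u) - c * sqrt u\<bar> \<le> K / sqrt u"
    using MR_asymp_ex by blast
  define K3 where "K3 = K + MR (exp 1) + c"
  have K3: "K3 \<ge> 0" using cK MR_nonneg[of "exp 1"] by (simp add: K3_def)
  have bd: "\<bar>MR (exp v) - c * v powr (1/2)\<bar> \<le> K3 * v powr (- 1/2)" if v: "v > 0" for v
  proof (cases "v \<ge> 1")
    case True
    have "K / sqrt v = K * v powr (- 1/2)" using v by (simp add: powr_minus_divide powr_half_sqrt flip: minus_divide_left)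
    also have "\<dots> \<le> K3 * v powr (- 1/2)" using cK MR_nonneg[of "exp 1"] by (intro mult_right_mono) (auto simp: K3_def)
    finally show ?thesis using cK(3)[OF True] v by (simp add: powr_half_sqrt)
  next
    case False
    have "v powr (1/2) \<le> 1 powr (1/2)" using v False by (intro powr_mono2) auto
    then have "v powr (1/2) \<le> 1" by simp
    then have "c * v powr (1/2) \<le> c * 1" using cK by (intro mult_left_mono) auto
    moreover have "0 \<le> c * v powr (1/2)" using cK by simp
    moreover have "MR (exp v) \<le> MR (exp 1)" using False by (intro MR_mono) auto
    ultimately have "\<bar>MR (exp v) - c * v powr (1/2)\<bar> \<le> K3 * 1"
      using MR_nonneg[of "exp v"] cK(1,2) unfolding K3_def mult_1_right by linarith
    also have "\<dots> \<le> K3 * v powr (- 1/2)"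
    proof (rule mult_left_mono[OF _ K3])
      have "1 powr (- 1/2) \<le> v powr (- 1/2)" using v False by (intro powr_mono2') auto
      then show "1 \<le> v powr (- 1/2)" by simp
    qed
    finally show ?thesis .
  qed
  have main: "\<bar>rser indR (1 + w) / w - c * (Gamma (3/2) * w powr (- 3/2))\<bar> \<le> K3 * (Gamma (1/2) * w powr (- 1/2))" if w: "w > 0" for w
  proof -
    define f g h where "f = (\<lambda>v. indicator {0..} v * (MR (exp v) * exp (- (w * v))))"
      and "g = (\<lambda>v. indicator {0..} v * (v powr (1/2) * exp (- (w * v))) :: real)"
      and "h = (\<lambda>v. indicator {0..} v * (v powr (- 1/2) * exp (- (w * v))) :: real)"
    have f: "has_bochner_integral lborel f (rser indR (1 + w) / w)" unfolding f_def by (rule MR_laplace[OF w])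
    have g: "has_bochner_integral lborel g (Gamma (3/2) * w powr (- 3/2))"
      using gamma_laplace[of "3/2" w] w by (simp add: g_def)
    have h: "has_bochner_integral lborel h (Gamma (1/2) * w powr (- 1/2))"
      using gamma_laplace[of "1/2" w] w by (simp add: h_def)
    have d: "has_bochner_integral lborel (\<lambda>v. f v - c * g v) (rser indR (1 + w) / w - c * (Gamma (3/2) * w powr (- 3/2)))"
      by (intro has_bochner_integral_diff has_bochner_integral_mult_right f g)
    have H: "has_bochner_integral lborel (\<lambda>v. K3 * h v) (K3 * (Gamma (1/2) * w powr (- 1/2)))"
      by (intro has_bochner_integral_mult_right h)
    have di: "integrable lborel (\<lambda>v. f v - c * g v)" and dI: "(\<integral>v. f v - c * g v \<partial>lborel) = rser indR (1 + w) / w - c * (Gamma (3/2) * w powr (- 3/2))"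
      using d by (simp_all add: has_bochner_integral_iff)
    have Hi: "integrable lborel (\<lambda>v. K3 * h v)" and HI: "(\<integral>v. K3 * h v \<partial>lborel) = K3 * (Gamma (1/2) * w powr (- 1/2))"
      using H unfolding has_bochner_integral_iff by blast+
    have "norm (\<integral>v. f v - c * g v \<partial>lborel) \<le> (\<integral>v. norm (f v - c * g v) \<partial>lborel)" by (rule integral_norm_bound)
    also have "\<dots> \<le> (\<integral>v. K3 * h v \<partial>lborel)"
    proof (rule integral_mono_AE[OF integrable_norm[OF di] Hi])
      show "AE v in lborel. norm (f v - c * g v) \<le> K3 * h v"
        using AE_lborel_singleton[of "0 :: real"]
      proof eventually_elim
        case (elim v)
        show ?case
        proof (cases "v > 0")
          case True
          have "f v - c * g v = (MR (exp v) - c * v powr (1/2)) * exp (- (w * v))" using True by (simp add: f_def g_def algebra_simps)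
          then have "norm (f v - c * g v) = \<bar>MR (exp v) - c * v powr (1/2)\<bar> * exp (- (w * v))" by (simp add: abs_mult)
          also have "\<dots> \<le> K3 * v powr (- 1/2) * exp (- (w * v))" by (intro mult_right_mono bd[OF True]) auto
          finally show ?thesis using True by (simp add: h_def)
        next
          case False
          then have "v < 0" using elim by simp
          then show ?thesis by (simp add: f_def g_def h_def)
        qed
      qed
    qed
    finally show ?thesis unfolding dI HI by simp
  qed
  define G where "G = (Gamma (3/2) :: real)"
  have G: "G = sqrt pi / 2"
  proof -
    have "(1/2 :: real) \<notin> \<int>\<^sub>\<le>\<^sub>0" by (auto dest: nonpos_Ints_nonpos)
    then have "Gamma (1/2 + 1 :: real) = 1/2 * Gamma (1/2)" by (rule Gamma_plus1)
    then show ?thesis by (simp add: G_def Gamma_one_half_real)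
  qed
  have near: "\<bar>sqrt w * rser indR (1 + w) - c * G\<bar> \<le> K3 * sqrt pi * w" if w: "w > 0" for w
  proof -
    have 1: "w powr (3/2) * (rser indR (1 + w) / w) = sqrt w * rser indR (1 + w)"
    proof -
      have "w powr (3/2) = w * sqrt w" using w powr_add[of w 1 "1/2"] by (simp add: powr_half_sqrt)
      then show ?thesis using w by simp
    qed
    have 2: "w powr (3/2) * w powr (- 3/2) = 1" "w powr (3/2) * w powr (- 1/2) = w" using w by (simp_all flip: powr_add)
    have "w powr (3/2) * \<bar>rser indR (1 + w) / w - c * (G * w powr (- 3/2))\<bar> \<le> w powr (3/2) * (K3 * (sqrt pi * w powr (- 1/2)))"
      using main[OF w] by (intro mult_left_mono) (simp_all add: G_def Gamma_one_half_real)
    also have "w powr (3/2) * (K3 * (sqrt pi * w powr (- 1/2))) = K3 * sqrt pi * (w powr (3/2) * w powr (- 1/2))" by simp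
    also have "\<dots> = K3 * sqrt pi * w" unfolding 2 ..
    also have "w powr (3/2) * \<bar>rser indR (1 + w) / w - c * (G * w powr (- 3/2))\<bar> = \<bar>w powr (3/2) * (rser indR (1 + w) / w - c * (G * w powr (- 3/2)))\<bar>"
      by (simp add: abs_mult)
    also have "w powr (3/2) * (rser indR (1 + w) / w - c * (G * w powr (- 3/2))) = sqrt w * rser indR (1 + w) - c * G * (w powr (3/2) * w powr (- 3/2))"
      unfolding right_diff_distrib 1 by simp
    also have "\<dots> = sqrt w * rser indR (1 + w) - c * G" unfolding 2 by simp
    finally show ?thesis .
  qed
  have "((\<lambda>w. sqrt w * rser indR (1 + w) - c * G) \<longlongrightarrow> 0) (at_right 0)"
  proof (rule Lim_null_comparison)
    show "\<forall>\<^sub>F w in at_right 0. norm (sqrt w * rser indR (1 + w) - c * G) \<le> K3 * sqrt pi * w"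
      using eventually_at_right_less[of "0 :: real"] by eventually_elim (use near in simp)
    have "((\<lambda>w. K3 * sqrt pi * w) \<longlongrightarrow> K3 * sqrt pi * 0) (at_right 0)" by (intro tendsto_intros)
    then show "((\<lambda>w. K3 * sqrt pi * w) \<longlongrightarrow> 0) (at_right 0)" by simp
  qed
  then have "((\<lambda>w. sqrt w * rser indR (1 + w)) \<longlongrightarrow> c * G) (at_right 0)" by (simp add: LIM_zero_iff)
  then have "((\<lambda>w. (sqrt w * rser indR (1 + w))\<^sup>2) \<longlongrightarrow> (c * G)\<^sup>2) (at_right 0)" by (rule tendsto_power)
  moreover have "\<forall>\<^sub>F w in at_right 0. (sqrt w * rser indR (1 + w))\<^sup>2 = w * rser indR (1 + w) ^ 2"
    using eventually_at_right_less[of "0 :: real"] by eventually_elim (simp add: power_mult_distrib)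
  ultimately have "((\<lambda>w. w * rser indR (1 + w) ^ 2) \<longlongrightarrow> (c * G)\<^sup>2) (at_right 0)"
    by (rule Lim_transform_eventually)
  then have A: "(c * G)\<^sup>2 = pi / 2 * PR\<^sup>2"
    unfolding PR_def using rser_indR_limit tendsto_unique[OF trivial_limit_at_right_real] by blast
  have "(c * G)\<^sup>2 = c\<^sup>2 * (pi / 4)" by (simp add: G power_mult_distrib power_divide)
  moreover have "(sqrt 2 * PR)\<^sup>2 * (pi / 4) = pi / 2 * PR\<^sup>2" by (simp add: power_mult_distrib)
  ultimately have "c\<^sup>2 * (pi / 4) = (sqrt 2 * PR)\<^sup>2 * (pi / 4)" using A by (simp only:)
  then have "c\<^sup>2 = (sqrt 2 * PR)\<^sup>2" by simp
  then have c: "c = sqrt 2 * PR"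
    by (rule power2_eq_imp_eq) (use cK(2) PR_ge_1 in simp_all)
  show ?thesis using cK(1) cK(3)[unfolded c] by blast
qed

definition BR :: "real \<Rightarrow> real" where "BR x = summ indR x"

lemma BR_nonneg: "BR x \<ge> 0"
  unfolding BR_def using indR_nonneg by (intro summ_nonneg) auto

lemma BR_le: "x \<ge> 0 \<Longrightarrow> BR x \<le> x"
proof -
  assume x: "x \<ge> 0"
  have "BR x \<le> (\<Sum>n\<in>nset x. 1)" unfolding BR_def summ_def by (intro sum_mono indR_le_1)
  also have "\<dots> = real (nat \<lfloor>x\<rfloor>)" by (simp add: nset_eq)
  also have "\<dots> \<le> x" using x by (rule of_nat_floor)
  finally show ?thesis .
qed

lemma BR_ln:
  "BR x * ln x = (\<Sum>k\<in>nset x. indR k * summ lamR (x / real k)) + (\<Sum>k\<in>nset x. indR k * ln (x / real k))"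
proof -
  have "BR x * ln x = (\<Sum>k\<in>nset x. indR k * ln (real k) + indR k * ln (x / real k))"
    unfolding BR_def summ_def sum_distrib_right
  proof (rule sum.cong[OF refl])
    fix k assume "k \<in> nset x"
    then have "real k \<ge> 1" "real k \<le> x" by (auto simp: nset_def)
    then have "ln (x / real k) = ln x - ln (real k)" by (intro ln_divide_pos) auto
    then have "ln x = ln (real k) + ln (x / real k)" by linarith
    then show "indR k * ln x = indR k * ln (real k) + indR k * ln (x / real k)" by (simp only: distrib_left)
  qed
  also have "\<dots> = summ (dconv lamR indR) x + (\<Sum>k\<in>nset x. indR k * ln (x / real k))"
    unfolding sum.distrib summ_def indR_ln ..
  finally show ?thesis unfolding summ_dconv .
qed

lemma BR_bound: "\<exists>C>0. \<forall>x\<ge>1. BR x \<le> C * (x / sqrt (1 + ln x))"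
proof -
  obtain C where C: "C > 0" "\<And>x. x \<ge> 1 \<Longrightarrow> MR x \<le> C * sqrt (1 + ln x)"
    using MR_bound by blast
  have "BR x \<le> (9 * C + 1) * (x / sqrt (1 + ln x))" if x: "x \<ge> 1" for x
  proof -
    define s where "s = sqrt (1 + ln x)"
    have s: "s \<ge> 1" "s * s = 1 + ln x" using x by (auto simp: s_def)
    have "BR x * ln x \<le> (\<Sum>k\<in>nset x. indR k * (8 * (x / real k))) + (\<Sum>k\<in>nset x. indR k * (x / real k))"
      unfolding BR_ln
    proof (intro add_mono sum_mono mult_left_mono)
      fix k assume "k \<in> nset x"
      then have y: "x / real k > 0" using x by (auto simp: nset_def)
      then show "summ lamR (x / real k) \<le> 8 * (x / real k)" by (intro summ_lamR_le) simp
      show "ln (x / real k) \<le> x / real k" using ln_le_minus_one[OF y] by linarith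
    qed (rule indR_nonneg)+
    also have "\<dots> = 9 * x * MR x"
      unfolding MR_def summ_def sum_distrib_left sum.distrib[symmetric] by (intro sum.cong) auto
    also have "\<dots> \<le> 9 * x * (C * s)" using C(2)[OF x] x unfolding s_def by (intro mult_left_mono) auto
    finally have "BR x * ln x \<le> 9 * x * (C * s)" .
    moreover have "x * 1 \<le> x * s" using x s by (intro mult_left_mono) auto
    then have "BR x \<le> x * s" using BR_le[of x] x by linarith
    ultimately have "BR x * (1 + ln x) \<le> 9 * x * (C * s) + x * s" by (simp only: distrib_left)
    then have "(BR x * s) * s \<le> ((9 * C + 1) * x) * s" unfolding s(2)[symmetric] by (simp add: algebra_simps)
    then have "BR x * s \<le> (9 * C + 1) * x" using s by simp
    then show ?thesis using s by (simp add: s_def[symmetric] pos_le_divide_eq)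
  qed
  then show ?thesis using C(1) by (intro exI[of _ "9 * C + 1"]) auto
qed

text \<open>For \<open>k > sqrt x\<close> the weight \<open>y * wt y\<close> at \<open>y = x / k\<close> is majorised by a sum over \<open>j\<close>
  with \<open>exp j \<le> y\<close>; exchanging the sums brings in \<^term>\<open>BR (x * exp (- j))\<close>.\<close>

lemma weighted_sum_bound:
  "\<exists>C>0. \<forall>x\<ge>1. (\<Sum>k\<in>nset x. indR k * (x / real k * wt (x / real k))) \<le> C * (x / sqrt (1 + ln x))"
proof -
  obtain C1 where C1: "C1 > 0" "\<And>x. x \<ge> 1 \<Longrightarrow> MR x \<le> C1 * sqrt (1 + ln x)"
    using MR_bound by blast
  obtain C2 where C2: "C2 > 0" "\<And>x. x \<ge> 1 \<Longrightarrow> BR x \<le> C2 * (x / sqrt (1 + ln x))"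
    using BR_bound by blast
  have zs: "summable (\<lambda>j. (1 + real j) powr (- 5/4))"
  proof -
    have "summable (\<lambda>j. real (Suc j) powr (- 5/4))" by (subst summable_Suc_iff) (simp add: summable_real_powr_iff)
    then show ?thesis by (simp add: add.commute)
  qed
  define Z where "Z = (\<Sum>j. (1 + real j) powr (- 5/4))"
  have Z: "Z \<ge> 0" unfolding Z_def by (rule suminf_nonneg[OF zs]) simp
  have "(\<Sum>k\<in>nset x. indR k * (x / real k * wt (x / real k))) \<le> (4 * C1 + exp 1 * (C2 * sqrt 2) * Z) * (x / sqrt (1 + ln x))"
    if x: "x \<ge> 1" for x
  proof -
    define l where "l = 1 + ln x"
    have l: "l \<ge> 1" using x by (simp add: l_def)
    define S1 S2 where "S1 = {k \<in> nset x. real k \<le> sqrt x}" and "S2 = {k \<in> nset x. \<not> real k \<le> sqrt x}"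
    define t where "t = (\<lambda>k. indR k * (x / real k * wt (x / real k)))"
    have lnsq: "ln (sqrt x) = ln x / 2" using x by (simp add: ln_sqrt)
    have fin: "finite S1" "finite S2" by (simp_all add: S1_def S2_def)
    have split: "(\<Sum>k\<in>nset x. t k) = (\<Sum>k\<in>S1. t k) + (\<Sum>k\<in>S2. t k)"
      unfolding S1_def S2_def by (subst sum.union_disjoint[symmetric]) (auto intro!: sum.cong)
    have p: "2 powr (5/4) \<le> (4 :: real)" using powr_mono[of "5/4" 2 "2 :: real"] by simp
    have part1: "(\<Sum>k\<in>S1. t k) \<le> 4 * C1 * (x / sqrt l)"
    proof -
      have "(\<Sum>k\<in>S1. t k) \<le> (\<Sum>k\<in>S1. 4 * x * l powr (- 5/4) * (indR k / real k))"
      proof (rule sum_mono)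
        fix k assume k: "k \<in> S1"
        then have k1: "real k \<ge> 1" "real k \<le> sqrt x" by (auto simp: S1_def nset_def)
        have "ln (real k) \<le> ln (sqrt x)" using k1 x by (subst ln_le_cancel_iff) auto
        moreover have "ln (x / real k) = ln x - ln (real k)" using k1 x by (intro ln_divide_pos) auto
        ultimately have "l / 2 \<le> 1 + ln (x / real k)" unfolding lnsq by (simp add: l_def)
        then have "wt (x / real k) \<le> (l / 2) powr (- 5/4)" unfolding wt_def using l by (intro powr_mono2') auto
        also have "(l / 2) powr (- 5/4) = 2 powr (5/4) * l powr (- 5/4)" by (simp add: powr_divide powr_minus field_simps)
        also have "\<dots> \<le> 4 * l powr (- 5/4)" using p by (intro mult_right_mono) auto
        finally have "x * wt (x / real k) \<le> x * (4 * l powr (- 5/4))" using x by (intro mult_left_mono) auto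
        then have "(indR k / real k) * (x * wt (x / real k)) \<le> (indR k / real k) * (x * (4 * l powr (- 5/4)))"
          by (rule mult_left_mono) (use indR_nonneg in simp)
        then show "t k \<le> 4 * x * l powr (- 5/4) * (indR k / real k)" by (simp add: t_def mult_ac)
      qed
      also have "\<dots> = 4 * x * l powr (- 5/4) * (\<Sum>k\<in>S1. indR k / real k)" by (simp only: sum_distrib_left)
      also have "(\<Sum>k\<in>S1. indR k / real k) \<le> MR x"
        unfolding MR_def summ_def S1_def using indR_nonneg by (intro sum_mono2) auto
      also have "MR x \<le> C1 * sqrt l" unfolding l_def by (rule C1(2)[OF x])
      also have "4 * x * l powr (- 5/4) * (C1 * sqrt l) = 4 * C1 * x * (l powr (- 5/4) * l powr (1/2))"
        using l by (simp add: powr_half_sqrt)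
      also have "l powr (- 5/4) * l powr (1/2) = l powr (- 3/4)" by (simp flip: powr_add)
      also have "l powr (- 3/4) \<le> l powr (- 1/2)" using l by (intro powr_mono) auto
      also have "l powr (- 1/2) = 1 / sqrt l" using l by (simp add: powr_minus_divide powr_half_sqrt flip: minus_divide_left)
      finally show ?thesis using x C1(1) by (simp add: mult_left_mono)
    qed
    define J where "J = nat \<lfloor>ln x\<rfloor>"
    define a where "a = (\<lambda>j. exp (real j) * (1 + real j) powr (- 5/4))"
    have a0: "a j \<ge> 0" for j by (simp add: a_def)
    define I where "I = (\<lambda>j k. if real k \<le> x * exp (- real j) then 1 else 0 :: real)"
    have part2: "(\<Sum>k\<in>S2. t k) \<le> exp 1 * (C2 * sqrt 2) * Z * (x / sqrt l)"
    proof -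
      have "(\<Sum>k\<in>S2. t k) \<le> (\<Sum>k\<in>S2. \<Sum>j\<le>J. indR k * (exp 1 * (a j * I j k)))"
      proof (rule sum_mono)
        fix k assume k: "k \<in> S2"
        then have k1: "real k \<ge> 1" "real k \<le> x" by (auto simp: S2_def nset_def)
        define y where "y = x / real k"
        have y: "y \<ge> 1" "y \<le> x" using k1 x by (auto simp: y_def field_simps intro: mult_left_le)
        define j where "j = nat \<lfloor>ln y\<rfloor>"
        have ly: "ln y \<ge> 0" using y by simp
        have "real j = of_int \<lfloor>ln y\<rfloor>" using ly by (simp add: j_def)
        then have j: "real j \<le> ln y" "ln y \<le> real j + 1" by linarith+
        have jJ: "j \<le> J" unfolding j_def J_def using y by (intro nat_mono floor_mono) simp
        have ej: "exp (real j) \<le> y" using j(1) y by (metis exp_le_cancel_iff exp_ln less_le_trans zero_less_one)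
        have "y \<le> exp (real j + 1)" using j(2) y by (metis exp_le_cancel_iff exp_ln less_le_trans zero_less_one)
        then have "y * wt y \<le> exp (real j + 1) * (1 + real j) powr (- 5/4)"
          unfolding wt_def using j y by (intro mult_mono powr_mono2') auto
        also have "\<dots> = exp 1 * (a j * I j k)"
        proof -
          have "real k * exp (real j) \<le> x" using ej k1 by (simp add: y_def field_simps)
          then have "real k \<le> x * exp (- real j)" by (simp add: exp_minus field_simps)
          then show ?thesis by (simp add: a_def I_def exp_add)
        qed
        also have "\<dots> \<le> (\<Sum>j\<le>J. exp 1 * (a j * I j k))"
          using jJ a0 by (intro member_le_sum) (auto simp: I_def)
        finally have "indR k * (y * wt y) \<le> indR k * (\<Sum>j\<le>J. exp 1 * (a j * I j k))"
          using indR_nonneg by (intro mult_left_mono) auto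
        then show "t k \<le> (\<Sum>j\<le>J. indR k * (exp 1 * (a j * I j k)))" by (simp add: t_def y_def sum_distrib_left)
      qed
      also have "\<dots> = (\<Sum>j\<le>J. \<Sum>k\<in>S2. indR k * (exp 1 * (a j * I j k)))" by (rule sum.swap)
      also have "\<dots> = (\<Sum>j\<le>J. exp 1 * a j * (\<Sum>k\<in>S2. indR k * I j k))"
        by (simp add: sum_distrib_left mult_ac)
      also have "\<dots> \<le> (\<Sum>j\<le>J. exp 1 * a j * (C2 * sqrt 2 * (x * exp (- real j) / sqrt l)))"
      proof (intro sum_mono mult_left_mono)
        fix j
        define y where "y = x * exp (- real j)"
        have y0: "y > 0" using x by (simp add: y_def)
        show "(\<Sum>k\<in>S2. indR k * I j k) \<le> C2 * sqrt 2 * (x * exp (- real j) / sqrt l)"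
        proof (cases "y > sqrt x")
          case True
          have y1: "y \<ge> 1" using True x real_sqrt_ge_1_iff[of x] by linarith
          have "(\<Sum>k\<in>S2. indR k * I j k) = (\<Sum>k\<in>{k\<in>S2. real k \<le> y}. indR k)"
            using fin by (simp add: I_def y_def sum.inter_filter[symmetric] if_distrib cong: if_cong)
          also have "\<dots> \<le> BR y" unfolding BR_def summ_def
            using indR_nonneg by (intro sum_mono2) (auto simp: S2_def nset_def)
          also have "\<dots> \<le> C2 * (y / sqrt (1 + ln y))" by (rule C2(2)[OF y1])
          also have "\<dots> \<le> C2 * (y / sqrt (l / 2))"
          proof -
            have "ln (sqrt x) \<le> ln y" using True x y0 by (subst ln_le_cancel_iff) auto
            then have "l / 2 \<le> 1 + ln y" unfolding lnsq by (simp add: l_def)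
            then have "sqrt (l / 2) \<le> sqrt (1 + ln y)" by simp
            then show ?thesis using y0 l C2(1) by (intro mult_left_mono divide_left_mono mult_pos_pos) auto
          qed
          also have "\<dots> = C2 * sqrt 2 * (y / sqrt l)" by (simp add: real_sqrt_divide)
          finally show ?thesis by (simp add: y_def)
        next
          case False
          have "(\<Sum>k\<in>S2. indR k * I j k) = 0"
          proof (rule sum.neutral, rule ballI)
            fix k assume "k \<in> S2"
            then have "real k > sqrt x" by (simp add: S2_def)
            then show "indR k * I j k = 0" using False by (simp add: I_def y_def)
          qed
          then show ?thesis using C2(1) x l by simp
        qed
      qed (use a0 in simp)
      also have "\<dots> = (\<Sum>j\<le>J. exp 1 * (C2 * sqrt 2) * (x / sqrt l) * (1 + real j) powr (- 5/4))"
      proof (rule sum.cong[OF refl])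
        fix j
        have "exp (real j) * exp (- real j) = 1" by (simp flip: exp_add)
        have "exp 1 * a j * (C2 * sqrt 2 * (x * exp (- real j) / sqrt l)) = exp 1 * (C2 * sqrt 2) * (x / sqrt l) * (1 + real j) powr (- 5/4) * (exp (real j) * exp (- real j))"
          by (simp add: a_def mult_ac)
        then show "exp 1 * a j * (C2 * sqrt 2 * (x * exp (- real j) / sqrt l)) = exp 1 * (C2 * sqrt 2) * (x / sqrt l) * (1 + real j) powr (- 5/4)"
          unfolding \<open>exp (real j) * exp (- real j) = 1\<close> by simp
      qed
      also have "\<dots> = exp 1 * (C2 * sqrt 2) * (x / sqrt l) * (\<Sum>j\<le>J. (1 + real j) powr (- 5/4))" by (simp only: sum_distrib_left)
      also have "\<dots> \<le> exp 1 * (C2 * sqrt 2) * (x / sqrt l) * Z"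
      proof (rule mult_left_mono)
        show "(\<Sum>j\<le>J. (1 + real j) powr (- 5/4)) \<le> Z" unfolding Z_def by (rule sum_le_suminf[OF zs]) auto
      qed (use C2(1) x l in simp)
      finally show ?thesis by (simp only: mult_ac)
    qed
    have "(\<Sum>k\<in>nset x. t k) \<le> 4 * C1 * (x / sqrt l) + exp 1 * (C2 * sqrt 2) * Z * (x / sqrt l)"
      unfolding split by (rule add_mono[OF part1 part2])
    then show ?thesis by (simp only: t_def l_def distrib_right)
  qed
  moreover have "4 * C1 + exp 1 * (C2 * sqrt 2) * Z > 0" using C1(1) C2(1) Z by (intro add_pos_nonneg) auto
  ultimately show ?thesis by blast
qed

lemma BR_asymp: "\<exists>K>0. \<forall>x\<ge>exp 1. \<bar>BR x - PR / sqrt 2 * (x / sqrt (ln x))\<bar> \<le> K * (x / (ln x * sqrt (ln x)))"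
proof -
  obtain D where D: "D > 0" "\<And>x. x \<ge> 1 \<Longrightarrow> \<bar>summ lamR x - x / 2\<bar> \<le> D * (x * wt x)"
    using summ_lamR_asymp by blast
  obtain K1 where K1: "K1 > 0" "\<And>u. u \<ge> 1 \<Longrightarrow> \<bar>MR (exp u) - sqrt 2 * PR * sqrt u\<bar> \<le> K1 / sqrt u"
    using MR_asymp by blast
  obtain C where C: "C > 0" "\<And>x. x \<ge> 1 \<Longrightarrow> (\<Sum>k\<in>nset x. indR k * (x / real k * wt (x / real k))) \<le> C * (x / sqrt (1 + ln x))"
    using weighted_sum_bound by blast
  obtain K2 where K2: "K2 > 0" "\<And>x :: real. x \<ge> 1 \<Longrightarrow> (1 + ln x) powr (9/4) \<le> K2 * x powr 1"
    using one_plus_ln_powr_le[of "9/4" 1] by auto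
  have lw: "ln y \<le> K2 * (y * wt y)" if y: "y \<ge> 1" for y
  proof -
    have l: "1 + ln y > 0" using y ln_ge_zero[of y] by linarith
    have "ln y \<le> 1 + ln y" by simp
    also have "1 + ln y = (1 + ln y) powr (9/4) * wt y" unfolding wt_def using l by (simp flip: powr_add)
    also have "\<dots> \<le> K2 * y powr 1 * wt y" using K2(2)[OF y] wt_pos[OF y] by (intro mult_right_mono) auto
    finally show ?thesis using y by simp
  qed
  have "\<bar>BR x - PR / sqrt 2 * (x / sqrt (ln x))\<bar> \<le> (K1 / 2 + (D + K2) * C) * (x / (ln x * sqrt (ln x)))" if x: "x \<ge> exp 1" for x
  proof -
    have x0: "x \<ge> 1" using x exp_ge_add_one_self[of 1] by linarith
    define u where "u = ln x"
    have u: "u \<ge> 1" "exp u = x" using x x0 by (auto simp: u_def ln_ge_iff)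
    define R where "R = (\<Sum>k\<in>nset x. indR k * (x / real k * wt (x / real k)))"
    have yk: "x / real k \<ge> 1" if "k \<in> nset x" for k using that by (auto simp: nset_def)
    have "\<bar>(\<Sum>k\<in>nset x. indR k * summ lamR (x / real k)) - (\<Sum>k\<in>nset x. indR k * (x / real k / 2))\<bar> \<le> (\<Sum>k\<in>nset x. D * (indR k * (x / real k * wt (x / real k))))"
      unfolding sum_subtractf[symmetric]
    proof (rule order_trans[OF sum_abs], rule sum_mono)
      fix k assume k: "k \<in> nset x"
      have "\<bar>indR k * summ lamR (x / real k) - indR k * (x / real k / 2)\<bar> = indR k * \<bar>summ lamR (x / real k) - x / real k / 2\<bar>"
        using indR_nonneg[of k] by (simp only: right_diff_distrib[symmetric] abs_mult abs_of_nonneg)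
      also have "\<dots> \<le> indR k * (D * (x / real k * wt (x / real k)))" by (intro mult_left_mono D(2) yk k indR_nonneg)
      finally show "\<bar>indR k * summ lamR (x / real k) - indR k * (x / real k / 2)\<bar> \<le> D * (indR k * (x / real k * wt (x / real k)))" by (simp only: mult_ac)
    qed
    also have "\<dots> = D * R" by (simp only: R_def sum_distrib_left)
    finally have e1: "\<bar>(\<Sum>k\<in>nset x. indR k * summ lamR (x / real k)) - (\<Sum>k\<in>nset x. indR k * (x / real k / 2))\<bar> \<le> D * R" .
    have "(\<Sum>k\<in>nset x. indR k * (x / real k / 2)) = x / 2 * MR x"
      unfolding MR_def summ_def sum_distrib_left by (intro sum.cong) (auto simp: mult_ac)
    note e1 = e1[unfolded this]
    have "(\<Sum>k\<in>nset x. indR k * ln (x / real k)) \<le> (\<Sum>k\<in>nset x. K2 * (indR k * (x / real k * wt (x / real k))))"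
    proof (rule sum_mono)
      fix k assume k: "k \<in> nset x"
      have "indR k * ln (x / real k) \<le> indR k * (K2 * (x / real k * wt (x / real k)))" by (intro mult_left_mono lw yk k indR_nonneg)
      then show "indR k * ln (x / real k) \<le> K2 * (indR k * (x / real k * wt (x / real k)))" by (simp only: mult_ac)
    qed
    also have "\<dots> = K2 * R" by (simp only: R_def sum_distrib_left)
    finally have e2: "(\<Sum>k\<in>nset x. indR k * ln (x / real k)) \<le> K2 * R" .
    have e3: "(\<Sum>k\<in>nset x. indR k * ln (x / real k)) \<ge> 0"
      using yk indR_nonneg by (intro sum_nonneg mult_nonneg_nonneg ln_ge_zero) auto
    have "R \<le> C * (x / sqrt (1 + u))" unfolding R_def u_def by (rule C(2)[OF x0])
    also have "\<dots> \<le> C * (x / sqrt u)" using C(1) x0 u by (intro mult_left_mono divide_left_mono) auto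
    finally have R: "R \<le> C * (x / sqrt u)" .
    have "\<bar>BR x * u - x / 2 * MR x\<bar> \<le> D * R + K2 * R"
      unfolding u_def BR_ln using e1 e2 e3 by linarith
    also have "\<dots> = (D + K2) * R" by (simp only: distrib_right)
    also have "\<dots> \<le> (D + K2) * (C * (x / sqrt u))" using R D(1) K2(1) by (intro mult_left_mono) auto
    finally have f1: "\<bar>BR x * u - x / 2 * MR x\<bar> \<le> (D + K2) * C * (x / sqrt u)" by (simp only: mult.assoc)
    have m1: "x / 2 * \<bar>MR x - sqrt 2 * PR * sqrt u\<bar> \<le> x / 2 * (K1 / sqrt u)"
      using K1(2)[OF u(1)] x0 unfolding u(2) by (intro mult_left_mono) auto
    have m2: "\<bar>x / 2 * MR x - x / 2 * (sqrt 2 * PR * sqrt u)\<bar> = x / 2 * \<bar>MR x - sqrt 2 * PR * sqrt u\<bar>"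
      unfolding right_diff_distrib[symmetric] abs_mult using x0 by simp
    have m3: "x / 2 * (K1 / sqrt u) = K1 / 2 * (x / sqrt u)" by simp
    have f2: "\<bar>x / 2 * MR x - x / 2 * (sqrt 2 * PR * sqrt u)\<bar> \<le> K1 / 2 * (x / sqrt u)"
      using m1 unfolding m2 m3 .
    have su: "sqrt u * sqrt u = u" "sqrt u > 0" using u by auto
    have m: "x / 2 * (sqrt 2 * PR * sqrt u) = u * (PR / sqrt 2 * (x / sqrt u))"
    proof -
      have "sqrt 2 / 2 = 1 / sqrt (2 :: real)" by (simp add: real_div_sqrt field_simps)
      note A = this
      have B: "u * (x / sqrt u) = x * sqrt u" using su by (metis nonzero_mult_div_cancel_left less_irrefl mult.assoc mult.commute times_divide_eq_right)
      have "u * (PR / sqrt 2 * (x / sqrt u)) = PR * (1 / sqrt 2) * (u * (x / sqrt u))" by simp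
      also have "\<dots> = PR * (sqrt 2 / 2) * (x * sqrt u)" unfolding A B ..
      finally show ?thesis by simp
    qed
    have "\<bar>BR x * u - u * (PR / sqrt 2 * (x / sqrt u))\<bar> \<le> (D + K2) * C * (x / sqrt u) + K1 / 2 * (x / sqrt u)"
      using f1 f2 unfolding m by linarith
    moreover have "\<bar>BR x * u - u * (PR / sqrt 2 * (x / sqrt u))\<bar> = u * \<bar>BR x - PR / sqrt 2 * (x / sqrt u)\<bar>"
      unfolding mult.commute[of "BR x" u] right_diff_distrib[symmetric] abs_mult using u by simp
    ultimately have "u * \<bar>BR x - PR / sqrt 2 * (x / sqrt u)\<bar> \<le> (K1 / 2 + (D + K2) * C) * (x / sqrt u)" by (simp only: distrib_right)
    moreover have "A \<le> B / v" if "v * A \<le> B" "v > 0" for A B v :: real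
      using that by (simp add: pos_le_divide_eq mult.commute)
    ultimately have "\<bar>BR x - PR / sqrt 2 * (x / sqrt u)\<bar> \<le> (K1 / 2 + (D + K2) * C) * (x / sqrt u) / u"
      using u(1) by force
    also have "\<dots> = (K1 / 2 + (D + K2) * C) * (x / (u * sqrt u))"
      by (simp only: times_divide_eq_right divide_divide_eq_left mult.commute[of "sqrt u" u])
    finally show ?thesis by (simp only: u_def)
  qed
  moreover have "K1 / 2 + (D + K2) * C > 0" using K1(1) D(1) K2(1) C(1) by (intro add_pos_pos) auto
  ultimately show ?thesis by blast
qed

section \<open>The sum over the quarter disc\<close>

context
  fixes X :: real
  assumes X: "X > 0"
begin

definition circ :: "real \<Rightarrow> real" where
  "circ t = (t * sqrt (X\<^sup>2 - t\<^sup>2) + X\<^sup>2 * arcsin (t / X)) / 2"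

lemma circ_deriv:
  assumes t: "0 < t" "t < X"
  shows "(circ has_real_derivative sqrt (X\<^sup>2 - t\<^sup>2)) (at t)"
proof -
  define h where "h = sqrt (X\<^sup>2 - t\<^sup>2)"
  have "t\<^sup>2 < X\<^sup>2" using t by (intro power_strict_mono) auto
  then have h: "h > 0" "h\<^sup>2 = X\<^sup>2 - t\<^sup>2" by (auto simp: h_def)
  have sq: "sqrt (1 - (t / X)\<^sup>2) = h / X"
  proof -
    have "1 - (t / X)\<^sup>2 = (X\<^sup>2 - t\<^sup>2) / X\<^sup>2" using X by (simp add: power_divide diff_divide_distrib)
    then show ?thesis using X by (simp add: h_def real_sqrt_divide)
  qed
  have 1: "((\<lambda>t. sqrt (X\<^sup>2 - t\<^sup>2)) has_real_derivative - (t / h)) (at t)"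
    using \<open>t\<^sup>2 < X\<^sup>2\<close> by (auto intro!: derivative_eq_intros simp: h_def field_simps)
  have 2: "((\<lambda>t. arcsin (t / X)) has_real_derivative inverse (sqrt (1 - (t / X)\<^sup>2)) * (1 / X)) (at t)"
  proof (rule DERIV_chain2[OF DERIV_arcsin])
    have "0 < t / X" "t / X < 1" using t X by simp_all
    then show "- 1 < t / X" "t / X < 1" by linarith+
    show "((\<lambda>t. t / X) has_real_derivative 1 / X) (at t)" using X by (auto intro!: derivative_eq_intros)
  qed
  have "(circ has_real_derivative ((1 * sqrt (X\<^sup>2 - t\<^sup>2) + - (t / h) * t) + X\<^sup>2 * (inverse (sqrt (1 - (t / X)\<^sup>2)) * (1 / X))) / 2) (at t)"
    unfolding circ_def by (intro DERIV_cdivide DERIV_add DERIV_cmult DERIV_mult 1 2 DERIV_ident)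
  moreover have "((1 * sqrt (X\<^sup>2 - t\<^sup>2) + - (t / h) * t) + X\<^sup>2 * (inverse (sqrt (1 - (t / X)\<^sup>2)) * (1 / X))) / 2 = h"
  proof -
    have "X\<^sup>2 * (inverse (h / X) * (1 / X)) = X\<^sup>2 / h" using X h by (simp add: field_simps power2_eq_square)
    moreover have "h + - (t / h) * t + X\<^sup>2 / h = 2 * h" using h by (simp add: field_simps power2_eq_square)
    ultimately show ?thesis unfolding sq h_def[symmetric] by simp
  qed
  ultimately have "(circ has_real_derivative h) (at t)" by (simp only:)
  then show ?thesis by (simp add: h_def)
qed

lemma circ_bounds:
  assumes st: "0 \<le> s" "s \<le> t" "t \<le> X"
  shows "circ t - circ s \<le> (t - s) * sqrt (X\<^sup>2 - s\<^sup>2)" "(t - s) * sqrt (X\<^sup>2 - t\<^sup>2) \<le> circ t - circ s"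
proof -
  have "circ t - circ s \<le> (t - s) * sqrt (X\<^sup>2 - s\<^sup>2) \<and> (t - s) * sqrt (X\<^sup>2 - t\<^sup>2) \<le> circ t - circ s"
  proof (cases "s = t")
    case False
    then have lt: "s < t" using st by simp
    have cont: "continuous_on {s..t} circ"
      unfolding circ_def using X st
      by (intro continuous_intros) (auto simp: divide_le_eq le_divide_eq)
    obtain z where z: "s < z" "z < t" "circ t - circ s = sqrt (X\<^sup>2 - z\<^sup>2) * (t - s)"
    proof (rule mvt[OF lt cont])
      fix z assume "s < z" "z < t"
      then show "(circ has_derivative (\<lambda>u. sqrt (X\<^sup>2 - z\<^sup>2) * u)) (at z)"
        using circ_deriv[of z] st by (simp add: has_field_derivative_def)
    qed (use that in auto)
    have "sqrt (X\<^sup>2 - z\<^sup>2) \<le> sqrt (X\<^sup>2 - s\<^sup>2)" "sqrt (X\<^sup>2 - t\<^sup>2) \<le> sqrt (X\<^sup>2 - z\<^sup>2)"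
      using z st by (auto intro!: power_mono)
    then have "sqrt (X\<^sup>2 - z\<^sup>2) * (t - s) \<le> sqrt (X\<^sup>2 - s\<^sup>2) * (t - s)" "sqrt (X\<^sup>2 - t\<^sup>2) * (t - s) \<le> sqrt (X\<^sup>2 - z\<^sup>2) * (t - s)"
      using lt by (auto intro!: mult_right_mono)
    then show ?thesis using z(3) by (simp add: mult.commute)
  qed simp
  then show "circ t - circ s \<le> (t - s) * sqrt (X\<^sup>2 - s\<^sup>2)" "(t - s) * sqrt (X\<^sup>2 - t\<^sup>2) \<le> circ t - circ s" by auto
qed

lemma sum_sqrt_circle: "\<bar>(\<Sum>a\<le>nat \<lfloor>X\<rfloor>. sqrt (X\<^sup>2 - (real a)\<^sup>2)) - pi / 4 * X\<^sup>2\<bar> \<le> X"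
proof -
  define N where "N = nat \<lfloor>X\<rfloor>"
  define h where "h = (\<lambda>a. sqrt (X\<^sup>2 - (real a)\<^sup>2))"
  have "real N = of_int \<lfloor>X\<rfloor>" using X by (simp add: N_def)
  then have N: "real N \<le> X" "X \<le> real N + 1" by linarith+
  have low: "circ (real m) - circ 0 \<le> (\<Sum>a<m. h a)" if "m \<le> N" for m
    using that
  proof (induction m)
    case (Suc m)
    have "circ (real (Suc m)) - circ (real m) \<le> (real (Suc m) - real m) * h m"
      unfolding h_def using Suc.prems N by (intro circ_bounds(1)) auto
    then show ?case using Suc by simp
  qed simp
  have up: "(\<Sum>a\<le>m. h a) \<le> h 0 + (circ (real m) - circ 0)" if "m \<le> N" for m
    using that
  proof (induction m)
    case (Suc m)
    have "(real (Suc m) - real m) * h (Suc m) \<le> circ (real (Suc m)) - circ (real m)"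
      unfolding h_def using Suc.prems N by (intro circ_bounds(2)) auto
    then show ?case using Suc by simp
  qed simp
  have c0: "circ 0 = 0" by (simp add: circ_def)
  have cX: "circ X = pi / 4 * X\<^sup>2" using X by (simp add: circ_def)
  have hN: "h N \<ge> 0" using N by (auto simp: h_def intro!: power_mono)
  have "circ X - circ (real N) \<le> (X - real N) * h N" unfolding h_def using N by (intro circ_bounds(1)) auto
  also have "\<dots> \<le> 1 * h N" using N hN by (intro mult_right_mono) auto
  finally have 1: "circ X - circ (real N) \<le> h N" by simp
  have "(X - real N) * sqrt (X\<^sup>2 - X\<^sup>2) \<le> circ X - circ (real N)" using N by (intro circ_bounds(2)) auto
  then have 2: "circ (real N) \<le> circ X" by simp
  have "(\<Sum>a\<le>N. h a) = (\<Sum>a<N. h a) + h N" by (simp add: lessThan_Suc_atMost[symmetric])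
  then have "circ X \<le> (\<Sum>a\<le>N. h a)" using low[of N] 1 c0 by simp
  moreover have "(\<Sum>a\<le>N. h a) \<le> X + circ X" using up[of N] 2 c0 X by (simp add: h_def)
  ultimately show ?thesis using X unfolding cX by (simp add: h_def N_def abs_le_iff)
qed

end

lemma sum_r_R_eq:
  assumes x: "x \<ge> 0"
  shows "(\<Sum>n | n \<ge> 1 \<and> real n \<le> x. real (r_R n)) = (\<Sum>a\<le>nat \<lfloor>sqrt x\<rfloor>. BR (sqrt (x - (real a)\<^sup>2)))"
proof -
  define N where "N = nat \<lfloor>sqrt x\<rfloor>"
  define T where "T = {(a, b). b \<in> sums_of_two_squares \<and> real (a\<^sup>2 + b\<^sup>2) \<le> x}"
  have aN: "a \<le> N" if "real (a\<^sup>2) \<le> x" for a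
  proof -
    have "real a \<le> sqrt x" using that by (intro real_le_rsqrt) simp
    then show ?thesis unfolding N_def by (simp add: le_nat_floor)
  qed
  have TN: "T \<subseteq> {..N} \<times> {..N}"
  proof
    fix p assume "p \<in> T"
    then obtain a b where p: "p = (a, b)" "real (a\<^sup>2) + real (b\<^sup>2) \<le> x" by (auto simp: T_def)
    then have "real (a\<^sup>2) \<le> x" "real (b\<^sup>2) \<le> x" by (simp_all del: of_nat_power)
    then show "p \<in> {..N} \<times> {..N}" using aN p by auto
  qed
  then have finT: "finite T" by (rule finite_subset) simp
  have b1: "b \<ge> 1" if "b \<in> sums_of_two_squares" for b using that by (simp add: sums_of_two_squares_iff)
  have "(\<Sum>n | n \<ge> 1 \<and> real n \<le> x. real (r_R n)) = (\<Sum>n\<in>nset x. \<Sum>p\<in>{p \<in> T. (case p of (a, b) \<Rightarrow> a\<^sup>2 + b\<^sup>2) = n}. 1)"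
    unfolding nset_def
  proof (rule sum.cong[OF refl])
    fix n assume n: "n \<in> {n. 1 \<le> n \<and> real n \<le> x}"
    have "{p \<in> T. (case p of (a, b) \<Rightarrow> a\<^sup>2 + b\<^sup>2) = n} = {(a, b). b \<in> sums_of_two_squares \<and> a\<^sup>2 + b\<^sup>2 = n}"
      using n by (auto simp: T_def)
    then show "real (r_R n) = (\<Sum>p\<in>{p \<in> T. (case p of (a, b) \<Rightarrow> a\<^sup>2 + b\<^sup>2) = n}. 1)"
      by (simp add: r_R_def)
  qed
  also have "\<dots> = (\<Sum>p\<in>T. 1)"
  proof (rule sum.group[OF finT finite_nset])
    show "(\<lambda>p. case p of (a, b) \<Rightarrow> a\<^sup>2 + b\<^sup>2) ` T \<subseteq> nset x"
    proof
      fix n assume "n \<in> (\<lambda>p. case p of (a, b) \<Rightarrow> a\<^sup>2 + b\<^sup>2) ` T"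
      then obtain a b where ab: "b \<in> sums_of_two_squares" "real (a\<^sup>2 + b\<^sup>2) \<le> x" "n = a\<^sup>2 + b\<^sup>2" by (auto simp: T_def)
      have "1 \<le> b\<^sup>2" using b1[OF ab(1)] by simp
      then show "n \<in> nset x" using ab unfolding nset_def by simp
    qed
  qed
  also have "\<dots> = (\<Sum>a\<le>N. \<Sum>p\<in>{p \<in> T. fst p = a}. 1)"
    by (rule sum.group[symmetric, OF finT finite_atMost]) (use TN in auto)
  also have "\<dots> = (\<Sum>a\<le>N. BR (sqrt (x - (real a)\<^sup>2)))"
  proof (rule sum.cong[OF refl])
    fix a assume "a \<in> {..N}"
    define y where "y = sqrt (x - (real a)\<^sup>2)"
    have iff: "real (a\<^sup>2 + b\<^sup>2) \<le> x \<longleftrightarrow> real b \<le> y" for b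
    proof -
      have "real b \<le> y \<longleftrightarrow> (real b)\<^sup>2 \<le> x - (real a)\<^sup>2"
      proof
        assume "real b \<le> y"
        moreover have "y\<^sup>2 = x - (real a)\<^sup>2" if "y \<ge> 0"
          unfolding y_def using that y_def by simp
        ultimately show "(real b)\<^sup>2 \<le> x - (real a)\<^sup>2"
          by (metis of_nat_0_le_iff order_trans power_mono)
      next
        assume "(real b)\<^sup>2 \<le> x - (real a)\<^sup>2"
        then show "real b \<le> y" unfolding y_def by (rule real_le_rsqrt)
      qed
      then show ?thesis by auto
    qed
    have "{p \<in> T. fst p = a} = (\<lambda>b. (a, b)) ` {b \<in> nset y. b \<in> sums_of_two_squares}"
      using iff b1 by (auto simp: T_def nset_def simp del: of_nat_add of_nat_power)
    then have "card {p \<in> T. fst p = a} = card {b \<in> nset y. b \<in> sums_of_two_squares}"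
      by (simp add: card_image inj_on_def)
    moreover have "BR y = (\<Sum>b\<in>{b \<in> nset y. b \<in> sums_of_two_squares}. 1)"
      unfolding BR_def summ_def indR_def by (subst sum.inter_filter) simp_all
    ultimately show "(\<Sum>p\<in>{p \<in> T. fst p = a}. 1) = BR (sqrt (x - (real a)\<^sup>2))" by (simp add: y_def)
  qed
  finally show ?thesis by (simp add: N_def)
qed

lemma sum_r_R_asymp:
  "\<exists>K x0. \<forall>x\<ge>x0. \<bar>(\<Sum>n | n \<ge> 1 \<and> real n \<le> x. real (r_R n)) - pi / 4 * PR * (x / sqrt (ln x))\<bar> \<le> K * (x / (ln x * sqrt (ln x)))"
proof -
  obtain K where K: "K > 0" "\<And>y. y \<ge> exp 1 \<Longrightarrow> \<bar>BR y - PR / sqrt 2 * (y / sqrt (ln y))\<bar> \<le> K * (y / (ln y * sqrt (ln y)))"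
    using BR_asymp by blast
  obtain K1 where K1: "K1 > 0" "\<And>x :: real. x \<ge> 1 \<Longrightarrow> (1 + ln x) powr (3/2) \<le> K1 * x powr (1/4)"
    using one_plus_ln_powr_le[of "3/2" "1/4"] by auto
  have P: "PR \<ge> 1" by (rule PR_ge_1)
  define M where "M = 8 * K + 4 * PR + (1 + PR) * K1"
  have M: "M > 0" using K K1 P by (auto simp: M_def intro!: add_pos_pos mult_pos_pos)
  have main: "\<bar>(\<Sum>n | n \<ge> 1 \<and> real n \<le> x. real (r_R n)) - pi / 4 * PR * (x / sqrt (ln x))\<bar> \<le> (2 * M + PR * K1) * (x / (ln x * sqrt (ln x)))"
    if x: "x \<ge> exp 4" for x
  proof -
    define L where "L = ln x"
    define X where "X = sqrt x"
    have x1: "x \<ge> 1" using x exp_ge_add_one_self[of 4] by linarith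
    have L: "L \<ge> 4" using x x1 by (simp add: L_def ln_ge_iff)
    have X: "X \<ge> 1" "X\<^sup>2 = x" using x1 by (auto simp: X_def)
    define Q where "Q = L * sqrt L"
    have sL: "sqrt L \<ge> 2" using L real_sqrt_le_mono[of 4 L] by simp
    have Q: "Q > 0" using L sL by (simp add: Q_def)
    have QK: "Q \<le> K1 * x powr (1/4)"
    proof -
      have "Q = L powr 1 * L powr (1/2)" using L by (simp add: Q_def powr_half_sqrt)
      also have "\<dots> = L powr (3/2)" by (subst powr_add[symmetric]) simp
      also have "\<dots> \<le> (1 + L) powr (3/2)" using L by (intro powr_mono2) auto
      also have "\<dots> \<le> K1 * x powr (1/4)" unfolding L_def by (rule K1(2)[OF x1])
      finally show ?thesis .
    qed
    have q4: "x powr (1/4) * x powr (1/4) = X" using x1 by (simp add: X_def powr_half_sqrt flip: powr_add)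
    have q4': "x powr (1/4) \<le> K1 * (X / Q)"
    proof -
      have "x powr (1/4) * Q \<le> x powr (1/4) * (K1 * x powr (1/4))" using QK by (intro mult_left_mono) auto
      also have "\<dots> = K1 * X" using q4 by (simp add: mult_ac)
      finally show ?thesis using Q by (simp add: pos_le_divide_eq)
    qed
    have each: "\<bar>BR (sqrt (x - (real a)\<^sup>2)) - PR / sqrt L * sqrt (x - (real a)\<^sup>2)\<bar> \<le> M * (X / Q)"
      if a: "a \<le> nat \<lfloor>X\<rfloor>" for a
    proof -
      define z where "z = x - (real a)\<^sup>2"
      define y where "y = sqrt z"
      have "real a \<le> real (nat \<lfloor>X\<rfloor>)" using a by simp
      also have "\<dots> \<le> X" using X by (intro of_nat_floor) simp
      finally have "real a \<le> X" .
      then have "(real a)\<^sup>2 \<le> X\<^sup>2" by (intro power_mono) auto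
      then have z: "0 \<le> z" "z \<le> x" using X by (auto simp: z_def)
      have y: "0 \<le> y" "y \<le> X" using z by (auto simp: y_def X_def)
      have XQ: "X / Q \<ge> 0" using X Q by simp
      show ?thesis
      proof (cases "z \<ge> X")
        case True
        have z1: "z \<ge> 1" using True X by linarith
        define l where "l = ln z"
        have "ln X = L / 2" using x1 by (simp add: X_def L_def ln_sqrt)
        moreover have "ln X \<le> ln z" using True X by (subst ln_le_cancel_iff) auto
        ultimately have l: "L / 2 \<le> l" "l \<le> L" using z z1 x1 by (auto simp: l_def L_def)
        have ly: "ln y = l / 2" using z1 by (simp add: y_def l_def ln_sqrt)
        have y1: "y \<ge> 1" using z1 by (simp add: y_def)
        have "ln y \<ge> 1" using l L ly by simp
        then have "exp 1 \<le> y" using y1 by (simp add: ln_ge_iff)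
        then have "\<bar>BR y - PR / sqrt 2 * (y / sqrt (l / 2))\<bar> \<le> K * (y / (l / 2 * sqrt (l / 2)))" using K(2)[of y] ly by simp
        also have "PR / sqrt 2 * (y / sqrt (l / 2)) = PR * y / sqrt l" by (simp add: real_sqrt_divide)
        also have "K * (y / (l / 2 * sqrt (l / 2))) \<le> K * (X / (L / 4 * (sqrt L / 2)))"
        proof -
          have "sqrt (L / 4) \<le> sqrt (l / 2)" using l by simp
          then have "sqrt L / 2 \<le> sqrt (l / 2)" by (simp add: real_sqrt_divide)
          then have "L / 4 * (sqrt L / 2) \<le> l / 2 * sqrt (l / 2)" using l L by (intro mult_mono) auto
          moreover have "L / 4 * (sqrt L / 2) > 0" using L by simp
          ultimately show ?thesis using K(1) y by (intro mult_left_mono frac_le) auto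
        qed
        also have "\<dots> = 8 * K * (X / Q)" by (simp add: Q_def)
        finally have A: "\<bar>BR y - PR * y / sqrt l\<bar> \<le> 8 * K * (X / Q)" .
        have sl: "sqrt l > 0" "sqrt l * sqrt l = l" using l L by auto
        have sLL: "sqrt L > 0" "sqrt L * sqrt L = L" using L by auto
        have sle: "sqrt l \<le> sqrt L" using l by simp
        have d0: "1 / sqrt l - 1 / sqrt L \<ge> 0" using sle sl by (simp add: frac_le)
        have d1: "1 / sqrt l - 1 / sqrt L \<le> 2 * (L - l) / Q"
        proof -
          have "sqrt (L / 4) \<le> sqrt l" using l L by simp
          then have hl: "sqrt L / 2 \<le> sqrt l" by (simp add: real_sqrt_divide)
          have "(sqrt L - sqrt l) * sqrt L \<le> (sqrt L - sqrt l) * (sqrt L + sqrt l)"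
            using sle sl by (intro mult_left_mono) auto
          also have "\<dots> = L - l" using sl sLL by (simp add: algebra_simps)
          finally have n: "(sqrt L - sqrt l) * sqrt L \<le> L - l" .
          have "1 / sqrt l - 1 / sqrt L = ((sqrt L - sqrt l) * sqrt L) / (sqrt l * (sqrt L * sqrt L))"
            using sl sLL(1) by (simp add: field_simps)
          also have "\<dots> \<le> (L - l) / (sqrt L / 2 * (sqrt L * sqrt L))"
          proof (rule frac_le)
            show "sqrt L / 2 * (sqrt L * sqrt L) \<le> sqrt l * (sqrt L * sqrt L)" using hl sLL by (intro mult_right_mono) auto
            show "0 < sqrt L / 2 * (sqrt L * sqrt L)" using sLL(1) by simp
          qed (use n l in auto)
          also have "\<dots> = 2 * (L - l) / Q" unfolding sLL(2) by (simp add: Q_def mult.commute)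
          finally show ?thesis .
        qed
        have yL: "y * (L - l) \<le> 2 * X"
        proof -
          have xz: "x / z \<ge> 1" using z z1 by simp
          have "L - l = ln (x / z)" using x1 z1 by (simp add: L_def l_def ln_divide_pos)
          also have "\<dots> = 2 * ln (sqrt (x / z))" using xz by (simp add: ln_sqrt)
          also have "\<dots> \<le> 2 * sqrt (x / z)" using ln_le_minus_one[of "sqrt (x / z)"] xz x1 z1 by simp
          finally have "y * (L - l) \<le> y * (2 * sqrt (x / z))" using y by (intro mult_left_mono) auto
          also have "\<dots> = 2 * X" using z1 by (simp add: y_def X_def real_sqrt_divide)
          finally show ?thesis .
        qed
        have "\<bar>PR * y / sqrt l - PR / sqrt L * y\<bar> = PR * y * (1 / sqrt l - 1 / sqrt L)"
        proof -
          have "PR * y / sqrt l - PR / sqrt L * y = PR * y * (1 / sqrt l - 1 / sqrt L)" by (simp add: right_diff_distrib)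
          moreover have "PR * y * (1 / sqrt l - 1 / sqrt L) \<ge> 0" using P y d0 by simp
          ultimately show ?thesis by simp
        qed
        also have "\<dots> \<le> PR * y * (2 * (L - l) / Q)" using P y d1 by (intro mult_left_mono) auto
        also have "\<dots> = 2 * PR / Q * (y * (L - l))" by simp
        also have "\<dots> \<le> 2 * PR / Q * (2 * X)" using P Q yL by (intro mult_left_mono) auto
        also have "\<dots> = 4 * PR * (X / Q)" by simp
        finally have B: "\<bar>PR * y / sqrt l - PR / sqrt L * y\<bar> \<le> 4 * PR * (X / Q)" .
        have "\<bar>BR y - PR / sqrt L * y\<bar> \<le> 8 * K * (X / Q) + 4 * PR * (X / Q)" using A B by linarith
        also have "\<dots> = (8 * K + 4 * PR) * (X / Q)" by (simp only: distrib_right)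
        also have "\<dots> \<le> M * (X / Q)" using XQ P K1(1) unfolding M_def by (intro mult_right_mono) auto
        finally show ?thesis by (simp add: y_def z_def)
      next
        case False
        have "y \<le> sqrt X" using False by (simp add: y_def)
        also have "sqrt X = x powr (1/4)" using x1 q4 by (metis powr_ge_zero real_sqrt_abs2 abs_of_nonneg)
        finally have y4: "y \<le> x powr (1/4)" .
        have "PR / sqrt L * y \<le> PR / 1 * y" using P sL L y by (intro mult_right_mono divide_left_mono) auto
        then have "PR / sqrt L * y \<le> PR * y" by simp
        moreover have "PR / sqrt L * y \<ge> 0" using P L y by simp
        moreover have "0 \<le> BR y" "BR y \<le> y" using BR_nonneg BR_le[OF y(1)] by auto
        ultimately have "\<bar>BR y - PR / sqrt L * y\<bar> \<le> y + PR * y" by linarith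
        also have "\<dots> = (1 + PR) * y" by (simp add: algebra_simps)
        also have "\<dots> \<le> (1 + PR) * (K1 * (X / Q))" using P y4 q4' by (intro mult_left_mono) auto
        also have "\<dots> = ((1 + PR) * K1) * (X / Q)" by simp
        also have "\<dots> \<le> M * (X / Q)" using XQ P K(1) unfolding M_def by (intro mult_right_mono) auto
        finally show ?thesis by (simp add: y_def z_def)
      qed
    qed
    define S where "S = (\<Sum>a\<le>nat \<lfloor>X\<rfloor>. sqrt (x - (real a)\<^sup>2))"
    have S: "\<bar>S - pi / 4 * x\<bar> \<le> X" using sum_sqrt_circle[of X] X by (simp add: S_def)
    have tot: "(\<Sum>n | n \<ge> 1 \<and> real n \<le> x. real (r_R n)) = (\<Sum>a\<le>nat \<lfloor>X\<rfloor>. BR (sqrt (x - (real a)\<^sup>2)))"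
      unfolding X_def by (rule sum_r_R_eq) (use x1 in simp)
    have "\<bar>(\<Sum>a\<le>nat \<lfloor>X\<rfloor>. BR (sqrt (x - (real a)\<^sup>2))) - PR / sqrt L * S\<bar> \<le> (\<Sum>a\<le>nat \<lfloor>X\<rfloor>. M * (X / Q))"
      unfolding S_def sum_distrib_left sum_subtractf[symmetric]
      by (rule order_trans[OF sum_abs], rule sum_mono) (use each in auto)
    also have "\<dots> = (real (nat \<lfloor>X\<rfloor>) + 1) * (M * (X / Q))" by simp
    also have "\<dots> \<le> (2 * X) * (M * (X / Q))"
    proof (rule mult_right_mono)
      show "real (nat \<lfloor>X\<rfloor>) + 1 \<le> 2 * X" using of_nat_floor[of X] X by linarith
    qed (use M X Q in simp)
    also have "\<dots> = 2 * M * (x / Q)" using X(2) by (simp add: power2_eq_square)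
    finally have A: "\<bar>(\<Sum>a\<le>nat \<lfloor>X\<rfloor>. BR (sqrt (x - (real a)\<^sup>2))) - PR / sqrt L * S\<bar> \<le> 2 * M * (x / Q)" .
    have "\<bar>PR / sqrt L * S - pi / 4 * PR * (x / sqrt L)\<bar> = PR / sqrt L * \<bar>S - pi / 4 * x\<bar>"
    proof -
      have "PR / sqrt L * S - pi / 4 * PR * (x / sqrt L) = PR / sqrt L * (S - pi / 4 * x)" by (simp add: right_diff_distrib mult_ac)
      moreover have "PR / sqrt L \<ge> 0" using P L by simp
      ultimately show ?thesis by (simp only: abs_mult abs_of_nonneg)
    qed
    also have "\<dots> \<le> PR / 1 * X" using S P sL L by (intro mult_mono divide_left_mono) auto
    also have "\<dots> \<le> PR * (K1 * (x / Q))"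
    proof -
      have "x powr (1/4) \<le> x powr (1/2)" using x1 by (intro powr_mono) auto
      then have "x powr (1/4) \<le> X" using x1 by (simp add: X_def powr_half_sqrt)
      then have "K1 * x powr (1/4) \<le> K1 * X" using K1(1) by (intro mult_left_mono) auto
      then have "Q \<le> K1 * X" using QK by linarith
      then have "X * Q \<le> X * (K1 * X)" using X by (intro mult_left_mono) auto
      also have "\<dots> = K1 * x" using X(2) by (simp add: power2_eq_square mult_ac)
      finally have "X \<le> K1 * (x / Q)" using Q by (simp add: pos_le_divide_eq)
      then have "PR * X \<le> PR * (K1 * (x / Q))" using P by (intro mult_left_mono) auto
      then show ?thesis by simp
    qed
    finally have B: "\<bar>PR / sqrt L * S - pi / 4 * PR * (x / sqrt L)\<bar> \<le> PR * K1 * (x / Q)" by (simp only: mult.assoc)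
    have "\<bar>(\<Sum>n | n \<ge> 1 \<and> real n \<le> x. real (r_R n)) - pi / 4 * PR * (x / sqrt L)\<bar> \<le> 2 * M * (x / Q) + PR * K1 * (x / Q)"
    proof -
      have "\<bar>a - c\<bar> \<le> p + q" if "\<bar>a - b\<bar> \<le> p" "\<bar>b - c\<bar> \<le> q" for a b c p q :: real
        using that by linarith
      from this[OF A B] show ?thesis unfolding tot .
    qed
    then show ?thesis by (simp only: distrib_right L_def Q_def)
  qed
  show ?thesis
    by (intro exI[of _ "2 * M + PR * K1"] exI[of _ "exp 4"] allI impI) (rule main)
qed

theorem lemma7p1p1:
  "\<exists>E :: real \<Rightarrow> real. E \<in> O[at_top](\<lambda>x. 1 / ln x) \<and>
     (\<forall>\<^sub>F x in at_top.
        (\<Sum>n | n \<ge> 1 \<and> real n \<le> x. real (r_R n)) = c_R * (x / sqrt (ln x)) * (1 + E x))"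
proof -
  obtain K x0 where K: "\<And>x. x \<ge> x0 \<Longrightarrow>
      \<bar>(\<Sum>n | n \<ge> 1 \<and> real n \<le> x. real (r_R n)) - pi / 4 * PR * (x / sqrt (ln x))\<bar> \<le> K * (x / (ln x * sqrt (ln x)))"
    using sum_r_R_asymp by blast
  have c: "c_R = pi / 4 * PR" by (simp add: c_R_def PR_def)
  have c0: "c_R > 0" using PR_ge_1 by (simp add: c)
  define S where "S = (\<lambda>x. \<Sum>n | n \<ge> 1 \<and> real n \<le> x. real (r_R n))"
  define E where "E = (\<lambda>x. S x / (c_R * (x / sqrt (ln x))) - 1)"
  have big: "\<forall>\<^sub>F x in at_top. x \<ge> max x0 (exp 1)" by (rule eventually_ge_at_top)
  have pos: "c_R * (x / sqrt (ln x)) > 0" if "x \<ge> exp 1" for x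
  proof -
    have "x > 1" using that exp_gt_one[of 1] by linarith
    then show ?thesis using c0 by simp
  qed
  have "E \<in> O[at_top](\<lambda>x. 1 / ln x)"
  proof (rule landau_o.bigI[of "\<bar>K\<bar> / c_R + 1"])
    show "\<bar>K\<bar> / c_R + 1 > 0" using c0 by (simp add: add_nonneg_pos)
    show "\<forall>\<^sub>F x in at_top. norm (E x) \<le> (\<bar>K\<bar> / c_R + 1) * norm (1 / ln x)"
      using big
    proof eventually_elim
      case (elim x)
      have x1: "x > 1" using elim exp_gt_one[of 1] by linarith
      define m where "m = c_R * (x / sqrt (ln x))"
      have m: "m > 0" unfolding m_def using elim by (intro pos) auto
      have "E x = S x / m - 1" by (simp only: E_def m_def)
      then have "E x = (S x - m) / m" using m by (simp add: diff_divide_distrib)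
      then have "\<bar>E x\<bar> = \<bar>S x - m\<bar> / m" using m by simp
      also have "\<dots> \<le> \<bar>K\<bar> * (x / (ln x * sqrt (ln x))) / m"
      proof (rule divide_right_mono)
        have "\<bar>S x - m\<bar> \<le> K * (x / (ln x * sqrt (ln x)))" using K[of x] elim by (simp add: S_def m_def c)
        also have "\<dots> \<le> \<bar>K\<bar> * (x / (ln x * sqrt (ln x)))" using x1 by (intro mult_right_mono) auto
        finally show "\<bar>S x - m\<bar> \<le> \<bar>K\<bar> * (x / (ln x * sqrt (ln x)))" .
      qed (use m in simp)
      also have "\<dots> = \<bar>K\<bar> / c_R * (1 / ln x)" using x1 c0 by (simp add: m_def field_simps)
      also have "\<dots> \<le> (\<bar>K\<bar> / c_R + 1) * (1 / ln x)" using x1 by (intro mult_right_mono) auto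
      finally show ?case using x1 by simp
    qed
  qed
  moreover have "\<forall>\<^sub>F x in at_top. S x = c_R * (x / sqrt (ln x)) * (1 + E x)"
    using big
  proof eventually_elim
    case (elim x)
    then have "exp 1 \<le> x" by simp
    then have "c_R * (x / sqrt (ln x)) \<noteq> 0" by (metis pos less_irrefl)
    moreover have "s = m * (1 + (s / m - 1))" if "m \<noteq> 0" for s m :: real using that by simp
    ultimately show ?case unfolding E_def by blast
  qed
  ultimately show ?thesis unfolding S_def by blast
qed

end
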